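(* Let $0<\delta<1$ and let $\{\Omega_N\}_{N\in\mathbb{N}}$ be a uniformly $\delta$-dense sequence of sampling points with bandwidths $\{K_N\}_{N\in\mathbb{N}}$. For nodes $0=w_0<w_1<\dots<w_k<w_{k+1}=1$, $w=\{w_1,\dots,w_k\}$, and degrees $M=\{M_0,\dots,M_k\}\in\mathbb{N}^{k+1}$, consider the piecewise polynomial spaces $$\mathrm{T}_{w,M}=\{f\in L^2(0,1): f|_{[w_j,w_{j+1})}\in\mathbb{P}_{M_j},\ j=0,\dots,k\},$$ and put $\eta=\min_{j=0,\dots,k}\{w_{j+1}-w_j\}$ and $M_{\max}=\max\{M_0,\dots,M_k\}$. Then a sufficient condition for the weighted least-squares reconstruction from $\mathrm{T}_{w,M}$ using the samples at $\Omega_N$ to be stable and quasi-optimal is the scaling $$\frac{M_{\max}^2}{\eta}=\mathcal{O}(K_N),\qquad N\to\infty.$$ In particular, when $\eta$ is fixed and $M_{\max}$ is varied this is the square-root scaling $M_{\max}=\mathcal{O}(\sqrt{K_N})$, and when $M_{\max}$ is fixed and $\eta$ is varied it is the linear scaling $1/\eta=\mathcal{O}(K_N)$.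
   Context: $\mathbb{P}_m$ is the space of algebraic polynomials of degree at most $m$; $\mathrm{H}=L^2(0,1)$ with its usual norm $\|\cdot\|$; $\hat f(\omega)=\int_0^1 f(x)e^{-2\pi i\omega x}\,dx$ for $\omega\in\mathbb{R}$. Sampling points: $\Omega_N=\{\omega_{n,N}\}_{n=1}^N\subseteq\mathbb{R}$ with $\omega_{1,N}<\dots<\omega_{N,N}$. The sequence $\{\Omega_N\}_{N\in\mathbb{N}}$ is uniformly $\delta$-dense with bandwidths $\{K_N\}\subseteq[0,\infty)$ if (i) $K_N\to\infty$ as $N\to\infty$ and $\Omega_N\subseteq[-K_N,K_N]$; and (ii) for each $N$, $\max_{n=0,\dots,N}\{\omega_{n+1,N}-\omega_{n,N}\}\le\delta$, where $\omega_{0,N}=\omega_{N,N}-2K_N$ and $\omega_{N+1,N}=\omega_{1,N}+2K_N$. Weighted least-squares reconstruction of $f\in\mathrm{H}$ from a finite-dimensional subspace $\mathrm{T}\subseteq\mathrm{H}$: $$f_{N,\mathrm{T}}=\underset{g\in\mathrm{T}}{\operatorname{argmin}}\sum_{n=1}^N\mu_{n,N}\left|\hat f(\omega_{n,N})-\hat g(\omega_{n,N})\right|^2,\qquad \mu_{n,N}=\tfrac12(\omega_{n+1,N}-\omega_{n-1,N}).$$ Stability and quasi-optimality: let $C_1$ be the largest and $C_2$ the smallest constant such that $\sum_{n=1}^N\mu_{n,N}|\hat f(\omega_{n,N})|^2\ge C_1\|f\|^2$ for all $f\in\mathrm{T}$ and $\sum_{n=1}^N\mu_{n,N}|\hat f(\omega_{n,N})|^2\le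 C_2\|f\|^2$ for all $f\in\mathrm{H}$, and let $C=\sqrt{C_2/C_1}$. Then $\|f-f_{N,\mathrm{T}}\|\le C\inf_{g\in\mathrm{T}}\|f-g\|$ and $\|f_{N,\mathrm{T}}\|\le C\|f\|$ for all $f\in\mathrm{H}$. The reconstruction is regarded as stable and quasi-optimal when $C$ is finite and bounded.
   Formalization: The scaling O(K_N) (likewise in the special cases) is read with a sufficiently small implied constant, since for large constants dim T can exceed the number of samples; in the main claim M_max ≥ 1 is assumed, as M_max = 0 would put no restriction on η. *)

theory Defs
  imports "HOL-Analysis.Analysis" "HOL-Computational_Algebra.Polynomial"
begin

section \<open>The space \<open>L\<^sup>2(0,1)\<close>\<close>

text \<open>Elements of \<open>L\<^sup>2(0,1)\<close> are represented by functions on the reals, of which only the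
  restriction to \<open>(0,1)\<close> matters and which are identified when \<open>l2norm\<close> of their difference
  vanishes.\<close>

definition L2_01 :: "(real \<Rightarrow> complex) set" where
  "L2_01 = {f. f \<in> borel_measurable (lebesgue_on {0<..<1}) \<and>
           integrable (lebesgue_on {0<..<1}) (\<lambda>x. (cmod (f x))\<^sup>2)}"

definition l2norm :: "(real \<Rightarrow> complex) \<Rightarrow> real" where
  "l2norm f = sqrt (LINT x|lebesgue_on {0<..<1}. (cmod (f x))\<^sup>2)"

definition fourier :: "(real \<Rightarrow> complex) \<Rightarrow> real \<Rightarrow> complex" where
  "fourier f \<omega> =
     (LINT x|lebesgue_on {0<..<1}. f x * exp (- 2 * of_real pi * \<i> * of_real \<omega> * of_real x))"


section \<open>Sampling points\<close>

text \<open>\<open>\<Omega> N n\<close> is \<open>\<omega>\<^bsub>n,N\<^esub>\<close> for \<open>n = 1..N\<close>; all other values of \<open>\<Omega> N\<close>, as well as everything at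
  \<open>N = 0\<close>, are irrelevant. \<open>extpt\<close> adds the two outer points \<open>n = 0\<close> and \<open>n = N + 1\<close>.\<close>

definition extpt :: "(nat \<Rightarrow> nat \<Rightarrow> real) \<Rightarrow> (nat \<Rightarrow> real) \<Rightarrow> nat \<Rightarrow> nat \<Rightarrow> real" where
  "extpt \<Omega> K N n =
     (if n = 0 then \<Omega> N N - 2 * K N
      else if n = N + 1 then \<Omega> N 1 + 2 * K N
      else \<Omega> N n)"

definition uniformly_dense ::
    "real \<Rightarrow> (nat \<Rightarrow> nat \<Rightarrow> real) \<Rightarrow> (nat \<Rightarrow> real) \<Rightarrow> bool" where
  "uniformly_dense \<delta> \<Omega> K \<longleftrightarrow>
     filterlim K at_top sequentially \<and>
     (\<forall>N\<ge>1. 0 \<le> K N \<and>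
        strict_mono_on {1..N} (\<Omega> N) \<and>
        \<Omega> N ` {1..N} \<subseteq> {- K N..K N} \<and>
        (\<forall>n\<in>{0..N}. extpt \<Omega> K N (n + 1) - extpt \<Omega> K N n \<le> \<delta>))"

definition weight :: "(nat \<Rightarrow> nat \<Rightarrow> real) \<Rightarrow> (nat \<Rightarrow> real) \<Rightarrow> nat \<Rightarrow> nat \<Rightarrow> real" where
  "weight \<Omega> K N n = (extpt \<Omega> K N (n + 1) - extpt \<Omega> K N (n - 1)) / 2"

definition sample_energy ::
    "(nat \<Rightarrow> nat \<Rightarrow> real) \<Rightarrow> (nat \<Rightarrow> real) \<Rightarrow> nat \<Rightarrow> (real \<Rightarrow> complex) \<Rightarrow> real" where
  "sample_energy \<Omega> K N f = (\<Sum>n=1..N. weight \<Omega> K N n * (cmod (fourier f (\<Omega> N n)))\<^sup>2)"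


section \<open>Weighted least-squares reconstruction\<close>

definition is_ls_reconstruction ::
    "(nat \<Rightarrow> nat \<Rightarrow> real) \<Rightarrow> (nat \<Rightarrow> real) \<Rightarrow> nat \<Rightarrow> (real \<Rightarrow> complex) set
      \<Rightarrow> (real \<Rightarrow> complex) \<Rightarrow> (real \<Rightarrow> complex) \<Rightarrow> bool" where
  "is_ls_reconstruction \<Omega> K N T f h \<longleftrightarrow>
     is_arg_min
       (\<lambda>g. \<Sum>n=1..N. weight \<Omega> K N n * (cmod (fourier f (\<Omega> N n) - fourier g (\<Omega> N n)))\<^sup>2)
       (\<lambda>g. g \<in> T) h"

text \<open>The sets below are closed, nonempty (they contain \<open>0\<close>, resp. the sum of the weights) and
  bounded above (when \<open>T\<close> contains an element of positive norm), resp. below, so that the supremum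
  and the infimum are the largest and the smallest admissible constant. As \<open>x / 0 = 0\<close> in HOL,
  \<open>const_C\<close> has its intended meaning only if \<open>const_C1\<close> is positive; this is what finiteness of
  the constant \<open>C\<close> amounts to.\<close>

definition const_C1 ::
    "(nat \<Rightarrow> nat \<Rightarrow> real) \<Rightarrow> (nat \<Rightarrow> real) \<Rightarrow> nat \<Rightarrow> (real \<Rightarrow> complex) set \<Rightarrow> real" where
  "const_C1 \<Omega> K N T = Sup {c. \<forall>f\<in>T. sample_energy \<Omega> K N f \<ge> c * (l2norm f)\<^sup>2}"

definition const_C2 :: "(nat \<Rightarrow> nat \<Rightarrow> real) \<Rightarrow> (nat \<Rightarrow> real) \<Rightarrow> nat \<Rightarrow> real" where
  "const_C2 \<Omega> K N = Inf {c. \<forall>f\<in>L2_01. sample_energy \<Omega> K N f \<le> c * (l2norm f)\<^sup>2}"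

definition const_C ::
    "(nat \<Rightarrow> nat \<Rightarrow> real) \<Rightarrow> (nat \<Rightarrow> real) \<Rightarrow> nat \<Rightarrow> (real \<Rightarrow> complex) set \<Rightarrow> real" where
  "const_C \<Omega> K N T = sqrt (const_C2 \<Omega> K N / const_C1 \<Omega> K N T)"

text \<open>Asymptotically in \<open>N\<close>, the constant \<open>C\<close> is finite and bounded, and it controls the
  reconstruction from \<open>T N\<close> (any minimiser: minimisers are unique only up to null sets).\<close>

definition stable_quasi_optimal ::
    "(nat \<Rightarrow> nat \<Rightarrow> real) \<Rightarrow> (nat \<Rightarrow> real) \<Rightarrow> (nat \<Rightarrow> (real \<Rightarrow> complex) set) \<Rightarrow> bool" where
  "stable_quasi_optimal \<Omega> K T \<longleftrightarrow>
     (\<exists>B. \<forall>\<^sub>F N in sequentially.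
        0 < const_C1 \<Omega> K N (T N) \<and> const_C \<Omega> K N (T N) \<le> B \<and>
        (\<forall>f\<in>L2_01.
           (\<exists>h. is_ls_reconstruction \<Omega> K N (T N) f h) \<and>
           (\<forall>h. is_ls_reconstruction \<Omega> K N (T N) f h \<longrightarrow>
              l2norm (\<lambda>x. f x - h x)
                \<le> const_C \<Omega> K N (T N) * (INF g\<in>T N. l2norm (\<lambda>x. f x - g x)) \<and>
              l2norm h \<le> const_C \<Omega> K N (T N) * l2norm f)))"


section \<open>Piecewise polynomials\<close>

definition is_nodes :: "nat \<Rightarrow> (nat \<Rightarrow> real) \<Rightarrow> bool" where
  "is_nodes k w \<longleftrightarrow> w 0 = 0 \<and> w (k + 1) = 1 \<and> (\<forall>j\<le>k. w j < w (j + 1))"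

definition piecewise_poly :: "nat \<Rightarrow> (nat \<Rightarrow> real) \<Rightarrow> (nat \<Rightarrow> nat) \<Rightarrow> (real \<Rightarrow> complex) set" where
  "piecewise_poly k w M =
     {f \<in> L2_01. \<forall>j\<le>k. \<exists>p :: complex poly. degree p \<le> M j \<and>
        (AE x in lebesgue_on {w j..<w (j + 1)}. f x = poly p (of_real x))}"

definition min_gap :: "nat \<Rightarrow> (nat \<Rightarrow> real) \<Rightarrow> real" where
  "min_gap k w = Min ((\<lambda>j. w (j + 1) - w j) ` {0..k})"

definition max_deg :: "nat \<Rightarrow> (nat \<Rightarrow> nat) \<Rightarrow> nat" where
  "max_deg k M = Max (M ` {0..k})"

end

theory Submission
  imports Defs
begin

text \<open>Let \<open>F\<close> be the transform of \<open>f\<close>, centred so that \<open>\<parallel>F'\<parallel> \<le> \<pi>\<parallel>f\<parallel>\<close>. On each Voronoi cell of a sampling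
  point, Wirtinger's inequality compares \<open>F\<close> with its sample, and the total error is at most \<open>\<theta>\<parallel>f\<parallel>\<close> for
  any \<open>\<theta> > \<delta>\<close>. Hence the sampled energy is at most \<open>4\<parallel>f\<parallel>\<^sup>2\<close>, and it is bounded below as soon as the
  energy of \<open>F\<close> in \<open>[-R,R]\<close>, with \<open>R\<close> close to \<open>K\<^sub>N\<close>, exceeds \<open>\<theta>\<parallel>f\<parallel>\<^sup>2\<close>.

  For a piecewise polynomial \<open>f\<close> this concentration holds because \<open>f\<close> is close to a continuous piecewise
  polynomial \<open>g\<close> vanishing at the nodes with \<open>\<parallel>g'\<parallel>\<close> at most a multiple of \<open>(M\<^sub>m\<^sub>a\<^sub>x + 1)\<^sup>2\<parallel>f\<parallel>/\<eta>\<close>, by the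
  weighted Bernstein inequality; the energy of the transform of \<open>g\<close> outside \<open>[-R,R]\<close> is then at most
  \<open>\<parallel>g'\<parallel>\<^sup>2/(2\<pi>R)\<^sup>2\<close>. Plancherel's theorem is replaced by Bessel's inequality and Parseval's identity for
  the frequencies \<open>n + t\<close>, \<open>n \<in> \<int>\<close>, integrated over \<open>t \<in> [0,1]\<close>.\<close>

section \<open>A weighted Bernstein inequality\<close>

text \<open>A function in the space jumps at the nodes, so bounds on its piecewise derivative say
  nothing about the energy outside a window: piecewise constants have derivative zero, and their
  transforms still decay only like 1/\<open>\<omega>\<close>. Hence the cutoff that kills each piece
  at its two ends. Its boundary layer is thinner than the piece by a factor of order (degree + 1)^2,
  because a polynomial can concentrate that strongly at an endpoint; this is where the square of the
  degree comes from. The weight \<open>(x - a) * (b - x)\<close> serves twice: it shows that the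
  layer carries little mass, and it bounds the derivative of the product.

  The restriction \<open>\<delta> < 1\<close> is the balance of two constants: a cell reaches at
  most \<open>\<delta> / 2\<close> to each side of its sample, where Wirtinger's constant is
  \<open>\<delta> / pi\<close>, and the centred derivative contributes the factor \<open>pi\<close>.

  The implied constant of the scaling has to be small, depending on \<open>\<delta>\<close>:
  equispaced samples with gap \<open>\<delta>\<close> number about 2 K / \<open>\<delta>\<close>,
  and a large constant would admit spaces of larger dimension, on which the lower constant cannot be
  positive.\<close>

definition poly_ip :: "real \<Rightarrow> real \<Rightarrow> real poly \<Rightarrow> real poly \<Rightarrow> real" where
  "poly_ip a b p q = integral {a..b} (\<lambda>x. poly p x * poly q x)"

lemma integrable_poly [simp]: "(\<lambda>x::real. poly p x) integrable_on {a..b}"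
  by (intro integrable_continuous_interval continuous_intros)

lemma integrable_poly_mult [simp]: "(\<lambda>x::real. poly p x * poly q x) integrable_on {a..b}"
  by (intro integrable_continuous_interval continuous_intros)

lemma poly_ip_commute: "poly_ip a b p q = poly_ip a b q p"
  by (simp add: poly_ip_def mult.commute)

lemma poly_ip_add_left: "poly_ip a b (p + q) r = poly_ip a b p r + poly_ip a b q r"
  unfolding poly_ip_def by (simp add: distrib_right integral_add)

lemma poly_ip_smult_left: "poly_ip a b (smult c p) r = c * poly_ip a b p r"
  unfolding poly_ip_def by (simp add: mult.assoc)

lemma poly_ip_diff_left: "poly_ip a b (p - q) r = poly_ip a b p r - poly_ip a b q r"
  unfolding poly_ip_def by (simp add: left_diff_distrib integral_diff)

lemma poly_ip_add_right: "poly_ip a b r (p + q) = poly_ip a b r p + poly_ip a b r q"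
  by (metis poly_ip_commute poly_ip_add_left)

lemma poly_ip_smult_right: "poly_ip a b r (smult c p) = c * poly_ip a b r p"
  by (metis poly_ip_commute poly_ip_smult_left)

lemma poly_ip_zero_left [simp]: "poly_ip a b 0 r = 0"
  unfolding poly_ip_def by simp

lemma poly_ip_nonneg: "0 \<le> poly_ip a b p p"
  unfolding poly_ip_def by (intro integral_nonneg) auto

lemma poly_ip_eq_0:
  assumes "a < b" "poly_ip a b p p = 0"
  shows "p = 0"
proof (rule ccontr)
  assume "p \<noteq> 0"
  have "integral {a..b} (\<lambda>x. poly p x * poly p x) = 0"
    using assms(2) by (simp add: poly_ip_def)
  moreover have "continuous_on {a..b} (\<lambda>x. poly p x * poly p x)" by (intro continuous_intros)
  ultimately have "\<forall>x\<in>{a..b}. poly p x * poly p x = 0"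
    using integral_eq_0_iff[of a b "\<lambda>x. poly p x * poly p x"] assms(1) by simp
  then have "{a..b} \<subseteq> {x. poly p x = 0}" by auto
  moreover have "infinite {a..b}" using assms by simp
  ultimately show False using poly_roots_finite[OF \<open>p \<noteq> 0\<close>] finite_subset by blast
qed

lemma integral_pderiv:
  fixes p :: "real poly"
  assumes "a \<le> b"
  shows "integral {a..b} (poly (pderiv p)) = poly p b - poly p a"
proof -
  have "(poly (pderiv p) has_integral (poly p b - poly p a)) {a..b}"
    using assms by (intro fundamental_theorem_of_calculus)
      (auto simp flip: has_real_derivative_iff_has_vector_derivative intro!: DERIV_subset[OF poly_DERIV])
  then show ?thesis by (rule integral_unique)
qed

text \<open>Gram-Schmidt inside an induction: \<open>q\<close> below is the monic orthogonal
  polynomial of degree \<open>n\<close>, and the new projection adds the component along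
  \<open>q\<close>. As the zero polynomial has degree 0, the disjunction
  \<open>r = 0 \<or> degree r < n\<close> is what makes \<open>n = 0\<close> stand for the zero
  space.\<close>

lemma poly_projection:
  assumes "a < b"
  shows "\<exists>r. (r = 0 \<or> degree r < n) \<and> (\<forall>s. s = 0 \<or> degree s < n \<longrightarrow> poly_ip a b (p - r) s = 0)"
proof (induction n arbitrary: p)
  case 0
  then show ?case by (auto intro!: exI[of _ 0] simp: poly_ip_commute[of a b _ 0])
next
  case (Suc n)
  have aux: "s = 0 \<or> degree s < Suc m \<longleftrightarrow> degree s < Suc m" for s :: "real poly" and m
    by auto
  define m where "m = (monom 1 n :: real poly)"
  obtain r1 where r1: "r1 = 0 \<or> degree r1 < n" "\<And>s. s = 0 \<or> degree s < n \<Longrightarrow> poly_ip a b (m - r1) s = 0"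
    using Suc[of m] by auto
  obtain r2 where r2: "r2 = 0 \<or> degree r2 < n" "\<And>s. s = 0 \<or> degree s < n \<Longrightarrow> poly_ip a b (p - r2) s = 0"
    using Suc[of p] by auto
  define q where "q = m - r1"
  have cq: "coeff q n = 1" using r1(1) by (auto simp: q_def m_def coeff_eq_0)
  have dq: "degree q \<le> n" using r1(1) unfolding q_def m_def
    by (intro degree_diff_le) (auto simp: degree_monom_le)
  have "poly_ip a b q q \<noteq> 0" using cq poly_ip_eq_0[OF assms, of q] by auto
  define r where "r = r2 + smult (poly_ip a b p q / poly_ip a b q q) q"
  have dr: "degree r < Suc n" using r2(1) dq unfolding r_def less_Suc_eq_le
    by (intro degree_add_le order_trans[OF degree_smult_le]) auto
  have "poly_ip a b (p - r) s = 0" if "degree s < Suc n" for s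
  proof -
    define t where "t = s - smult (coeff s n) q"
    have "degree t \<le> n" unfolding t_def using that dq
      by (intro degree_diff_le order_trans[OF degree_smult_le]) auto
    moreover have "coeff t n = 0" by (simp add: t_def cq)
    ultimately have t: "t = 0 \<or> degree t < n"
      by (metis eq_zero_or_degree_less)
    have s: "s = t + smult (coeff s n) q" by (simp add: t_def)
    have "poly_ip a b q r2 = 0" "poly_ip a b q t = 0" using r1 r2(1) t q_def by auto
    have "p - r = (p - r2) - smult (poly_ip a b p q / poly_ip a b q q) q"
      by (simp add: r_def)
    then have "poly_ip a b (p - r) t = 0"
      using r2(2)[OF t] \<open>poly_ip a b q t = 0\<close>
      by (simp only: poly_ip_diff_left poly_ip_smult_left mult_zero_right diff_zero)
    moreover have "poly_ip a b (p - r) q = 0"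
      using \<open>poly_ip a b q r2 = 0\<close> \<open>poly_ip a b q q \<noteq> 0\<close> unfolding r_def
      by (simp add: poly_ip_diff_left poly_ip_smult_left poly_ip_add_left poly_ip_commute[of a b r2 q])
    ultimately have "poly_ip a b (p - r) (t + smult (coeff s n) q) = 0"
      unfolding poly_ip_add_right poly_ip_smult_right by simp
    then show ?thesis using s by simp
  qed
  then show ?case using dr by (metis degree_0 zero_less_Suc)
qed

section \<open>The Sturm-Liouville operator with weight (x - a)(b - x) and its spectrum\<close>

definition legendre_op :: "real \<Rightarrow> real \<Rightarrow> real poly \<Rightarrow> real poly" where
  "legendre_op a b p = pderiv ([:- a * b, a + b, -1:] * pderiv p)"

text \<open>The quadratic factor is (x - a)(b - x); it vanishes at both ends, so integration by
  parts leaves no boundary term.\<close>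

lemma legendre_op_parts:
  assumes "a \<le> b"
  shows "poly_ip a b (legendre_op a b p) r
    = - poly_ip a b ([:- a * b, a + b, -1:] * pderiv p) (pderiv r)"
proof -
  let ?W = "[:- a * b, a + b, -1:]"
  have W: "poly ?W a = 0" "poly ?W b = 0" by (auto simp: algebra_simps)
  have "integral {a..b} (poly (pderiv (?W * pderiv p * r))) = 0"
    using W by (subst integral_pderiv[OF assms]) (simp add: algebra_simps)
  also have "poly (pderiv (?W * pderiv p * r))
    = (\<lambda>x. poly (legendre_op a b p) x * poly r x + poly (?W * pderiv p) x * poly (pderiv r) x)"
    unfolding legendre_op_def pderiv_mult[of "?W * pderiv p" r] by (auto simp del: mult_pCons_left simp: algebra_simps)
  finally show ?thesis
    unfolding poly_ip_def by (subst (asm) integral_add[OF integrable_poly_mult integrable_poly_mult]) linarith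
qed

lemma legendre_op_symmetric:
  assumes "a \<le> b"
  shows "poly_ip a b (legendre_op a b p) r = poly_ip a b p (legendre_op a b r)"
proof -
  have "poly_ip a b ([:- a * b, a + b, -1:] * pderiv p) (pderiv r) =
      poly_ip a b ([:- a * b, a + b, -1:] * pderiv r) (pderiv p)"
    unfolding poly_ip_def poly_mult by (simp only: mult_ac)
  then show ?thesis using assms legendre_op_parts poly_ip_commute by metis
qed

text \<open>In the monomial basis the operator is triangular with diagonal entries
  \<open>- n * (n + 1)\<close>. This shows both that it does not raise degrees and what its
  eigenvalues are.\<close>

lemma coeff_legendre_op:
  "coeff (legendre_op a b p) n
     = - real (n * (n + 1)) * coeff p n + (a + b) * real ((n + 1)^2) * coeff p (n + 1)
       - a * b * real ((n + 1) * (n + 2)) * coeff p (n + 2)"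
  by (cases n) (simp_all add: legendre_op_def coeff_pderiv algebra_simps power2_eq_square)

lemma degree_legendre_op: "degree p \<le> n \<Longrightarrow> degree (legendre_op a b p) \<le> n"
  by (intro degree_le) (auto simp: coeff_legendre_op coeff_eq_0)

text \<open>The component of \<open>p\<close> orthogonal to all polynomials of degree less than \<open>n\<close> is an eigenvector of
  the symmetric Legendre operator, with eigenvalue \<open>- n (n + 1)\<close>.\<close>

lemma bernstein_poly_ip:
  assumes "a < b" "degree p \<le> n"
  shows "poly_ip a b ([:- a * b, a + b, -1:] * pderiv p) (pderiv p) \<le> real (n * (n + 1)) * poly_ip a b p p"
  using assms(2)
proof (induction n arbitrary: p)
  case 0
  then have "pderiv p = 0" by (simp add: pderiv_eq_0_iff)
  then show ?case by simp
next
  case (Suc n)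
  define E where "E = (\<lambda>p r. poly_ip a b ([:- a * b, a + b, -1:] * pderiv p) (pderiv r))"
  define c where "c = real (Suc n * (Suc n + 1))"
  have ab: "a \<le> b" using assms by simp
  obtain r where r: "r = 0 \<or> degree r < Suc n"
    "\<And>s. s = 0 \<or> degree s < Suc n \<Longrightarrow> poly_ip a b (p - r) s = 0"
    using poly_projection[OF \<open>a < b\<close>, of "Suc n" p] by blast
  define q where "q = p - r"
  \<comment> \<open>The leading coefficients of \<open>legendre_op a b q\<close> and
    \<open>- c * q\<close> agree, so \<open>l\<close> has degree at most \<open>n\<close>. By
    symmetry of the operator \<open>l\<close> is also orthogonal to all polynomials of that degree,
    hence to itself, and vanishes.\<close>
  define l where "l = legendre_op a b q + smult c q"
  have dr: "degree r \<le> n" using r(1) by auto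
  then have dq: "degree q \<le> Suc n" using Suc.prems unfolding q_def by (intro degree_diff_le) auto
  have "degree l \<le> Suc n" unfolding l_def
    using degree_legendre_op[OF dq, of a b] dq
    by (intro degree_add_le order_trans[OF degree_smult_le]) auto
  moreover have "coeff l (Suc n) = 0"
    using dq by (simp add: l_def c_def coeff_legendre_op coeff_eq_0) (simp add: algebra_simps)
  ultimately have l: "l = 0 \<or> degree l < Suc n" by (metis eq_zero_or_degree_less)
  have orth: "poly_ip a b l s = 0" if "s = 0 \<or> degree s < Suc n" for s
  proof -
    have "degree (legendre_op a b s) \<le> n" using that by (intro degree_legendre_op) auto
    then show ?thesis
      using r(2)[of s] r(2)[of "legendre_op a b s"] that
      by (simp add: l_def q_def poly_ip_add_left poly_ip_smult_left legendre_op_symmetric[OF ab])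
  qed
  have "l = 0" using orth[OF l] poly_ip_eq_0[OF \<open>a < b\<close>] by simp
  then have Lq: "legendre_op a b q = smult (- c) q"
    unfolding l_def by (simp add: eq_neg_iff_add_eq_0)
  have qr: "poly_ip a b q r = 0" using r q_def by auto
  have p: "p = q + r" by (simp add: q_def)
  have parts: "poly_ip a b (legendre_op a b x) y = - E x y" for x y
    unfolding E_def by (rule legendre_op_parts[OF ab])
  have Eqx: "E q x = c * poly_ip a b q x" for x
    using parts[of q x] unfolding Lq poly_ip_smult_left by simp
  have Erq: "E r q = 0"
    using parts[of r q] qr unfolding legendre_op_symmetric[OF ab, of r q] Lq poly_ip_smult_right
    by (simp add: poly_ip_commute[of a b r])
  \<comment> \<open>No cross term survives, because \<open>q\<close> is an eigenvector orthogonal to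
    \<open>r\<close>. The eigenvalue \<open>c\<close> of the top component dominates the factor that
    the induction gives for \<open>r\<close>.\<close>
  have "E p p = E q q + E q r + E r q + E r r"
    unfolding p E_def pderiv_add distrib_left poly_ip_add_left poly_ip_add_right by simp
  also have "\<dots> = c * poly_ip a b q q + E r r"
    by (simp only: Eqx Erq qr mult_zero_right add_0_right)
  also have "E r r \<le> real (n * (n + 1)) * poly_ip a b r r" using Suc.IH[OF dr] unfolding E_def .
  also have "\<dots> \<le> c * poly_ip a b r r"
    by (intro mult_right_mono poly_ip_nonneg) (simp add: c_def)
  finally have "E p p \<le> c * (poly_ip a b q q + poly_ip a b r r)"
    by (simp add: distrib_left)
  also have "poly_ip a b q q + poly_ip a b r r = poly_ip a b p p"
    unfolding p using qr by (simp add: poly_ip_add_left poly_ip_add_right poly_ip_commute[of a b r q])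
  finally show ?case unfolding E_def c_def .
qed

lemma bernstein_real_poly:
  fixes p :: "real poly"
  assumes "a < b" "degree p \<le> n"
  shows "integral {a..b} (\<lambda>x. (x - a) * (b - x) * (poly (pderiv p) x)\<^sup>2)
    \<le> real (n * (n + 1)) * integral {a..b} (\<lambda>x. (poly p x)\<^sup>2)"
proof -
  have 1: "poly_ip a b p p = integral {a..b} (\<lambda>x. (poly p x)\<^sup>2)"
    by (simp add: poly_ip_def power2_eq_square)
  have "poly_ip a b ([:- a * b, a + b, -1:] * pderiv p) (pderiv p)
      = integral {a..b} (\<lambda>x. (x - a) * (b - x) * (poly (pderiv p) x)\<^sup>2)"
    by (simp add: poly_ip_def power2_eq_square algebra_simps)
  then show ?thesis using bernstein_poly_ip[OF assms] 1 by simp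
qed

section \<open>Complex coefficients through real and imaginary parts\<close>

lemma poly_map_poly_Re: "poly (map_poly Re p) x = Re (poly p (of_real x))"
  by (induction p) (auto simp: map_poly_pCons)

lemma poly_map_poly_Im: "poly (map_poly Im p) x = Im (poly p (of_real x))"
  by (induction p) (auto simp: map_poly_pCons)

lemma pderiv_map_poly_Re: "pderiv (map_poly Re p) = map_poly Re (pderiv p)"
  by (rule poly_eqI) (simp add: coeff_pderiv coeff_map_poly)

lemma pderiv_map_poly_Im: "pderiv (map_poly Im p) = map_poly Im (pderiv p)"
  by (rule poly_eqI) (simp add: coeff_pderiv coeff_map_poly)

lemma bernstein_complex_poly:
  fixes p :: "complex poly"
  assumes "a < b" "degree p \<le> n"
  shows "integral {a..b} (\<lambda>x. (x - a) * (b - x) * (cmod (poly (pderiv p) (of_real x)))\<^sup>2)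
    \<le> real (n * (n + 1)) * integral {a..b} (\<lambda>x. (cmod (poly p (of_real x)))\<^sup>2)"
proof -
  let ?r = "map_poly Re p" and ?i = "map_poly Im p"
  have d: "degree ?r \<le> n" "degree ?i \<le> n" using assms(2) by (auto simp: coeff_map_poly coeff_eq_0 intro!: degree_le)
  have i1: "(\<lambda>x. (x - a) * (b - x) * (poly q x)\<^sup>2) integrable_on {a..b}"
    "(\<lambda>x. (poly q x)\<^sup>2) integrable_on {a..b}" for q :: "real poly"
    by (intro integrable_continuous_interval continuous_intros)+
  have "integral {a..b} (\<lambda>x. (x - a) * (b - x) * (cmod (poly (pderiv p) (of_real x)))\<^sup>2)
     = integral {a..b} (\<lambda>x. (x - a) * (b - x) * (poly (pderiv ?r) x)\<^sup>2)
      + integral {a..b} (\<lambda>x. (x - a) * (b - x) * (poly (pderiv ?i) x)\<^sup>2)"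
    by (subst integral_add[symmetric, OF i1(1) i1(1)])
       (simp add: pderiv_map_poly_Re pderiv_map_poly_Im poly_map_poly_Re poly_map_poly_Im
         cmod_power2 distrib_left)
  also have "\<dots> \<le> real (n * (n + 1)) * (integral {a..b} (\<lambda>x. (poly ?r x)\<^sup>2)
       + integral {a..b} (\<lambda>x. (poly ?i x)\<^sup>2))"
    using bernstein_real_poly[OF assms(1) d(1)] bernstein_real_poly[OF assms(1) d(2)]
    by (simp add: distrib_left)
  also have "integral {a..b} (\<lambda>x. (poly ?r x)\<^sup>2) + integral {a..b} (\<lambda>x. (poly ?i x)\<^sup>2)
      = integral {a..b} (\<lambda>x. (cmod (poly p (of_real x)))\<^sup>2)"
    by (subst integral_add[symmetric, OF i1(2) i1(2)])
       (simp add: poly_map_poly_Re poly_map_poly_Im cmod_power2)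
  finally show ?thesis .
qed

section \<open>Cutoffs of polynomials\<close>

lemma poly_cmod_has_real_derivative:
  fixes p :: "complex poly"
  shows "((\<lambda>x. (cmod (poly p (of_real x)))\<^sup>2) has_real_derivative
      2 * Re (cnj (poly p (of_real x)) * poly (pderiv p) (of_real x))) (at x within S)"
proof -
  have "((\<lambda>x. (poly (map_poly Re p) x)\<^sup>2 + (poly (map_poly Im p) x)\<^sup>2) has_real_derivative
      2 * poly (map_poly Re p) x * poly (pderiv (map_poly Re p)) x
      + 2 * poly (map_poly Im p) x * poly (pderiv (map_poly Im p)) x) (at x within S)"
    by (auto intro!: derivative_eq_intros DERIV_subset[OF poly_DERIV])
  then show ?thesis
    by (simp add: poly_map_poly_Re poly_map_poly_Im pderiv_map_poly_Re pderiv_map_poly_Im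
        cmod_power2 algebra_simps)
qed

text \<open>This is \<open>1 - s\<^bsup>2e\<^esup>\<close> for the affine map \<open>s\<close> of \<open>[a,b]\<close> onto \<open>[-1,1]\<close>.\<close>

definition cutoff_poly :: "real \<Rightarrow> real \<Rightarrow> nat \<Rightarrow> complex poly" where
  "cutoff_poly a b e = 1 - [: of_real (- (a + b) / (b - a)), of_real (2 / (b - a)) :] ^ (2 * e)"

context
  fixes a b :: real and p :: "complex poly" and n :: nat
  assumes ab: "a < b" and deg: "degree p \<le> n"
begin

private definition "s x = (2 * x - a - b) / (b - a)"

private lemma s_bound: "x \<in> {a..b} \<Longrightarrow> \<bar>s x\<bar> \<le> 1"
  using ab by (auto simp: s_def abs_le_iff field_simps)

private lemma s_weight: "1 - (s x)\<^sup>2 = 4 * ((x - a) * (b - x)) / (b - a)\<^sup>2"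
proof -
  have "(b - a)\<^sup>2 - (2 * x - a - b)\<^sup>2 = 4 * ((x - a) * (b - x))"
    by (simp add: power2_eq_square algebra_simps)
  then show ?thesis using ab by (simp add: s_def power_divide diff_divide_eq_iff)
qed

private lemma s_deriv: "(s has_real_derivative (2 / (b - a))) (at x within S)"
proof -
  have "s = (\<lambda>x. 2 / (b - a) * x - (a + b) / (b - a))"
    by (rule ext) (simp add: s_def diff_divide_distrib add_divide_distrib)
  moreover have "((\<lambda>x. 2 / (b - a) * x - (a + b) / (b - a)) has_real_derivative 2 / (b - a) * 1 - 0) (at x within S)"
    by (intro DERIV_diff DERIV_cmult DERIV_ident DERIV_const)
  ultimately show ?thesis by (simp only: mult_1_right diff_zero)
qed

private lemma s_cont [continuous_intros]: "continuous_on S s"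
  unfolding s_def using ab by (auto intro!: continuous_intros)

private lemma poly_s: "poly [: of_real (- (a + b) / (b - a)), of_real (2 / (b - a)) :] (of_real x :: complex) = of_real (s x)"
  using ab by (simp add: s_def diff_divide_distrib add_divide_distrib)

private lemma bernoulli: "1 - y ^ k \<le> real k * (1 - y)" if "0 \<le> y" for y :: real
  using Bernoulli_inequality[of "y - 1" k] that by (simp add: algebra_simps)

private abbreviation "N x \<equiv> (cmod (poly p (of_real x)))\<^sup>2"
private abbreviation "D x \<equiv> (cmod (poly (pderiv p) (of_real x)))\<^sup>2"
private abbreviation "W x \<equiv> (x - a) * (b - x)"

private lemma bern: "integral {a..b} (\<lambda>x. W x * D x) \<le> real ((n + 1)\<^sup>2) * integral {a..b} N"
proof -
  have "integral {a..b} (\<lambda>x. W x * D x) \<le> real (n * (n + 1)) * integral {a..b} N"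
    using bernstein_complex_poly[OF ab deg] .
  also have "\<dots> \<le> real ((n + 1)\<^sup>2) * integral {a..b} N"
    by (intro mult_right_mono integral_nonneg integrable_continuous_interval continuous_intros)
       (auto simp: power2_eq_square)
  finally show ?thesis .
qed

private lemma integrable_cont: "continuous_on {a..b} f \<Longrightarrow> f integrable_on {a..b}" for f :: "real \<Rightarrow> real"
  by (rule integrable_continuous_interval)

private lemma s_ends: "s a = -1" "s b = 1"
  using ab by (auto simp: s_def field_simps)

lemma cutoff_poly_ends:
  assumes "e \<ge> 1"
  shows "poly (cutoff_poly a b e) (of_real a) = 0" "poly (cutoff_poly a b e) (of_real b) = 0"
proof -
  show "poly (cutoff_poly a b e) (of_real a) = 0" "poly (cutoff_poly a b e) (of_real b) = 0"
    using poly_s[of a] poly_s[of b] s_ends by (simp_all only: cutoff_poly_def poly_diff poly_1 poly_power) simp_all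
qed

text \<open>The left side is the integral \<open>A\<close> of \<open>s x ^ (4 * e)\<close> times the
  squared modulus of \<open>p\<close>, that is, the mass of \<open>p\<close> in two boundary layers
  of relative width about 1/e. Integrating the derivative of \<open>phi\<close> times that square
  trades \<open>(4 * e + 1) * A\<close> for the total mass plus a term containing
  \<open>pderiv p\<close>, which the weighted Bernstein inequality bounds by
  \<open>4 * U * Q\<close> times the total mass. With \<open>e = 2 * U^2 * Q\<close> the quotient is
  at most 1/U.\<close>

lemma cutoff_poly_close:
  assumes U: "U \<ge> 1" and e: "e = 2 * U\<^sup>2 * (n + 1)\<^sup>2"
  shows "integral {a..b} (\<lambda>x. (cmod (poly p (of_real x) - poly (cutoff_poly a b e * p) (of_real x)))\<^sup>2)
    \<le> integral {a..b} N / real U"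
proof -
  define Q where "Q = real ((n + 1)\<^sup>2)"
  define l where "l = b - a"
  \<comment> \<open>The weight of Young's inequality below, chosen so that its two terms both become
    \<open>lam * P\<close> once the Bernstein inequality is applied.\<close>
  define lam where "lam = 4 * real U * Q / l"
  define P where "P = integral {a..b} N"
  define A where "A = integral {a..b} (\<lambda>x. s x ^ (4 * e) * N x)"
  \<comment> \<open>\<open>phi\<close> vanishes at both ends, so the derivative of \<open>phi \<bar>p\<bar>\<^sup>2\<close> integrates to zero.\<close>
  define phi where "phi x = s x ^ (4 * e + 1) - s x" for x
  have Q: "Q > 0" and l: "l > 0" and lam: "lam > 0" using U ab by (auto simp: Q_def l_def lam_def)
  have P0: "0 \<le> P" unfolding P_def
    by (intro integral_nonneg integrable_continuous_interval continuous_intros) auto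
  have cphi [continuous_intros]: "continuous_on S phi" for S
    unfolding phi_def by (intro continuous_intros)
  have re: "real e = 2 * (real U)\<^sup>2 * Q" unfolding e Q_def by simp
  let ?R = "\<lambda>x. Re (cnj (poly p (of_real x)) * poly (pderiv p) (of_real x))"
  have dphi: "(phi has_real_derivative (2 / l * ((4 * real e + 1) * s x ^ (4 * e) - 1))) (at x within S)" for x S
  proof -
    have "(phi has_real_derivative (of_nat (4 * e + 1) * (2 / l * s x ^ (4 * e + 1 - Suc 0)) - 2 / l)) (at x within S)"
      unfolding phi_def l_def by (intro DERIV_diff DERIV_power s_deriv)
    then show ?thesis by (rule DERIV_cong) (simp add: algebra_simps add_divide_distrib)
  qed
  have ends: "phi a = 0" "phi b = 0" by (simp_all add: phi_def s_ends)
  have d: "((\<lambda>x. phi x * N x) has_vector_derivative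
      phi x * (2 * ?R x) + (2 / l * ((4 * real e + 1) * s x ^ (4 * e) - 1)) * N x) (at x within S)" for x S
    unfolding has_real_derivative_iff_has_vector_derivative[symmetric]
    by (rule DERIV_mult'[OF dphi poly_cmod_has_real_derivative])
  have "((\<lambda>x. phi x * (2 * ?R x) + (2 / l * ((4 * real e + 1) * s x ^ (4 * e) - 1)) * N x)
     has_integral (phi b * N b - phi a * N a)) {a..b}"
    by (rule fundamental_theorem_of_calculus[OF _ d]) (use ab in simp)
  then have "integral {a..b} (\<lambda>x. phi x * (2 * ?R x) + (2 / l * ((4 * real e + 1) * s x ^ (4 * e) - 1)) * N x) = 0"
    using ends by (simp add: integral_unique)
  also have "integral {a..b} (\<lambda>x. phi x * (2 * ?R x) + (2 / l * ((4 * real e + 1) * s x ^ (4 * e) - 1)) * N x)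
    = integral {a..b} (\<lambda>x. 2 / l * (4 * real e + 1) * (s x ^ (4 * e) * N x) - 2 / l * N x + 2 * ?R x * phi x)"
    by (rule integral_cong) (simp add: algebra_simps)
  also have "\<dots> = 2 / l * (4 * real e + 1) * A - 2 / l * P + integral {a..b} (\<lambda>x. 2 * ?R x * phi x)"
  proof -
    have "(\<lambda>x. 2 / l * (4 * real e + 1) * (s x ^ (4 * e) * N x)) integrable_on {a..b}"
      "(\<lambda>x. 2 / l * N x) integrable_on {a..b}" "(\<lambda>x. 2 * ?R x * phi x) integrable_on {a..b}"
      by (intro integrable_cont continuous_intros)+
    then show ?thesis
      unfolding A_def P_def by (simp only: integral_add integral_diff integrable_diff integral_mult_right)
  qed
  finally have eq: "2 / l * ((4 * real e + 1) * A - P) = - integral {a..b} (\<lambda>x. 2 * ?R x * phi x)"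
    by (simp add: algebra_simps)
  have "- integral {a..b} (\<lambda>x. 2 * ?R x * phi x) = integral {a..b} (\<lambda>x. - (2 * ?R x * phi x))"
    by simp
  also have "\<dots> \<le> integral {a..b} (\<lambda>x. lam * N x + (8 * real e / l\<^sup>2 / lam) * (W x * D x))"
  proof (intro integral_le integrable_cont continuous_intros)
    fix x assume x: "x \<in> {a..b}"
    have s: "\<bar>s x\<bar> \<le> 1" by (rule s_bound[OF x])
    have "\<bar>s x\<bar> ^ (4 * e) = s x ^ (4 * e)" by (rule power_even_abs) simp
    then have s4: "0 \<le> s x ^ (4 * e)" "s x ^ (4 * e) \<le> 1"
      using s power_le_one[of "\<bar>s x\<bar>" "4 * e"] zero_le_power[of "\<bar>s x\<bar>" "4 * e"] by linarith+
    have "(phi x)\<^sup>2 = (s x)\<^sup>2 * (1 - s x ^ (4 * e))\<^sup>2"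
      by (simp add: phi_def power2_eq_square algebra_simps)
    also have "\<dots> \<le> 1 * (1 - s x ^ (4 * e))"
    proof (rule mult_mono)
      show "(s x)\<^sup>2 \<le> 1" using s by (simp add: abs_square_le_1)
      have "(1 - s x ^ (4 * e)) * (1 - s x ^ (4 * e)) \<le> 1 * (1 - s x ^ (4 * e))"
        using s4 by (intro mult_right_mono) linarith+
      then show "(1 - s x ^ (4 * e))\<^sup>2 \<le> 1 - s x ^ (4 * e)" by (simp only: power2_eq_square mult_1)
    qed simp_all
    \<comment> \<open>Bernoulli's inequality converts the cutoff into the weight \<open>W\<close>,
      the only factor against which the derivative of \<open>p\<close> is controlled.\<close>
    also have "s x ^ (4 * e) = ((s x)\<^sup>2) ^ (2 * e)" by (simp flip: power_mult)
    also have "1 * (1 - ((s x)\<^sup>2) ^ (2 * e)) \<le> real (2 * e) * (1 - (s x)\<^sup>2)"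
      using bernoulli[of "(s x)\<^sup>2" "2 * e"] by simp
    also have "\<dots> = 8 * real e / l\<^sup>2 * W x" unfolding s_weight l_def by simp
    finally have phi2: "(phi x)\<^sup>2 \<le> 8 * real e / l\<^sup>2 * W x" .
    have "- (2 * ?R x * phi x) \<le> \<bar>2 * ?R x * phi x\<bar>" by (rule abs_ge_minus_self)
    also have "\<dots> = 2 * \<bar>?R x\<bar> * \<bar>phi x\<bar>" by (simp only: abs_mult abs_numeral)
    also have "\<dots> \<le> 2 * (cmod (poly p (of_real x)) * cmod (poly (pderiv p) (of_real x))) * \<bar>phi x\<bar>"
      using abs_Re_le_cmod[of "cnj (poly p (of_real x)) * poly (pderiv p) (of_real x)"]
      by (intro mult_mono) (auto simp: norm_mult)
    also have "\<dots> \<le> lam * N x + (phi x)\<^sup>2 / lam * D x"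
    proof -
      have "0 \<le> (lam * cmod (poly p (of_real x)) - \<bar>phi x\<bar> * cmod (poly (pderiv p) (of_real x)))\<^sup>2" by simp
      then have "lam * (2 * (cmod (poly p (of_real x)) * cmod (poly (pderiv p) (of_real x))) * \<bar>phi x\<bar>)
          \<le> lam * (lam * N x) + (phi x)\<^sup>2 * D x"
        by (simp add: power2_diff power_mult_distrib power2_eq_square[of lam] mult_ac)
      also have "\<dots> = lam * (lam * N x + (phi x)\<^sup>2 / lam * D x)"
        using lam by (simp add: distrib_left)
      finally show ?thesis using lam by (rule mult_left_le_imp_le)
    qed
    also have "\<dots> \<le> lam * N x + (8 * real e / l\<^sup>2 * W x) / lam * D x"
      using lam phi2 by (intro add_left_mono mult_right_mono divide_right_mono) auto
    also have "8 * real e / l\<^sup>2 * w / lam * d = 8 * real e / l\<^sup>2 / lam * (w * d)" for w d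
      by simp
    finally show "- (2 * ?R x * phi x) \<le> lam * N x + (8 * real e / l\<^sup>2 / lam) * (W x * D x)" .
  qed
  also have "\<dots> = lam * P + (8 * real e / l\<^sup>2 / lam) * integral {a..b} (\<lambda>x. W x * D x)"
  proof -
    have "(\<lambda>x. lam * N x) integrable_on {a..b}" "(\<lambda>x. 8 * real e / l\<^sup>2 / lam * (W x * D x)) integrable_on {a..b}"
      by (intro integrable_cont continuous_intros)+
    then show ?thesis
      unfolding P_def by (simp only: integral_add integral_mult_right)
  qed
  also have "\<dots> \<le> lam * P + (8 * real e / l\<^sup>2 / lam) * (Q * P)"
    using bern lam l unfolding Q_def P_def by (intro add_left_mono mult_left_mono) auto
  also have "8 * real e / l\<^sup>2 / lam * (Q * P) = lam * P"
    using Q l U unfolding lam_def re by (simp add: field_simps power2_eq_square)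
  also have "lam * P + lam * P = 2 * lam * P" by simp
  finally have "2 / l * ((4 * real e + 1) * A - P) \<le> 2 * lam * P" unfolding eq .
  then have "(4 * real e + 1) * A - P \<le> l * lam * P" using l by (simp add: field_simps)
  then have 1: "(8 * (real U)\<^sup>2 * Q + 1) * A \<le> (1 + 4 * real U * Q) * P"
    using l unfolding lam_def re by (simp add: algebra_simps)
  have U1: "1 \<le> real U" "1 \<le> Q" using U by (auto simp: Q_def)
  have "1 \<le> real U * Q" using mult_mono[OF U1] by simp
  then have "real U * (1 + 4 * real U * Q) \<le> real U * (5 * real U * Q)"
    by (intro mult_left_mono) linarith+
  also have "\<dots> \<le> 8 * (real U)\<^sup>2 * Q + 1" using Q by (simp add: power2_eq_square)
  finally have 2: "real U * (1 + 4 * real U * Q) \<le> 8 * (real U)\<^sup>2 * Q + 1" .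
  have "A \<le> (1 + 4 * real U * Q) * P / (8 * (real U)\<^sup>2 * Q + 1)"
    using 1 Q by (subst pos_le_divide_eq) (auto simp: add_nonneg_pos mult.commute)
  also have "\<dots> \<le> P / real U"
    using mult_right_mono[OF 2 P0] Q U by (simp add: field_simps add_nonneg_pos)
  finally have "A \<le> P / real U" .
  moreover have "integral {a..b} (\<lambda>x. (cmod (poly p (of_real x) - poly (cutoff_poly a b e * p) (of_real x)))\<^sup>2) = A"
    unfolding A_def
  proof (rule integral_cong)
    fix x
    have "poly p (of_real x) - poly (cutoff_poly a b e * p) (of_real x) = of_real (s x ^ (2 * e)) * poly p (of_real x)"
      unfolding cutoff_poly_def poly_mult poly_diff poly_power poly_s by (simp add: algebra_simps)
    then show "(cmod (poly p (of_real x) - poly (cutoff_poly a b e * p) (of_real x)))\<^sup>2 = s x ^ (4 * e) * N x"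
      by (simp only: norm_mult norm_of_real power_mult_distrib power2_abs) (simp flip: power_mult)
  qed
  ultimately show ?thesis by (simp add: P_def)
qed

text \<open>In the product rule the derivative of the cutoff is at most 4e/l, while the squared
  cutoff is at most \<open>4 * e / l^2 * W\<close> by Bernoulli's inequality, so the term with
  \<open>pderiv p\<close> falls under the weighted Bernstein inequality. As \<open>e\<close> is of
  order \<open>Q\<close>, both terms are of order Q/l; the constant is 144 = 128 + 16, from
  \<open>32 * e^2\<close> and \<open>8 * e * Q\<close>.\<close>

lemma cutoff_poly_deriv:
  assumes U: "U \<ge> 1" and e: "e = 2 * U\<^sup>2 * (n + 1)\<^sup>2"
  shows "integral {a..b} (\<lambda>x. (cmod (poly (pderiv (cutoff_poly a b e * p)) (of_real x)))\<^sup>2)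
    \<le> 144 * real U ^ 4 * (real ((n + 1)\<^sup>2) / (b - a))\<^sup>2 * integral {a..b} N"
proof -
  define Q where "Q = real ((n + 1)\<^sup>2)"
  define l where "l = b - a"
  define P where "P = integral {a..b} N"
  have Q: "Q > 0" and l: "l > 0" using ab by (auto simp: Q_def l_def)
  have P0: "0 \<le> P" unfolding P_def
    by (intro integral_nonneg integrable_continuous_interval continuous_intros) auto
  have re: "real e = 2 * (real U)\<^sup>2 * Q" unfolding e Q_def by simp
  have "e \<ge> 1" using U e by simp
  have "integral {a..b} (\<lambda>x. (cmod (poly (pderiv (cutoff_poly a b e * p)) (of_real x)))\<^sup>2)
     \<le> integral {a..b} (\<lambda>x. 32 * (real e)\<^sup>2 / l\<^sup>2 * N x + 8 * real e / l\<^sup>2 * (W x * D x))"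
  proof (intro integral_le integrable_cont continuous_intros)
    fix x assume x: "x \<in> {a..b}"
    have s: "\<bar>s x\<bar> \<le> 1" by (rule s_bound[OF x])
    let ?X = "poly (cutoff_poly a b e) (complex_of_real x)"
    let ?X' = "poly (pderiv (cutoff_poly a b e)) (complex_of_real x)"
    have X: "?X = of_real (1 - (s x)\<^sup>2 ^ e)"
      unfolding cutoff_poly_def poly_diff poly_power poly_s by (simp add: power_mult)
    have Y: "0 \<le> (s x)\<^sup>2 ^ e" "(s x)\<^sup>2 ^ e \<le> 1"
      using s power_le_one[of "(s x)\<^sup>2" e] by (auto simp: abs_square_le_1)
    have "(cmod ?X)\<^sup>2 = (1 - (s x)\<^sup>2 ^ e)\<^sup>2" unfolding X norm_of_real by simp
    also have "\<dots> \<le> (1 - (s x)\<^sup>2 ^ e) * 1" unfolding power2_eq_square[of "1 - _"] using Y by (intro mult_left_mono) auto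
    also have "\<dots> \<le> real e * (1 - (s x)\<^sup>2)" using bernoulli[of "(s x)\<^sup>2" e] by simp
    also have "\<dots> = 4 * real e / l\<^sup>2 * W x" unfolding s_weight l_def by simp
    finally have X2: "(cmod ?X)\<^sup>2 \<le> 4 * real e / l\<^sup>2 * W x" .
    have "?X' = - (of_nat (2 * e) * of_real (s x) ^ (2 * e - 1) * of_real (2 / (b - a)))"
      unfolding cutoff_poly_def pderiv_diff pderiv_power poly_mult poly_diff poly_smult poly_power poly_s
      by (simp add: pderiv_pCons pderiv_1)
    then have "cmod ?X' = real (2 * e) * \<bar>s x\<bar> ^ (2 * e - 1) * \<bar>2 / (b - a)\<bar>"
      by (simp only: norm_minus_cancel norm_mult norm_power norm_of_real norm_of_nat)
    also have "\<dots> \<le> real (2 * e) * 1 * \<bar>2 / (b - a)\<bar>"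
      using s by (intro mult_right_mono mult_left_mono power_le_one) auto
    also have "\<dots> = 4 * real e / l" using ab by (simp add: l_def)
    finally have "(cmod ?X')\<^sup>2 \<le> (4 * real e / l)\<^sup>2" by (rule power_mono) simp
    then have X'2: "(cmod ?X')\<^sup>2 \<le> 16 * (real e)\<^sup>2 / l\<^sup>2" by (simp add: power_divide power_mult_distrib)
    have "(cmod (poly (pderiv (cutoff_poly a b e * p)) (of_real x)))\<^sup>2
       \<le> (cmod ?X' * cmod (poly p (of_real x)) + cmod ?X * cmod (poly (pderiv p) (of_real x)))\<^sup>2"
      unfolding pderiv_mult poly_add poly_mult
      by (intro power_mono norm_triangle_le) (auto simp: norm_mult mult.commute)
    also have "\<dots> \<le> 2 * ((cmod ?X')\<^sup>2 * N x) + 2 * ((cmod ?X)\<^sup>2 * D x)"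
      using sum_squares_bound[of "cmod ?X' * cmod (poly p (of_real x))" "cmod ?X * cmod (poly (pderiv p) (of_real x))"]
      by (simp add: power2_sum power_mult_distrib mult_ac add_ac)
    also have "\<dots> \<le> 2 * (16 * (real e)\<^sup>2 / l\<^sup>2 * N x) + 2 * (4 * real e / l\<^sup>2 * W x * D x)"
      using X2 X'2 by (intro add_mono mult_left_mono mult_right_mono) auto
    also have "2 * (4 * real e / l\<^sup>2 * w * d) = 8 * real e / l\<^sup>2 * (w * d)" for w d by simp
    also have "2 * (16 * (real e)\<^sup>2 / l\<^sup>2 * w) = 32 * (real e)\<^sup>2 / l\<^sup>2 * w" for w by simp
    finally show "(cmod (poly (pderiv (cutoff_poly a b e * p)) (of_real x)))\<^sup>2
      \<le> 32 * (real e)\<^sup>2 / l\<^sup>2 * N x + 8 * real e / l\<^sup>2 * (W x * D x)" .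
  qed
  also have "\<dots> = 32 * (real e)\<^sup>2 / l\<^sup>2 * P + 8 * real e / l\<^sup>2 * integral {a..b} (\<lambda>x. W x * D x)"
  proof -
    have "(\<lambda>x. 32 * (real e)\<^sup>2 / l\<^sup>2 * N x) integrable_on {a..b}"
      "(\<lambda>x. 8 * real e / l\<^sup>2 * (W x * D x)) integrable_on {a..b}"
      by (intro integrable_cont continuous_intros)+
    then show ?thesis
      unfolding P_def by (simp only: integral_add integral_mult_right)
  qed
  also have "\<dots> \<le> 32 * (real e)\<^sup>2 / l\<^sup>2 * P + 8 * real e / l\<^sup>2 * (Q * P)"
    using bern l unfolding Q_def P_def by (intro add_left_mono mult_left_mono) auto
  also have "\<dots> = (128 * real U ^ 4 + 16 * (real U)\<^sup>2) * (Q / l)\<^sup>2 * P"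
    unfolding re by (simp add: power2_eq_square power4_eq_xxxx algebra_simps add_divide_distrib)
  also have "\<dots> \<le> (144 * real U ^ 4) * (Q / l)\<^sup>2 * P"
    using U power_increasing[of 2 4 "real U"] P0 by (intro mult_right_mono) auto
  finally show ?thesis unfolding Q_def l_def P_def .
qed

end

section \<open>The inner product of \<open>L\<^sup>2(0,1)\<close>\<close>

abbreviation M01 :: "real measure" where
  "M01 \<equiv> lebesgue_on {0<..<1}"

lemma finite_measure_M01: "finite_measure M01"
  by (rule finite_measure_lebesgue_on) (simp add: bounded_set_imp_lmeasurable)

lemma measure_M01: "measure M01 (space M01) = 1"
  by (simp add: measure_restrict_space)

lemma measurable_M01_borel: "f \<in> borel_measurable borel \<Longrightarrow> f \<in> borel_measurable M01"
  by (metis measurable_completion measurable_lborel2 measurable_restrict_space1)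

lemma L2_01_measurable: "f \<in> L2_01 \<Longrightarrow> f \<in> borel_measurable M01"
  and L2_01_square_integrable: "f \<in> L2_01 \<Longrightarrow> integrable M01 (\<lambda>x. (cmod (f x))\<^sup>2)"
  by (auto simp: L2_01_def)

lemma L2_01_mult_integrable:
  assumes "f \<in> L2_01" "g \<in> L2_01"
  shows "integrable M01 (\<lambda>x. f x * g x)"
proof (rule Bochner_Integration.integrable_bound)
  show "integrable M01 (\<lambda>x. (cmod (f x))\<^sup>2 + (cmod (g x))\<^sup>2)"
    using assms by (intro Bochner_Integration.integrable_add L2_01_square_integrable)
  show "(\<lambda>x. f x * g x) \<in> borel_measurable M01"
    using assms by (intro borel_measurable_times L2_01_measurable)
  have "cmod (f x) * cmod (g x) \<le> (cmod (f x))\<^sup>2 + (cmod (g x))\<^sup>2" for x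
  proof -
    have "0 \<le> cmod (f x) * cmod (g x)" by simp
    then show ?thesis using sum_squares_bound[of "cmod (f x)" "cmod (g x)"] by linarith
  qed
  then show "AE x in M01. norm (f x * g x) \<le> norm ((cmod (f x))\<^sup>2 + (cmod (g x))\<^sup>2)"
    by (intro AE_I2) (simp add: norm_mult)
qed

lemma L2_01_bounded_mult:
  assumes "f \<in> L2_01" "b \<in> borel_measurable M01" "\<And>x. x \<in> {0<..<1} \<Longrightarrow> cmod (b x) \<le> B"
  shows "(\<lambda>x. b x * f x) \<in> L2_01"
  unfolding L2_01_def mem_Collect_eq
proof
  show m: "(\<lambda>x. b x * f x) \<in> borel_measurable M01"
    by (intro borel_measurable_times assms(2) L2_01_measurable assms(1))
  show "integrable M01 (\<lambda>x. (cmod (b x * f x))\<^sup>2)"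
  proof (rule Bochner_Integration.integrable_bound)
    show "integrable M01 (\<lambda>x. B\<^sup>2 * (cmod (f x))\<^sup>2)"
      using assms by (intro integrable_mult_right L2_01_square_integrable)
    show "(\<lambda>x. (cmod (b x * f x))\<^sup>2) \<in> borel_measurable M01"
      using m by measurable
    show "AE x in M01. norm ((cmod (b x * f x))\<^sup>2) \<le> norm (B\<^sup>2 * (cmod (f x))\<^sup>2)"
      using assms(3) by (intro AE_I2) (auto simp: norm_mult power_mult_distrib intro!: mult_right_mono power_mono)
  qed
qed

lemma L2_01_bounded:
  assumes "b \<in> borel_measurable M01" "\<And>x. x \<in> {0<..<1} \<Longrightarrow> cmod (b x) \<le> B"
  shows "b \<in> L2_01"
proof -
  interpret finite_measure M01 by (rule finite_measure_M01)
  have "(\<lambda>x. 1) \<in> L2_01" by (auto simp: L2_01_def)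
  from L2_01_bounded_mult[OF this assms] show ?thesis by simp
qed

lemma L2_01_scale: "f \<in> L2_01 \<Longrightarrow> (\<lambda>x. c * f x) \<in> L2_01"
  by (rule L2_01_bounded_mult[where B = "cmod c"]) auto

lemma L2_01_cnj: "f \<in> L2_01 \<Longrightarrow> (\<lambda>x. cnj (f x)) \<in> L2_01"
  by (auto simp: L2_01_def intro: borel_measurable_continuous_onI[THEN measurable_compose_rev] continuous_intros)

lemma L2_01_add:
  assumes "f \<in> L2_01" "g \<in> L2_01"
  shows "(\<lambda>x. f x + g x) \<in> L2_01"
  unfolding L2_01_def mem_Collect_eq
proof
  show m: "(\<lambda>x. f x + g x) \<in> borel_measurable M01"
    using assms by (intro borel_measurable_add L2_01_measurable)
  show "integrable M01 (\<lambda>x. (cmod (f x + g x))\<^sup>2)"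
  proof (rule Bochner_Integration.integrable_bound)
    show "integrable M01 (\<lambda>x. 2 * (cmod (f x))\<^sup>2 + 2 * (cmod (g x))\<^sup>2)"
      using assms by (intro Bochner_Integration.integrable_add integrable_mult_right L2_01_square_integrable)
    show "(\<lambda>x. (cmod (f x + g x))\<^sup>2) \<in> borel_measurable M01"
      using m by measurable
    have "(cmod (f x + g x))\<^sup>2 \<le> 2 * (cmod (f x))\<^sup>2 + 2 * (cmod (g x))\<^sup>2" for x
      using power_mono[OF norm_triangle_ineq[of "f x" "g x"], of 2] sum_squares_bound[of "cmod (f x)" "cmod (g x)"]
      by (simp add: power2_sum)
    then show "AE x in M01. norm ((cmod (f x + g x))\<^sup>2) \<le> norm (2 * (cmod (f x))\<^sup>2 + 2 * (cmod (g x))\<^sup>2)"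
      by (intro AE_I2) simp
  qed
qed

lemma L2_01_diff: "f \<in> L2_01 \<Longrightarrow> g \<in> L2_01 \<Longrightarrow> (\<lambda>x. f x - g x) \<in> L2_01"
  using L2_01_add[OF _ L2_01_scale[of g "-1"], of f] by simp

lemma L2_01_const: "(\<lambda>x. c) \<in> L2_01"
  by (rule L2_01_bounded[where B = "cmod c"]) auto

lemma L2_01_sum: "(\<And>i. i \<in> I \<Longrightarrow> f i \<in> L2_01) \<Longrightarrow> (\<lambda>x. \<Sum>i\<in>I. f i x) \<in> L2_01"
proof (induction I rule: infinite_finite_induct)
  case (insert i I)
  then show ?case using L2_01_add[of "f i" "\<lambda>x. \<Sum>i\<in>I. f i x"] by simp
qed (auto intro: L2_01_const)

lemma L2_01_integrable: "f \<in> L2_01 \<Longrightarrow> integrable M01 f"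
  using L2_01_mult_integrable[OF L2_01_const[of 1], of f] by simp

definition ip01 :: "(real \<Rightarrow> complex) \<Rightarrow> (real \<Rightarrow> complex) \<Rightarrow> complex" where
  "ip01 f g = (LINT x|M01. f x * cnj (g x))"

lemma ip01_integrable: "f \<in> L2_01 \<Longrightarrow> g \<in> L2_01 \<Longrightarrow> integrable M01 (\<lambda>x. f x * cnj (g x))"
  by (intro L2_01_mult_integrable L2_01_cnj)

lemma l2norm_sq: "(l2norm f)\<^sup>2 = (LINT x|M01. (cmod (f x))\<^sup>2)"
  unfolding l2norm_def by (rule real_sqrt_pow2) simp

lemma l2norm_nonneg [simp]: "0 \<le> l2norm f"
  unfolding l2norm_def by simp

lemma ip01_self: "ip01 f f = of_real ((l2norm f)\<^sup>2)"
  unfolding ip01_def l2norm_sq complex_norm_square[symmetric] of_real_power[symmetric] by (rule integral_complex_of_real)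

lemma ip01_cnj: "ip01 g f = cnj (ip01 f g)"
  unfolding ip01_def by (subst Bochner_Integration.integral_cnj[symmetric]) (simp add: mult.commute)

lemma ip01_add_left: "f \<in> L2_01 \<Longrightarrow> g \<in> L2_01 \<Longrightarrow> h \<in> L2_01 \<Longrightarrow> ip01 (\<lambda>x. f x + g x) h = ip01 f h + ip01 g h"
  unfolding ip01_def using ip01_integrable by (simp add: distrib_right)

lemma ip01_diff_left: "f \<in> L2_01 \<Longrightarrow> g \<in> L2_01 \<Longrightarrow> h \<in> L2_01 \<Longrightarrow> ip01 (\<lambda>x. f x - g x) h = ip01 f h - ip01 g h"
  unfolding ip01_def using ip01_integrable by (simp add: left_diff_distrib)

lemma ip01_scale_left: "ip01 (\<lambda>x. c * f x) h = c * ip01 f h"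
  unfolding ip01_def by (simp add: mult.assoc)

lemma ip01_sum_left:
  assumes "\<And>i. i \<in> I \<Longrightarrow> f i \<in> L2_01" "h \<in> L2_01"
  shows "ip01 (\<lambda>x. \<Sum>i\<in>I. f i x) h = (\<Sum>i\<in>I. ip01 (f i) h)"
  unfolding ip01_def sum_distrib_right using assms ip01_integrable by (intro Bochner_Integration.integral_sum) auto

lemma l2norm_add_sq:
  assumes "f \<in> L2_01" "g \<in> L2_01"
  shows "(l2norm (\<lambda>x. f x + g x))\<^sup>2 = (l2norm f)\<^sup>2 + (l2norm g)\<^sup>2 + 2 * Re (ip01 f g)"
proof -
  have "complex_of_real ((l2norm (\<lambda>x. f x + g x))\<^sup>2) = ip01 (\<lambda>x. f x + g x) (\<lambda>x. f x + g x)"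
    by (rule ip01_self[symmetric])
  also have "\<dots> = ip01 f (\<lambda>x. f x + g x) + ip01 g (\<lambda>x. f x + g x)"
    using assms by (intro ip01_add_left L2_01_add)
  also have "ip01 f (\<lambda>x. f x + g x) = cnj (ip01 f f + ip01 g f)"
    by (subst ip01_cnj) (simp add: ip01_add_left assms)
  also have "ip01 g (\<lambda>x. f x + g x) = cnj (ip01 f g + ip01 g g)"
    by (subst ip01_cnj) (simp add: ip01_add_left assms)
  also have "ip01 g f = cnj (ip01 f g)" by (rule ip01_cnj)
  finally have "Re (complex_of_real ((l2norm (\<lambda>x. f x + g x))\<^sup>2))
      = Re (cnj (ip01 f f + cnj (ip01 f g)) + cnj (ip01 f g + ip01 g g))" by (rule arg_cong)
  then show ?thesis by (simp add: ip01_self)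
qed

lemma l2norm_scale: "l2norm (\<lambda>x. c * f x) = cmod c * l2norm f"
  unfolding l2norm_def by (simp add: norm_mult power_mult_distrib real_sqrt_mult)

lemma l2norm_diff_commute: "l2norm (\<lambda>x. f x - g x) = l2norm (\<lambda>x. g x - f x)"
  unfolding l2norm_def by (simp add: norm_minus_commute)

section \<open>Exponentials and the Fourier transform\<close>

definition expo :: "real \<Rightarrow> real \<Rightarrow> complex" where
  "expo \<omega> x = cis (2 * pi * \<omega> * x)"

lemma cis_borel_measurable [measurable]: "cis \<in> borel_measurable borel"
  by (intro borel_measurable_continuous_onI continuous_intros)

lemma expo_measurable [measurable]: "expo \<omega> \<in> borel_measurable M01"
  unfolding expo_def by (rule measurable_M01_borel) measurable

lemma norm_expo [simp]: "cmod (expo \<omega> x) = 1"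
  by (simp add: expo_def)

lemma expo_L2: "expo \<omega> \<in> L2_01"
  by (rule L2_01_bounded[where B = 1]) auto

lemma fourier_eq: "fourier f \<omega> = (LINT x|M01. f x * cnj (expo \<omega> x))"
  unfolding fourier_def expo_def by (simp add: exp_cnj cis_conv_exp mult_ac)

lemma fourier_ip01: "fourier f \<omega> = ip01 f (expo \<omega>)"
  by (simp add: fourier_eq ip01_def)

lemma fourier_add: "f \<in> L2_01 \<Longrightarrow> g \<in> L2_01 \<Longrightarrow> fourier (\<lambda>x. f x + g x) \<omega> = fourier f \<omega> + fourier g \<omega>"
  by (simp add: fourier_ip01 ip01_add_left expo_L2)

lemma fourier_diff: "f \<in> L2_01 \<Longrightarrow> g \<in> L2_01 \<Longrightarrow> fourier (\<lambda>x. f x - g x) \<omega> = fourier f \<omega> - fourier g \<omega>"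
  by (simp add: fourier_ip01 ip01_diff_left expo_L2)

lemma fourier_scale: "fourier (\<lambda>x. c * f x) \<omega> = c * fourier f \<omega>"
  by (simp add: fourier_ip01 ip01_scale_left)

lemma integral_M01_continuous:
  fixes f :: "real \<Rightarrow> 'a::euclidean_space"
  assumes "continuous_on {0..1} f"
  shows "integrable M01 f" "integral\<^sup>L M01 f = integral {0..1} f"
proof -
  have "f absolutely_integrable_on {0..1}" by (rule absolutely_integrable_continuous_real[OF assms])
  then have "f absolutely_integrable_on {0<..<1}"
    by (rule set_integrable_subset) auto
  then show "integrable M01 f" by (intro absolutely_integrable_imp_integrable) auto
  then show "integral\<^sup>L M01 f = integral {0..1} f"
    by (subst lebesgue_integral_eq_integral) (auto simp: integral_open_interval_real)
qed

lemma expo_orthonormal: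
  "ip01 (expo (of_int m + \<theta>)) (expo (of_int n + \<theta>)) = (if m = n then 1 else 0)"
proof -
  have "ip01 (expo (of_int m + \<theta>)) (expo (of_int n + \<theta>)) = (LINT x|M01. cis (2 * pi * of_int (m - n) * x))"
    unfolding ip01_def expo_def by (simp add: cis_cnj cis_mult algebra_simps)
  also have "\<dots> = integral {0..1} (\<lambda>x. cis (2 * pi * of_int (m - n) * x))"
    by (intro integral_M01_continuous continuous_intros)
  also have "\<dots> = (if m = n then 1 else 0)"
  proof (cases "m = n")
    case False
    define c where "c = 2 * pi * real_of_int (m - n)"
    have c: "c \<noteq> 0" using False by (simp add: c_def)
    have d: "((\<lambda>x. cis (c * x) / (\<i> * c)) has_vector_derivative cis (c * x)) (at x within {0..1})" for x
      using c unfolding cis_conv_exp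
      by (auto intro!: derivative_eq_intros has_vector_derivative_real_field simp: field_simps)
    have "((\<lambda>x. cis (c * x)) has_integral (cis (c * 1) / (\<i> * c) - cis (c * 0) / (\<i> * c))) {0..1}"
      by (rule fundamental_theorem_of_calculus[OF _ d]) simp
    moreover have "cis (c * 1) = 1" unfolding c_def using cis_multiple_2pi[of "of_int (m - n)"] by simp
    ultimately show ?thesis using False unfolding c_def by (simp add: integral_unique)
  qed simp
  finally show ?thesis .
qed

lemma bessel_inequality:
  assumes f: "f \<in> L2_01" and S: "finite S"
  shows "(\<Sum>n\<in>S. (cmod (fourier f (of_int n + \<theta>)))\<^sup>2) \<le> (l2norm f)\<^sup>2"
proof -
  define c where "c n = fourier f (of_int n + \<theta>)" for n
  define e where "e n = expo (of_int n + \<theta>)" for n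
  define P where "P = (\<lambda>x. \<Sum>n\<in>S. c n * e n x)"
  define s where "s = (\<Sum>n\<in>S. (cmod (c n))\<^sup>2)"
  have eL: "e n \<in> L2_01" "(\<lambda>x. c n * e n x) \<in> L2_01" for n
    by (auto simp: e_def expo_L2 L2_01_scale)
  have PL: "P \<in> L2_01" unfolding P_def by (intro L2_01_sum eL)
  have Ph: "ip01 P h = (\<Sum>n\<in>S. c n * ip01 (e n) h)" if "h \<in> L2_01" for h
    unfolding P_def using that eL by (simp add: ip01_sum_left ip01_scale_left)
  have "ip01 (e n) f = cnj (c n)" for n
    unfolding c_def e_def fourier_ip01 by (rule ip01_cnj)
  then have Pf: "ip01 P f = of_real s"
    using Ph[OF f] by (simp add: s_def flip: complex_norm_square)
  have "ip01 P (e n) = c n" if "n \<in> S" for n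
    using Ph[OF eL(1)] that S by (simp add: e_def expo_orthonormal if_distrib cong: if_cong)
  then have "ip01 (e n) P = cnj (c n)" if "n \<in> S" for n
    using that by (subst ip01_cnj) simp
  then have PP: "ip01 P P = of_real s"
    using Ph[OF PL] by (simp add: s_def flip: complex_norm_square)
  have nP: "(l2norm P)\<^sup>2 = s"
    using PP unfolding ip01_self of_real_eq_iff .
  have "0 \<le> (l2norm (\<lambda>x. f x + (-1) * P x))\<^sup>2" by simp
  also have "\<dots> = (l2norm f)\<^sup>2 + (l2norm (\<lambda>x. (-1) * P x))\<^sup>2 + 2 * Re (ip01 f (\<lambda>x. (-1) * P x))"
    by (rule l2norm_add_sq[OF f L2_01_scale[OF PL]])
  also have "ip01 f (\<lambda>x. (-1) * P x) = - of_real s"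
    by (subst ip01_cnj, subst ip01_scale_left) (simp add: Pf)
  also have "l2norm (\<lambda>x. (-1) * P x) = l2norm P" by (subst l2norm_scale) simp
  finally show ?thesis by (simp add: nP s_def c_def)
qed

section \<open>Differentiability of the transform, unit windows and Bessel's inequality for
  integrals\<close>

lemma cis_Taylor_bound: "cmod (cis y - 1 - \<i> * of_real y) \<le> y\<^sup>2"
proof -
  have "norm (exp (\<i> * of_real y) - (\<Sum>k\<le>1. (\<i> * of_real y) ^ k / fact k))
      \<le> exp \<bar>Re (\<i> * of_real y)\<bar> * norm (\<i> * of_real y :: complex) ^ Suc 1 / fact 1"
    by (rule Taylor_exp)
  then show ?thesis by (simp add: cis_conv_exp norm_mult diff_diff_eq power2_eq_square abs_mult_self_eq)
qed

text \<open>Differentiation under the integral: the second-order Taylor remainder of the exponential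
  is bounded uniformly for x in (0,1), so the error of the linear approximation is at most a
  multiple of the squared increment.\<close>

lemma fourier_has_vector_derivative:
  assumes f: "f \<in> L2_01"
  shows "(fourier f has_vector_derivative fourier (\<lambda>x. (- 2 * pi * \<i> * of_real x) * f x) \<omega>) (at \<omega>)"
proof -
  let ?g = "\<lambda>x. (- 2 * pi * \<i> * of_real x) * f x"
  have g: "?g \<in> L2_01"
    by (rule L2_01_bounded_mult[OF f, where B = "2 * pi"])
      (auto intro!: measurable_M01_borel simp: norm_mult)
  \<comment> \<open>The summand 1 keeps \<open>C\<close> positive when \<open>f\<close> vanishes, so
    that \<open>e / C\<close> is a valid radius.\<close>
  define C where "C = (2 * pi)\<^sup>2 * (LINT x|M01. cmod (f x)) + 1"
  have C: "C > 0" unfolding C_def by (intro add_nonneg_pos mult_nonneg_nonneg integral_nonneg_AE) auto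
  have bound: "cmod (fourier f v - fourier f \<omega> - (v - \<omega>) *\<^sub>R fourier ?g \<omega>) \<le> C * (v - \<omega>)\<^sup>2" for v
  proof -
    define h where "h x = f x * cnj (expo \<omega> x) * (cis (2 * pi * (\<omega> - v) * x) - 1 - \<i> * of_real (2 * pi * (\<omega> - v) * x))" for x
    have i1: "integrable M01 (\<lambda>x. f x * cnj (expo u x))" "integrable M01 (\<lambda>x. ?g x * cnj (expo u x))" for u
      using ip01_integrable[OF f expo_L2] ip01_integrable[OF g expo_L2] .
    have h: "h x = f x * cnj (expo v x) - f x * cnj (expo \<omega> x) - (v - \<omega>) *\<^sub>R (?g x * cnj (expo \<omega> x))" for x
    proof -
      have "cnj (expo \<omega> x) * cis (2 * pi * (\<omega> - v) * x) = cnj (expo v x)"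
        unfolding expo_def cis_cnj cis_mult by (simp add: algebra_simps)
      then show ?thesis unfolding h_def by (simp add: algebra_simps scaleR_conv_of_real)
    qed
    have hi: "integrable M01 h"
      unfolding h by (intro Bochner_Integration.integrable_diff integrable_scaleR_right i1)
    have "fourier f v - fourier f \<omega> - (v - \<omega>) *\<^sub>R fourier ?g \<omega> = (LINT x|M01. h x)"
    proof -
      have j: "integrable M01 (\<lambda>x. f x * cnj (expo v x) - f x * cnj (expo \<omega> x))"
        "integrable M01 (\<lambda>x. (v - \<omega>) *\<^sub>R (?g x * cnj (expo \<omega> x)))"
        by (intro Bochner_Integration.integrable_diff integrable_scaleR_right i1)+
      show ?thesis
        unfolding h fourier_eq Bochner_Integration.integral_diff[OF j] integral_scaleR_right
          Bochner_Integration.integral_diff[OF i1(1) i1(1)] ..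
    qed
    also have "cmod \<dots> \<le> (LINT x|M01. cmod (h x))" by (rule integral_norm_bound)
    also have "\<dots> \<le> (LINT x|M01. (2 * pi)\<^sup>2 * (v - \<omega>)\<^sup>2 * cmod (f x))"
    proof (rule integral_mono)
      show "integrable M01 (\<lambda>x. cmod (h x))" using hi by (rule integrable_norm)
      show "integrable M01 (\<lambda>x. (2 * pi)\<^sup>2 * (v - \<omega>)\<^sup>2 * cmod (f x))"
        by (intro integrable_mult_right integrable_norm L2_01_integrable f)
      fix x assume "x \<in> space M01"
      then have x: "0 < x" "x < 1" by auto
      have "cmod (h x) \<le> cmod (f x) * (2 * pi * (\<omega> - v) * x)\<^sup>2"
        unfolding h_def norm_mult[of "f x * _"] norm_mult[of "f x"]
        using cis_Taylor_bound[of "2 * pi * (\<omega> - v) * x"] by (auto intro!: mult_left_mono)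
      also have "(2 * pi * (\<omega> - v) * x)\<^sup>2 = (2 * pi)\<^sup>2 * (v - \<omega>)\<^sup>2 * x\<^sup>2"
        by (simp add: power_mult_distrib power2_commute)
      also have "cmod (f x) * ((2 * pi)\<^sup>2 * (v - \<omega>)\<^sup>2 * x\<^sup>2) \<le> cmod (f x) * ((2 * pi)\<^sup>2 * (v - \<omega>)\<^sup>2 * 1)"
        using x by (intro mult_left_mono) (auto simp: abs_square_le_1)
      finally show "cmod (h x) \<le> (2 * pi)\<^sup>2 * (v - \<omega>)\<^sup>2 * cmod (f x)"
        by (simp add: mult.commute)
    qed
    also have "\<dots> \<le> C * (v - \<omega>)\<^sup>2" unfolding C_def by (simp add: algebra_simps)
    finally show ?thesis .
  qed
  show ?thesis
    unfolding has_vector_derivative_def has_derivative_at'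
  proof (intro conjI allI impI)
    fix e :: real assume "e > 0"
    show "\<exists>d>0. \<forall>v. 0 < norm (v - \<omega>) \<and> norm (v - \<omega>) < d \<longrightarrow>
        norm (fourier f v - fourier f \<omega> - (v - \<omega>) *\<^sub>R fourier ?g \<omega>) / norm (v - \<omega>) < e"
    proof (intro exI[of _ "e / C"] conjI allI impI)
      show "0 < e / C" using \<open>e > 0\<close> C by simp
      fix v assume v: "0 < norm (v - \<omega>) \<and> norm (v - \<omega>) < e / C"
      have "norm (fourier f v - fourier f \<omega> - (v - \<omega>) *\<^sub>R fourier ?g \<omega>) \<le> C * \<bar>v - \<omega>\<bar> * \<bar>v - \<omega>\<bar>"
        using bound[of v] by (simp add: power2_eq_square mult.assoc)
      also have "\<dots> < e * \<bar>v - \<omega>\<bar>"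
        using v C by (intro mult_strict_right_mono) (auto simp: field_simps)
      finally show "norm (fourier f v - fourier f \<omega> - (v - \<omega>) *\<^sub>R fourier ?g \<omega>) / norm (v - \<omega>) < e"
        using v by (simp add: field_simps)
    qed
  qed (rule bounded_linear_scaleR_left)
qed

lemma fourier_continuous [continuous_intros]:
  "f \<in> L2_01 \<Longrightarrow> continuous_on S (fourier f)"
  by (meson continuous_at_imp_continuous_on fourier_has_vector_derivative has_vector_derivative_continuous)

text \<open>This carries estimates for the frequencies \<open>n + \<theta>\<close>, uniform in
  \<open>\<theta>\<close>, over to integrals on the line. The half-open range of \<open>n\<close>
  yields exactly the 2R unit intervals that tile the window.\<close>

lemma integral_unit_windows:
  fixes F :: "real \<Rightarrow> real"
  assumes F: "continuous_on UNIV F"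
  shows "integral {- real R..real R} F = integral {0..1} (\<lambda>\<theta>. \<Sum>n\<in>{- int R..<int R}. F (of_int n + \<theta>))"
proof -
  have c: "continuous_on S (\<lambda>\<theta>. F (u + \<theta>))" for u S
    by (intro continuous_on_compose2[OF F] continuous_intros) auto
  have i: "F integrable_on {u..v}" for u v
    by (intro integrable_continuous_interval continuous_on_subset[OF F]) auto
  have shift: "integral {0..1} (\<lambda>\<theta>. F (u + \<theta>)) = integral {u..u+1} F" for u
    using integral_shift_Icc_real[of 0 1 F u] by (simp add: o_def add.commute)
  have "(\<Sum>n\<in>{- int R..<int R}. integral {of_int n..of_int n + 1} F) = integral {- real R..real R} F"
  proof (induction R)
    case (Suc R)
    have ends: "real (Suc R) = real R + 1" "- (real R + 1) = - real R - 1" by simp_all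
    have "{- int (Suc R)..<int (Suc R)} = insert (- int R - 1) (insert (int R) {- int R..<int R})" by auto
    then have "(\<Sum>n\<in>{- int (Suc R)..<int (Suc R)}. integral {of_int n..of_int n + 1} F)
       = integral {- real R - 1..- real R} F + (integral {real R..real R + 1} F + integral {- real R..real R} F)"
      using Suc by simp
    also have "\<dots> = integral {- real (Suc R)..real (Suc R)} F"
    proof -
      have A: "integral {- real R - 1..- real R} F + integral {- real R..real R} F = integral {- real R - 1..real R} F"
        by (rule Henstock_Kurzweil_Integration.integral_combine[OF _ _ i]) auto
      have B: "integral {- real R - 1..real R} F + integral {real R..real R + 1} F = integral {- real R - 1..real R + 1} F"
        by (rule Henstock_Kurzweil_Integration.integral_combine[OF _ _ i]) auto
      show ?thesis unfolding ends using A B by linarith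
    qed
    finally show ?case .
  qed simp
  then show ?thesis
    by (subst integral_sum) (auto intro!: integrable_continuous_interval c simp: shift)
qed

lemma bessel_integral:
  assumes f: "f \<in> L2_01"
  shows "integral {- real R..real R} (\<lambda>\<omega>. (cmod (fourier f \<omega>))\<^sup>2) \<le> (l2norm f)\<^sup>2"
proof -
  have c: "continuous_on UNIV (\<lambda>\<omega>. (cmod (fourier f \<omega>))\<^sup>2)"
    by (intro continuous_intros f)
  have "integral {- real R..real R} (\<lambda>\<omega>. (cmod (fourier f \<omega>))\<^sup>2)
     = integral {0..1} (\<lambda>\<theta>. \<Sum>n\<in>{- int R..<int R}. (cmod (fourier f (of_int n + \<theta>)))\<^sup>2)"
    by (rule integral_unit_windows[OF c])
  also have "\<dots> \<le> integral {0..1} (\<lambda>\<theta>::real. (l2norm f)\<^sup>2)"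
    by (intro integral_le integrable_continuous_interval continuous_intros bessel_inequality f
        continuous_on_compose2[OF c]) auto
  finally show ?thesis by simp
qed

section \<open>Parseval's identity for Lipschitz functions\<close>

lemma sin_pi_ge:
  assumes "0 \<le> t" "t \<le> 1 / 2"
  shows "2 * t \<le> sin (pi * t)"
proof -
  have "concave_on {0..pi / 2} (\<lambda>x::real. sin x)"
    by (rule f''_le0_imp_concave[where f' = cos and f'' = "\<lambda>x. - sin x"])
      (auto intro!: derivative_eq_intros sin_ge_zero)
  then have "(1 - 2 * t) * sin 0 + 2 * t * sin (pi / 2) \<le> sin ((1 - 2 * t) *\<^sub>R 0 + (2 * t) *\<^sub>R (pi / 2))"
    using assms by (intro concave_onD[of "{0..pi/2}" sin]) auto
  then show ?thesis by (simp add: mult.commute)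
qed

text \<open>The modulus is \<open>2 * \<bar>sin (pi * s)\<bar>\<close>, and Jordan's inequality
  applies on either side of 1/2. The minimum is the distance of \<open>s\<close> from the nearest
  integer; the estimate keeps the denominator in Chernoff's quotient away from zero.\<close>

lemma norm_expo_minus_1_ge:
  assumes "\<bar>s\<bar> \<le> 1"
  shows "4 * min \<bar>s\<bar> (1 - \<bar>s\<bar>) \<le> cmod (expo 1 s - 1)"
proof -
  have 1: "cmod (expo 1 s - 1) = 2 * \<bar>sin (pi * s)\<bar>"
    using dist_exp_i_1[of "2 * pi * s"] by (simp add: expo_def cis_conv_exp)
  have 2: "\<bar>sin (pi * s)\<bar> = \<bar>sin (pi * \<bar>s\<bar>)\<bar>"
    by (cases "s \<ge> 0") auto
  have 3: "2 * min \<bar>s\<bar> (1 - \<bar>s\<bar>) \<le> \<bar>sin (pi * \<bar>s\<bar>)\<bar>"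
  proof (cases "\<bar>s\<bar> \<le> 1 / 2")
    case True
    then show ?thesis using sin_pi_ge[of "\<bar>s\<bar>"] by simp
  next
    case False
    have "sin (pi * (1 - \<bar>s\<bar>)) = sin (pi * \<bar>s\<bar>)"
      by (simp add: right_diff_distrib)
    then show ?thesis using sin_pi_ge[of "1 - \<bar>s\<bar>"] False assms by simp
  qed
  show ?thesis using 1 2 3 by linarith
qed

text \<open>Chernoff's argument for the pointwise convergence of Fourier series: dividing
  \<open>g - g(x\<^sub>0)\<close> by \<open>e\<^bsup>2\<pi>i(x - x\<^sub>0)\<^esup> - 1\<close> makes the partial sums telescope.\<close>

lemma chernoff_telescope:
  fixes g :: "real \<Rightarrow> complex"
  assumes g: "g \<in> L2_01" and h: "h \<in> L2_01"
    and eq: "\<And>x. x \<in> {0<..<1} \<Longrightarrow> g x = g x0 + (expo 1 (x - x0) - 1) * h x"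
    and R: "R \<ge> 1"
  shows "(\<Sum>n\<in>{- int R..<int R}. fourier g (of_int n) * expo (of_int n) x0)
     = g x0 + expo (- real R - 1) x0 * fourier h (- real R - 1) - expo (real R - 1) x0 * fourier h (real R - 1)"
proof -
  define a where "a n = expo (of_int n) x0 * fourier h (of_int n)" for n
  have step: "fourier g (of_int n) * expo (of_int n) x0 = (if n = 0 then g x0 else 0) + (a (n - 1) - a n)" for n
  proof -
    have L: "(\<lambda>x. expo 1 (x - x0) * h x) \<in> L2_01" "(\<lambda>x. g x0 * expo 0 x) \<in> L2_01"
      by (auto intro!: L2_01_bounded_mult[OF h, where B = 1] L2_01_scale expo_L2 L2_01_const
          simp: expo_def measurable_M01_borel)
    have "fourier g (of_int n) = fourier (\<lambda>x. g x0 * expo 0 x + (expo 1 (x - x0) * h x - h x)) (of_int n)"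
      unfolding fourier_eq
      by (intro Bochner_Integration.integral_cong refl) (subst eq, auto simp: expo_def algebra_simps)
    also have "\<dots> = g x0 * fourier (expo 0) (of_int n) + (fourier (\<lambda>x. expo 1 (x - x0) * h x) (of_int n) - fourier h (of_int n))"
      using L h by (simp add: fourier_add fourier_diff fourier_scale L2_01_diff)
    also have "fourier (expo 0) (of_int n) = (if n = 0 then 1 else 0)"
      unfolding fourier_ip01 using expo_orthonormal[of 0 0 n] by auto
    also have "fourier (\<lambda>x. expo 1 (x - x0) * h x) (of_int n) = fourier (\<lambda>x. cnj (expo 1 x0) * h x) (of_int (n - 1))"
      unfolding fourier_eq expo_def cis_cnj
      by (intro Bochner_Integration.integral_cong refl) (simp add: mult.assoc mult.left_commute[of _ "h _"] cis_mult algebra_simps)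
    also have "\<dots> = cnj (expo 1 x0) * fourier h (of_int (n - 1))" by (rule fourier_scale)
    finally have fg: "fourier g (of_int n) = g x0 * (if n = 0 then 1 else 0)
        + (cnj (expo 1 x0) * fourier h (of_int (n - 1)) - fourier h (of_int n))" .
    have "fourier g (of_int n) * expo (of_int n) x0 =
      (if n = 0 then g x0 else 0) * expo (of_int n) x0 +
      (cnj (expo 1 x0) * expo (of_int n) x0 * fourier h (of_int (n - 1)) - a n)"
      unfolding fg a_def by (cases "n = 0") (simp_all add: algebra_simps)
    also have "cnj (expo 1 x0) * expo (of_int n) x0 = expo (of_int (n - 1)) x0"
      unfolding expo_def cis_cnj cis_mult by (simp add: algebra_simps)
    finally show ?thesis by (simp add: a_def expo_def)
  qed
  have tele: "(\<Sum>n\<in>{- int R..<int R}. a (n - 1) - a n) = a (- int R - 1) - a (int R - 1)" for R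
  proof (induction R)
    case (Suc R)
    have "{- int (Suc R)..<int (Suc R)} = insert (- int R - 1) (insert (int R) {- int R..<int R})" by auto
    then show ?case using Suc by (simp add: algebra_simps)
  qed simp
  show ?thesis
    unfolding step sum.distrib tele using R by (simp add: a_def)
qed

text \<open>A Riemann-Lebesgue statement obtained from Bessel's inequality: the squares are summable
  along any injective sequence of integers.\<close>

lemma fourier_at_integers_tendsto_0:
  assumes h: "h \<in> L2_01" and k: "inj k"
  shows "(\<lambda>n::nat. fourier h (of_int (k n))) \<longlonglongrightarrow> 0"
proof -
  have "(\<Sum>n<N. (cmod (fourier h (of_int (k n))))\<^sup>2) \<le> (l2norm h)\<^sup>2" for N
  proof -
    have "(\<Sum>n\<in>k ` {..<N}. (cmod (fourier h (of_int n + 0)))\<^sup>2) \<le> (l2norm h)\<^sup>2"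
      by (rule bessel_inequality[OF h]) simp
    moreover have "inj_on k {..<N}" using k by (rule inj_on_subset) simp
    ultimately show ?thesis by (simp add: sum.reindex)
  qed
  then have "summable (\<lambda>n. (cmod (fourier h (of_int (k n))))\<^sup>2)"
    by (intro summableI_nonneg_bounded) auto
  then have "(\<lambda>n. (cmod (fourier h (of_int (k n))))\<^sup>2) \<longlonglongrightarrow> 0"
    by (rule summable_LIMSEQ_zero)
  then have "(\<lambda>n. sqrt ((cmod (fourier h (of_int (k n))))\<^sup>2)) \<longlonglongrightarrow> 0"
    using tendsto_real_sqrt by fastforce
  then show ?thesis by (simp add: tendsto_norm_zero_iff)
qed

lemma norm_fourier_le:
  assumes "f \<in> borel_measurable M01" "\<And>x. x \<in> {0<..<1} \<Longrightarrow> cmod (f x) \<le> B"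
  shows "cmod (fourier f \<omega>) \<le> B"
proof -
  interpret finite_measure M01 by (rule finite_measure_M01)
  have "f \<in> L2_01" using assms by (rule L2_01_bounded)
  have "cmod (fourier f \<omega>) \<le> (LINT x|M01. cmod (f x * cnj (expo \<omega> x)))"
    unfolding fourier_eq by (rule integral_norm_bound)
  also have "\<dots> \<le> (LINT x|M01. B)"
    using assms(2) by (intro integral_mono integrable_norm ip01_integrable \<open>f \<in> L2_01\<close> expo_L2)
      (auto simp: norm_mult)
  also have "\<dots> = B" using measure_M01 by simp
  finally show ?thesis .
qed

lemma continuous_measurable_M01:
  "continuous_on {0..1} f \<Longrightarrow> f \<in> borel_measurable M01"
  by (rule continuous_imp_measurable_on_sets_lebesgue) (auto intro: continuous_on_subset)

text \<open>The Lipschitz condition together with periodicity bounds Chernoff's quotient by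
  \<open>L\<close>, uniformly in the base point. The partial sums therefore converge at every point
  of (0,1) and stay below \<open>B + 2 * L\<close>, so dominated convergence allows integrating them
  against the conjugate of \<open>g\<close>.\<close>

lemma parseval_lipschitz:
  fixes g :: "real \<Rightarrow> complex"
  assumes lip: "L-lipschitz_on {0..1} g" and per: "g 0 = g 1"
  shows "(\<lambda>R. \<Sum>n\<in>{- int R..<int R}. (cmod (fourier g (of_int n)))\<^sup>2) \<longlonglongrightarrow> (l2norm g)\<^sup>2"
proof -
  interpret finite_measure M01 by (rule finite_measure_M01)
  have cont: "continuous_on {0..1} g" using lip by (rule lipschitz_on_continuous_on)
  have meas: "g \<in> borel_measurable M01" using cont by (rule continuous_measurable_M01)
  obtain B where B: "\<And>x. x \<in> {0..1} \<Longrightarrow> cmod (g x) \<le> B"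
    using compact_continuous_image[OF cont compact_Icc] compact_imp_bounded bounded_iff by (metis imageI)
  have gL: "g \<in> L2_01" using meas B by (intro L2_01_bounded[where B = B]) auto
  have L0: "L \<ge> 0" using lip by (rule lipschitz_on_nonneg)
  \<comment> \<open>At \<open>x = x0\<close> the quotient is 0/0 = 0, which is compatible with the
    bound and with the identity required of it.\<close>
  define h where "h x0 x = (g x - g x0) / (expo 1 (x - x0) - 1)" for x0 x
  \<comment> \<open>The minimum is the distance on the circle; its second entry comes from the path
    through the identified endpoints 0 and 1.\<close>
  have near: "cmod (g x - g x0) \<le> L * min \<bar>x - x0\<bar> (1 - \<bar>x - x0\<bar>)" if "x \<in> {0<..<1}" "x0 \<in> {0<..<1}" for x x0
  proof -
    have l: "cmod (g u - g v) \<le> L * \<bar>u - v\<bar>" if "u \<in> {0..1}" "v \<in> {0..1}" for u v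
      using lipschitz_onD[OF lip that] by (simp add: dist_norm)
    have "cmod (g x - g x0) \<le> cmod (g x - g 0) + cmod (g 1 - g x0)"
      using norm_triangle_ineq[of "g x - g 0" "g 1 - g x0"] per by simp
    also have "\<dots> \<le> L * x + L * (1 - x0)"
      using l[of x 0] l[of 1 x0] that by auto
    finally have 1: "cmod (g x - g x0) \<le> L * (1 - (x0 - x))" by (simp add: algebra_simps)
    have "cmod (g x - g x0) \<le> cmod (g x - g 1) + cmod (g 0 - g x0)"
      using norm_triangle_ineq[of "g x - g 1" "g 0 - g x0"] per by simp
    also have "\<dots> \<le> L * (1 - x) + L * x0"
      using l[of x 1] l[of 0 x0] that by auto
    finally have 2: "cmod (g x - g x0) \<le> L * (1 - (x - x0))" by (simp add: algebra_simps)
    show ?thesis using l[of x x0] 1 2 that by (auto simp: min_def abs_if)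
  qed
  have hB: "cmod (h x0 x) \<le> L" and heq: "g x = g x0 + (expo 1 (x - x0) - 1) * h x0 x"
    if "x \<in> {0<..<1}" "x0 \<in> {0<..<1}" for x x0
  proof -
    define m where "m = min \<bar>x - x0\<bar> (1 - \<bar>x - x0\<bar>)"
    have e: "4 * m \<le> cmod (expo 1 (x - x0) - 1)" unfolding m_def
      using that by (intro norm_expo_minus_1_ge) (auto simp: abs_if)
    have n: "cmod (g x - g x0) \<le> L * m" unfolding m_def using that by (rule near)
    have "x \<noteq> x0 \<Longrightarrow> m > 0" using that by (auto simp: m_def abs_if)
    then have nz: "x \<noteq> x0 \<Longrightarrow> expo 1 (x - x0) - 1 \<noteq> 0" using e by auto
    show "cmod (h x0 x) \<le> L"
    proof (cases "x = x0")
      case False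
      have "L * m \<le> L * cmod (expo 1 (x - x0) - 1)"
        using e \<open>x \<noteq> x0 \<Longrightarrow> m > 0\<close>[OF False] L0 by (intro mult_left_mono) auto
      then show ?thesis using n nz[OF False] unfolding h_def norm_divide
        by (simp add: divide_le_eq)
    qed (simp add: h_def L0)
    show "g x = g x0 + (expo 1 (x - x0) - 1) * h x0 x"
      using nz by (cases "x = x0") (auto simp: h_def)
  qed
  have hm: "h x0 \<in> borel_measurable M01" for x0
  proof -
    have "(\<lambda>x. expo 1 (x - x0)) \<in> borel_measurable M01"
      unfolding expo_def by (intro measurable_M01_borel) measurable
    then show ?thesis unfolding h_def by (intro borel_measurable_divide borel_measurable_diff meas) auto
  qed
  have hL: "h x0 \<in> L2_01" if "x0 \<in> {0<..<1}" for x0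
    using hm hB that by (intro L2_01_bounded[where B = L]) auto
  define S where "S R x = (\<Sum>n\<in>{- int R..<int R}. fourier g (of_int n) * expo (of_int n) x)" for R x
  have S_eq: "S R x0 = g x0 + expo (- real R - 1) x0 * fourier (h x0) (- real R - 1)
      - expo (real R - 1) x0 * fourier (h x0) (real R - 1)" if "x0 \<in> {0<..<1}" "R \<ge> 1" for R x0
    unfolding S_def by (rule chernoff_telescope[OF gL hL[OF that(1)] heq[OF _ that(1)] that(2)])
  have S_lim: "(\<lambda>R. S R x0) \<longlonglongrightarrow> g x0" if x0: "x0 \<in> {0<..<1}" for x0
  proof -
    have i: "inj (\<lambda>n. - int n - 1)" "inj (\<lambda>n. int n - 1)" by (simp_all add: inj_def)
    have a: "(\<lambda>R. fourier (h x0) (- real R - 1)) \<longlonglongrightarrow> 0" "(\<lambda>R. fourier (h x0) (real R - 1)) \<longlonglongrightarrow> 0"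
      using fourier_at_integers_tendsto_0[OF hL[OF x0] i(1)] fourier_at_integers_tendsto_0[OF hL[OF x0] i(2)]
      by simp_all
    have b: "(\<lambda>R. expo (c R) x0 * d R) \<longlonglongrightarrow> 0" if "d \<longlonglongrightarrow> 0" for c :: "nat \<Rightarrow> real" and d
    proof (rule tendsto_norm_zero_cancel)
      show "(\<lambda>R. cmod (expo (c R) x0 * d R)) \<longlonglongrightarrow> 0"
        using tendsto_norm_zero[OF that] by (simp add: norm_mult)
    qed
    have "(\<lambda>R. g x0 + expo (- real R - 1) x0 * fourier (h x0) (- real R - 1)
      - expo (real R - 1) x0 * fourier (h x0) (real R - 1)) \<longlonglongrightarrow> g x0 + 0 - 0"
      by (rule tendsto_diff[OF tendsto_add[OF tendsto_const b[OF a(1)]] b[OF a(2)]])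
    moreover have "eventually (\<lambda>R. g x0 + expo (- real R - 1) x0 * fourier (h x0) (- real R - 1)
      - expo (real R - 1) x0 * fourier (h x0) (real R - 1) = S R x0) sequentially"
      using eventually_ge_at_top[of 1] by eventually_elim (simp add: S_eq[OF x0])
    ultimately have "(\<lambda>R. S R x0) \<longlonglongrightarrow> g x0 + 0 - 0" by (rule Lim_transform_eventually)
    then show ?thesis by simp
  qed
  have S_bound: "cmod (S R x0) \<le> B + 2 * L" if x0: "x0 \<in> {0<..<1}" "R \<ge> 1" for x0 R
  proof -
    have f: "cmod (fourier (h x0) w) \<le> L" for w
      by (rule norm_fourier_le[OF hm hB[OF _ x0(1)]])
    have "cmod (a + u * b - v * c) \<le> cmod a + cmod b + cmod c" if "cmod u = 1" "cmod v = 1" for a b c u v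
      using norm_triangle_ineq4[of "a + u * b" "v * c"] norm_triangle_ineq[of a "u * b"] that
      by (simp add: norm_mult)
    then have "cmod (S R x0) \<le> cmod (g x0) + cmod (fourier (h x0) (- real R - 1)) + cmod (fourier (h x0) (real R - 1))"
      unfolding S_eq[OF x0] by simp
    moreover have "cmod (g x0) \<le> B" using x0(1) by (intro B) simp
    ultimately show ?thesis using f[of "- real R - 1"] f[of "real R - 1"] by linarith
  qed
  have Sm: "S R \<in> borel_measurable M01" for R
    unfolding S_def by (intro borel_measurable_sum borel_measurable_times borel_measurable_const expo_measurable)
  \<comment> \<open>\<open>Suc R\<close> because the uniform bound on the partial sums is available
    from index 1 on.\<close>
  have "(\<lambda>R. LINT x|M01. S (Suc R) x * cnj (g x)) \<longlonglongrightarrow> (LINT x|M01. g x * cnj (g x))"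
  proof (rule integral_dominated_convergence[where w = "\<lambda>x. (B + 2 * L) * B"])
    have cm: "(\<lambda>x. cnj (g x)) \<in> borel_measurable M01" using L2_01_cnj[OF gL] by (rule L2_01_measurable)
    show "(\<lambda>x. g x * cnj (g x)) \<in> borel_measurable M01" by (intro borel_measurable_times meas cm)
    show "(\<lambda>x. S (Suc R) x * cnj (g x)) \<in> borel_measurable M01" for R by (intro borel_measurable_times Sm cm)
    show "AE x in M01. (\<lambda>R. S (Suc R) x * cnj (g x)) \<longlonglongrightarrow> g x * cnj (g x)"
      by (intro AE_I2 tendsto_mult tendsto_const LIMSEQ_Suc[OF S_lim]) simp
    have B0: "0 \<le> B" using order_trans[OF norm_ge_zero B[of 0]] by simp
    show "AE x in M01. norm (S (Suc R) x * cnj (g x)) \<le> (B + 2 * L) * B" for R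
    proof (rule AE_I2)
      fix x assume "x \<in> space M01"
      then have x: "x \<in> {0<..<1}" "x \<in> {0..1}" by auto
      show "norm (S (Suc R) x * cnj (g x)) \<le> (B + 2 * L) * B"
        unfolding norm_mult complex_mod_cnj using B0 L0
        by (intro mult_mono S_bound[OF x(1)] B[OF x(2)]) simp_all
    qed
  qed auto
  moreover have "(LINT x|M01. S R x * cnj (g x)) = of_real (\<Sum>n\<in>{- int R..<int R}. (cmod (fourier g (of_int n)))\<^sup>2)" for R
  proof -
    have "(LINT x|M01. S R x * cnj (g x)) = ip01 (S R) g" by (simp add: ip01_def)
    also have "\<dots> = (\<Sum>n\<in>{- int R..<int R}. fourier g (of_int n) * ip01 (expo (of_int n)) g)"
      unfolding S_def by (subst ip01_sum_left) (auto intro!: L2_01_scale expo_L2 gL simp: ip01_scale_left)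
    also have "\<dots> = (\<Sum>n\<in>{- int R..<int R}. of_real ((cmod (fourier g (of_int n)))\<^sup>2))"
      by (intro sum.cong refl) (subst ip01_cnj, simp only: fourier_ip01 complex_norm_square)
    finally show ?thesis by simp
  qed
  moreover have "(LINT x|M01. g x * cnj (g x)) = of_real ((l2norm g)\<^sup>2)"
    using ip01_self[of g] by (simp add: ip01_def)
  ultimately have "(\<lambda>R. complex_of_real (\<Sum>n\<in>{- int (Suc R)..<int (Suc R)}. (cmod (fourier g (of_int n)))\<^sup>2))
      \<longlonglongrightarrow> of_real ((l2norm g)\<^sup>2)"
    by (simp only:)
  then have "(\<lambda>R. \<Sum>n\<in>{- int (Suc R)..<int (Suc R)}. (cmod (fourier g (of_int n)))\<^sup>2) \<longlonglongrightarrow> (l2norm g)\<^sup>2"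
    by (simp only: tendsto_of_real_iff)
  then show ?thesis by (rule LIMSEQ_imp_Suc)
qed

section \<open>Shifted frequencies and the energy outside a window\<close>

lemma norm_cis_diff_le: "cmod (cis a - cis b) \<le> \<bar>a - b\<bar>"
proof -
  have "cis a - cis b = cis b * (cis (a - b) - 1)"
    by (simp add: right_diff_distrib cis_mult)
  then have "cmod (cis a - cis b) = cmod (cis (a - b) - 1)" by (simp add: norm_mult)
  also have "\<dots> = 2 * \<bar>sin ((a - b) / 2)\<bar>"
    using dist_exp_i_1[of "a - b"] by (simp add: cis_conv_exp)
  also have "\<dots> \<le> \<bar>a - b\<bar>" using abs_sin_x_le_abs_x[of "(a - b) / 2"] by simp
  finally show ?thesis .
qed

lemma fourier_modulate: "fourier (\<lambda>x. cnj (expo \<theta> x) * G x) \<omega> = fourier G (\<omega> + \<theta>)"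
proof -
  have "cnj (expo (\<omega> + \<theta>) x) = cnj (expo \<theta> x) * cnj (expo \<omega> x)" for x
    unfolding expo_def cis_cnj cis_mult by (simp add: algebra_simps)
  then show ?thesis unfolding fourier_eq by (simp only: mult_ac)
qed

lemma lipschitz_modulate:
  fixes G :: "real \<Rightarrow> complex"
  assumes lip: "L-lipschitz_on {0..1} G" and B: "\<And>x. x \<in> {0..1} \<Longrightarrow> cmod (G x) \<le> B" and "0 \<le> \<theta>"
  shows "(L + B * (2 * pi * \<theta>))-lipschitz_on {0..1} (\<lambda>x. cnj (expo \<theta> x) * G x)"
proof (rule lipschitz_onI)
  have B0: "0 \<le> B" using order_trans[OF norm_ge_zero B[of 0]] by simp
  show "0 \<le> L + B * (2 * pi * \<theta>)" using lipschitz_on_nonneg[OF lip] B0 assms(3) by simp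
  fix x y :: real assume xy: "x \<in> {0..1}" "y \<in> {0..1}"
  have "cnj (expo \<theta> x) * G x - cnj (expo \<theta> y) * G y
     = cnj (expo \<theta> x) * (G x - G y) + G y * cnj (expo \<theta> x - expo \<theta> y)"
    by (simp add: algebra_simps)
  then have "dist (cnj (expo \<theta> x) * G x) (cnj (expo \<theta> y) * G y)
     \<le> cmod (cnj (expo \<theta> x) * (G x - G y)) + cmod (G y * cnj (expo \<theta> x - expo \<theta> y))"
    by (simp only: dist_norm norm_triangle_ineq)
  also have "\<dots> = cmod (G x - G y) + cmod (G y) * cmod (expo \<theta> x - expo \<theta> y)"
    by (simp only: norm_mult complex_mod_cnj norm_expo mult_1)
  also have "\<dots> \<le> L * dist x y + B * (2 * pi * \<theta> * dist x y)"
  proof (intro add_mono mult_mono B0 norm_ge_zero B xy)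
    show "cmod (G x - G y) \<le> L * dist x y" using lipschitz_onD[OF lip xy] by (simp add: dist_norm)
    have "cmod (expo \<theta> x - expo \<theta> y) \<le> \<bar>2 * pi * \<theta> * x - 2 * pi * \<theta> * y\<bar>"
      unfolding expo_def by (rule norm_cis_diff_le)
    also have "\<dots> = 2 * pi * \<theta> * dist x y"
      using assms(3) by (simp add: dist_real_def abs_mult flip: right_diff_distrib)
    finally show "cmod (expo \<theta> x - expo \<theta> y) \<le> 2 * pi * \<theta> * dist x y" .
  qed
  finally show "dist (cnj (expo \<theta> x) * G x) (cnj (expo \<theta> y) * G y) \<le> (L + B * (2 * pi * \<theta>)) * dist x y"
    by (simp add: algebra_simps)
qed

text \<open>For each \<open>\<theta>\<close> Parseval's identity is applied to \<open>G\<close>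
  multiplied by a unimodular exponential, whose coefficients are the values of the transform at
  \<open>n + \<theta>\<close>. That factor differs at 0 and 1 in general, so the product is periodic
  because \<open>G\<close> vanishes at both ends. Outside the window division by the frequency costs
  at most 1/(2 pi R), and Bessel's inequality for \<open>D\<close> sums up the tail.\<close>

lemma fourier_window_lower:
  fixes G :: "real \<Rightarrow> complex"
  assumes lip: "L-lipschitz_on {0..1} G" and ends: "G 0 = 0" "G 1 = 0"
    and D: "D \<in> L2_01" "\<And>\<omega>. fourier D \<omega> = 2 * pi * \<i> * \<omega> * fourier G \<omega>" and R: "R \<ge> 1"
  shows "(l2norm G)\<^sup>2 - (l2norm D)\<^sup>2 / (2 * pi * real R)\<^sup>2
    \<le> integral {- real R..real R} (\<lambda>\<omega>. (cmod (fourier G \<omega>))\<^sup>2)"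
proof -
  have cont: "continuous_on {0..1} G" using lip by (rule lipschitz_on_continuous_on)
  have meas: "G \<in> borel_measurable M01" using cont by (rule continuous_measurable_M01)
  obtain B where B: "\<And>x. x \<in> {0..1} \<Longrightarrow> cmod (G x) \<le> B"
    using compact_continuous_image[OF cont compact_Icc] compact_imp_bounded bounded_iff by (metis imageI)
  have GL: "G \<in> L2_01" using meas B by (intro L2_01_bounded[where B = B]) auto
  let ?w = "\<lambda>\<omega>. (cmod (fourier G \<omega>))\<^sup>2"
  have small: "?w \<omega> \<le> (cmod (fourier D \<omega>))\<^sup>2 / (2 * pi * real R)\<^sup>2" if "real R \<le> \<bar>\<omega>\<bar>" for \<omega>
  proof -
    have "(2 * pi * real R) * cmod (fourier G \<omega>) \<le> (2 * pi * \<bar>\<omega>\<bar>) * cmod (fourier G \<omega>)"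
      using that by (intro mult_right_mono mult_left_mono) auto
    also have "\<dots> = cmod (fourier D \<omega>)" by (simp add: D norm_mult)
    finally have "((2 * pi * real R) * cmod (fourier G \<omega>))\<^sup>2 \<le> (cmod (fourier D \<omega>))\<^sup>2"
      by (intro power_mono) auto
    then show ?thesis using R by (simp add: power_mult_distrib pos_le_divide_eq mult.commute)
  qed
  have pw: "(l2norm G)\<^sup>2 - (l2norm D)\<^sup>2 / (2 * pi * real R)\<^sup>2 \<le> (\<Sum>n\<in>{- int R..<int R}. ?w (of_int n + \<theta>))"
    if th: "\<theta> \<in> {0..1}" for \<theta>
  proof -
    let ?g = "\<lambda>x. cnj (expo \<theta> x) * G x"
    have "(\<lambda>R. \<Sum>n\<in>{- int R..<int R}. (cmod (fourier ?g (of_int n)))\<^sup>2) \<longlonglongrightarrow> (l2norm ?g)\<^sup>2"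
      using th ends by (intro parseval_lipschitz[OF lipschitz_modulate[OF lip B]]) auto
    moreover have "l2norm ?g = l2norm G" by (simp add: l2norm_def norm_mult)
    ultimately have lim: "(\<lambda>R. \<Sum>n\<in>{- int R..<int R}. ?w (of_int n + \<theta>)) \<longlonglongrightarrow> (l2norm G)\<^sup>2"
      by (simp add: fourier_modulate)
    have "(l2norm G)\<^sup>2 \<le> (\<Sum>n\<in>{- int R..<int R}. ?w (of_int n + \<theta>)) + (l2norm D)\<^sup>2 / (2 * pi * real R)\<^sup>2"
    proof (rule LIMSEQ_le_const2[OF lim], intro exI[of _ R] allI impI)
      fix R' assume "R \<le> R'"
      define A where "A = {- int R'..<int R'} - {- int R..<int R}"
      have "(\<Sum>n\<in>{- int R'..<int R'}. ?w (of_int n + \<theta>))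
         = (\<Sum>n\<in>{- int R..<int R}. ?w (of_int n + \<theta>)) + (\<Sum>n\<in>A. ?w (of_int n + \<theta>))"
        unfolding A_def using \<open>R \<le> R'\<close> by (subst sum.subset_diff[of "{- int R..<int R}"]) auto
      also have "(\<Sum>n\<in>A. ?w (of_int n + \<theta>)) \<le> (\<Sum>n\<in>A. (cmod (fourier D (of_int n + \<theta>)))\<^sup>2 / (2 * pi * real R)\<^sup>2)"
      proof (intro sum_mono small)
        fix n assume "n \<in> A"
        \<comment> \<open>The asymmetric index range fits \<open>\<theta>\<close> in [0,1]: from
          \<open>n <= - R - 1\<close> one still gets \<open>n + \<theta> <= - R\<close>.\<close>
        then have "n \<ge> int R \<or> n \<le> - int R - 1" by (auto simp: A_def)
        then have "real_of_int n \<ge> real R \<or> real_of_int n \<le> - real R - 1" by linarith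
        then show "real R \<le> \<bar>of_int n + \<theta>\<bar>" using th by auto
      qed
      also have "\<dots> = (\<Sum>n\<in>A. (cmod (fourier D (of_int n + \<theta>)))\<^sup>2) / (2 * pi * real R)\<^sup>2"
        by (rule sum_divide_distrib[symmetric])
      also have "\<dots> \<le> (l2norm D)\<^sup>2 / (2 * pi * real R)\<^sup>2"
        by (intro divide_right_mono bessel_inequality D) (auto simp: A_def)
      finally show "(\<Sum>n\<in>{- int R'..<int R'}. ?w (of_int n + \<theta>))
        \<le> (\<Sum>n\<in>{- int R..<int R}. ?w (of_int n + \<theta>)) + (l2norm D)\<^sup>2 / (2 * pi * real R)\<^sup>2" by simp
    qed
    then show ?thesis by simp
  qed
  have c: "continuous_on UNIV ?w" by (intro continuous_intros GL)
  have "(l2norm G)\<^sup>2 - (l2norm D)\<^sup>2 / (2 * pi * real R)\<^sup>2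
     = integral {0..1} (\<lambda>\<theta>::real. (l2norm G)\<^sup>2 - (l2norm D)\<^sup>2 / (2 * pi * real R)\<^sup>2)" by simp
  also have "\<dots> \<le> integral {0..1} (\<lambda>\<theta>. \<Sum>n\<in>{- int R..<int R}. ?w (of_int n + \<theta>))"
    by (intro integral_le integrable_continuous_interval continuous_intros pw
        continuous_on_compose2[OF c]) auto
  also have "\<dots> = integral {- real R..real R} ?w" by (rule integral_unit_windows[OF c, symmetric])
  finally show ?thesis .
qed

section \<open>Wirtinger's inequality and Voronoi cells\<close>

text \<open>Wirtinger's inequality by completing a square: a solution \<open>H\<close> of the Riccati equation
  \<open>H' = - c\<^sup>2 - H\<^sup>2\<close> gives \<open>\<bar>g'\<bar>\<^sup>2 - c\<^sup>2\<bar>g\<bar>\<^sup>2 = \<bar>g' - H g\<bar>\<^sup>2 + (H \<bar>g\<bar>\<^sup>2)'\<close>.\<close>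

lemma wirtinger_riccati:
  fixes g g' :: "real \<Rightarrow> complex" and H :: "real \<Rightarrow> real"
  assumes ab: "a \<le> b"
    and g: "\<And>x. x \<in> {a..b} \<Longrightarrow> (g has_vector_derivative g' x) (at x within {a..b})"
    and g': "continuous_on {a..b} g'"
    and H: "\<And>x. x \<in> {a..b} \<Longrightarrow> (H has_real_derivative (- c\<^sup>2 - (H x)\<^sup>2)) (at x within {a..b})"
    and bd: "H b * (cmod (g b))\<^sup>2 = 0" "H a * (cmod (g a))\<^sup>2 = 0"
  shows "c\<^sup>2 * integral {a..b} (\<lambda>x. (cmod (g x))\<^sup>2) \<le> integral {a..b} (\<lambda>x. (cmod (g' x))\<^sup>2)"
proof -
  let ?d = "\<lambda>x. H x * (2 * (g x \<bullet> g' x)) + (- c\<^sup>2 - (H x)\<^sup>2) * (cmod (g x))\<^sup>2"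
  have cg: "continuous_on {a..b} g"
    using has_vector_derivative_continuous[OF g] by (simp add: continuous_on_eq_continuous_within)
  have cH: "continuous_on {a..b} H"
    by (rule DERIV_continuous_on[OF H])
  have n: "((\<lambda>x. (cmod (g x))\<^sup>2) has_real_derivative 2 * (g x \<bullet> g' x)) (at x within {a..b})"
    if x: "x \<in> {a..b}" for x
  proof -
    have "((\<lambda>x. g x \<bullet> g x) has_vector_derivative (g x \<bullet> g' x + g' x \<bullet> g x)) (at x within {a..b})"
      by (rule bounded_bilinear.has_vector_derivative[OF bounded_bilinear_inner g[OF x] g[OF x]])
    then show ?thesis
      by (simp add: has_real_derivative_iff_has_vector_derivative dot_square_norm inner_commute[of "g' x" "g x"])
  qed
  have "(?d has_integral (H b * (cmod (g b))\<^sup>2 - H a * (cmod (g a))\<^sup>2)) {a..b}"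
  proof (rule fundamental_theorem_of_calculus[OF ab])
    fix x assume x: "x \<in> {a..b}"
    show "((\<lambda>x. H x * (cmod (g x))\<^sup>2) has_vector_derivative ?d x) (at x within {a..b})"
      unfolding has_real_derivative_iff_has_vector_derivative[symmetric]
      by (rule DERIV_mult'[OF H[OF x] n[OF x]])
  qed
  then have "integral {a..b} ?d = 0" unfolding bd by (simp add: integral_unique)
  moreover have "integral {a..b} ?d \<le> integral {a..b} (\<lambda>x. (cmod (g' x))\<^sup>2 - c\<^sup>2 * (cmod (g x))\<^sup>2)"
  proof (intro integral_le integrable_continuous_interval continuous_intros cg cH g')
    fix x assume "x \<in> {a..b}"
    have "0 \<le> (norm (g' x - H x *\<^sub>R g x))\<^sup>2" by simp
    also have "\<dots> = (cmod (g' x))\<^sup>2 + (H x)\<^sup>2 * (cmod (g x))\<^sup>2 - 2 * H x * (g x \<bullet> g' x)"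
      unfolding dot_square_norm[symmetric]
      by (simp add: inner_diff_left inner_diff_right power2_eq_square right_diff_distrib inner_commute[of "g' x" "g x"])
    finally show "?d x \<le> (cmod (g' x))\<^sup>2 - c\<^sup>2 * (cmod (g x))\<^sup>2"
      by (simp add: algebra_simps)
  qed
  moreover have "integral {a..b} (\<lambda>x. (cmod (g' x))\<^sup>2 - c\<^sup>2 * (cmod (g x))\<^sup>2)
     = integral {a..b} (\<lambda>x. (cmod (g' x))\<^sup>2) - c\<^sup>2 * integral {a..b} (\<lambda>x. (cmod (g x))\<^sup>2)"
    by (subst integral_diff)
      (auto intro!: integrable_continuous_interval continuous_intros cg g')
  ultimately show ?thesis by simp
qed

lemma cos_pos_small: "0 \<le> x \<Longrightarrow> x < pi / 2 \<Longrightarrow> cos x \<noteq> (0::real)"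
  using cos_gt_zero_pi[of x] by simp

lemma tan_riccati:
  assumes "cos y \<noteq> (0::real)"
  shows "c * c * inverse ((cos y)\<^sup>2) = c\<^sup>2 + (c * tan y)\<^sup>2"
proof -
  have "inverse ((cos y)\<^sup>2) = 1 + (tan y)\<^sup>2" using tan_sec[OF assms] by (simp add: power_inverse)
  then show ?thesis by (simp add: power_mult_distrib power2_eq_square[of c] distrib_left)
qed

text \<open>The Riccati solution is a tangent that vanishes at the free end, while \<open>g\<close>
  vanishes at the anchored end, so both boundary terms are zero. The strict bound
  \<open>c * (b - a) < pi / 2\<close> keeps the tangent finite up to the anchored end; it is the
  reason why later some \<open>\<theta>\<close> strictly above \<open>\<delta>\<close> is
  used.\<close>

lemma wirtinger_anchored:
  fixes g g' :: "real \<Rightarrow> complex"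
  assumes ab: "a \<le> b" and c: "0 < c" "c * (b - a) < pi / 2"
    and g: "\<And>x. (g has_vector_derivative g' x) (at x)"
    and g': "continuous_on UNIV g'"
    and zero: "g a = 0 \<or> g b = 0"
  shows "c\<^sup>2 * integral {a..b} (\<lambda>x. (cmod (g x))\<^sup>2) \<le> integral {a..b} (\<lambda>x. (cmod (g' x))\<^sup>2)"
proof -
  have dg: "(g has_vector_derivative g' x) (at x within {a..b})" for x
    using g by (rule has_vector_derivative_at_within)
  have cg: "continuous_on {a..b} g'" using g' by (rule continuous_on_subset) simp
  have small: "c * y < pi / 2" if "y \<le> b - a" for y
  proof -
    have "c * y \<le> c * (b - a)" using that c by (intro mult_left_mono) auto
    then show ?thesis using c by linarith
  qed
  from zero show ?thesis
  proof
    assume ga: "g a = 0"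
    show ?thesis
    proof (rule wirtinger_riccati[OF ab dg cg, where H = "\<lambda>x. c * tan (c * (b - x))"])
      fix x assume x: "x \<in> {a..b}"
      have y: "cos (c * (b - x)) \<noteq> 0" using x c small[of "b - x"] by (intro cos_pos_small) auto
      have "((\<lambda>x. c * tan (c * (b - x))) has_real_derivative
          c * (inverse ((cos (c * (b - x)))\<^sup>2) * (c * (0 - 1)))) (at x within {a..b})"
        by (intro DERIV_cmult DERIV_chain2[where f = tan] DERIV_tan y DERIV_diff DERIV_const DERIV_ident)
      then show "((\<lambda>x. c * tan (c * (b - x))) has_real_derivative - c\<^sup>2 - (c * tan (c * (b - x)))\<^sup>2) (at x within {a..b})"
        by (rule DERIV_cong) (use tan_riccati[OF y, of c] in \<open>simp add: algebra_simps\<close>)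
    qed (simp_all add: ga)
  next
    assume gb: "g b = 0"
    show ?thesis
    proof (rule wirtinger_riccati[OF ab dg cg, where H = "\<lambda>x. - (c * tan (c * (x - a)))"])
      fix x assume x: "x \<in> {a..b}"
      have y: "cos (c * (x - a)) \<noteq> 0" using x c small[of "x - a"] by (intro cos_pos_small) auto
      have "((\<lambda>x. - (c * tan (c * (x - a)))) has_real_derivative
          - (c * (inverse ((cos (c * (x - a)))\<^sup>2) * (c * (1 - 0))))) (at x within {a..b})"
        by (intro DERIV_minus DERIV_cmult DERIV_chain2[where f = tan] DERIV_tan y DERIV_diff DERIV_const DERIV_ident)
      then show "((\<lambda>x. - (c * tan (c * (x - a)))) has_real_derivative - c\<^sup>2 - (- (c * tan (c * (x - a))))\<^sup>2) (at x within {a..b})"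
        by (rule DERIV_cong) (use tan_riccati[OF y, of c] in \<open>simp add: algebra_simps\<close>)
    qed (simp_all add: gb)
  qed
qed

lemma wirtinger_cell:
  fixes F F' :: "real \<Rightarrow> complex"
  assumes w: "a \<le> w" "w \<le> b" and c: "0 < c" "c * (w - a) < pi / 2" "c * (b - w) < pi / 2"
    and F: "\<And>x. (F has_vector_derivative F' x) (at x)" and F': "continuous_on UNIV F'"
  shows "c\<^sup>2 * integral {a..b} (\<lambda>x. (cmod (F x - F w))\<^sup>2) \<le> integral {a..b} (\<lambda>x. (cmod (F' x))\<^sup>2)"
proof -
  have d: "((\<lambda>x. F x - F w) has_vector_derivative F' x) (at x)" for x
    using has_vector_derivative_diff[OF F has_vector_derivative_const] by simp
  have cF: "continuous_on S F" for S
    using F by (meson continuous_at_imp_continuous_on has_vector_derivative_continuous)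
  have i: "(\<lambda>x. (cmod (F x - F w))\<^sup>2) integrable_on {a..b}" "(\<lambda>x. (cmod (F' x))\<^sup>2) integrable_on {a..b}"
    by (intro integrable_continuous_interval continuous_intros cF continuous_on_subset[OF F'] subset_UNIV)+
  have "c\<^sup>2 * integral {a..w} (\<lambda>x. (cmod (F x - F w))\<^sup>2) \<le> integral {a..w} (\<lambda>x. (cmod (F' x))\<^sup>2)"
    by (rule wirtinger_anchored[OF w(1) c(1,2) d F']) simp
  moreover have "c\<^sup>2 * integral {w..b} (\<lambda>x. (cmod (F x - F w))\<^sup>2) \<le> integral {w..b} (\<lambda>x. (cmod (F' x))\<^sup>2)"
    by (rule wirtinger_anchored[OF w(2) c(1,3) d F']) simp
  ultimately show ?thesis
    unfolding Henstock_Kurzweil_Integration.integral_combine[OF w i(1), symmetric]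
      Henstock_Kurzweil_Integration.integral_combine[OF w i(2), symmetric] distrib_left
    by linarith
qed

text \<open>Young's inequality with weights fitted to a perturbation \<open>v\<close> of relative
  size \<open>\<theta>\<close>: a squared error \<open>\<theta>^2 * X\<close> then enters as
  \<open>\<theta> * X\<close>, which leaves room below \<open>X\<close> for every
  \<open>\<theta> < 1\<close>. The difference of the two sides is a square divided by
  \<open>\<theta> * (1 - \<theta>)\<close>.\<close>

lemma norm_add_sq_le:
  fixes u v :: "'a::real_normed_vector"
  assumes "0 < \<theta>" "\<theta> < 1"
  shows "(norm (u + v))\<^sup>2 \<le> (norm u)\<^sup>2 / (1 - \<theta>) + (norm v)\<^sup>2 / \<theta>"
proof -
  let ?a = "norm u" and ?b = "norm v"
  have "(norm (u + v))\<^sup>2 \<le> (?a + ?b)\<^sup>2" by (intro power_mono norm_triangle_ineq) simp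
  also have "\<dots> \<le> ?a\<^sup>2 / (1 - \<theta>) + ?b\<^sup>2 / \<theta>"
  proof -
    have "0 \<le> (\<theta> * ?a - (1 - \<theta>) * ?b)\<^sup>2" by simp
    also have "\<dots> = \<theta> * (1 - \<theta>) * (?a\<^sup>2 / (1 - \<theta>) + ?b\<^sup>2 / \<theta> - (?a + ?b)\<^sup>2)"
      using assms by (simp add: field_simps power2_eq_square)
    finally have "\<theta> * (1 - \<theta>) * 0 \<le> \<theta> * (1 - \<theta>) * (?a\<^sup>2 / (1 - \<theta>) + ?b\<^sup>2 / \<theta> - (?a + ?b)\<^sup>2)"
      by simp
    moreover have "0 < \<theta> * (1 - \<theta>)" using assms by simp
    ultimately show ?thesis by (simp only: mult_le_cancel_left_pos diff_ge_0_iff_ge)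
  qed
  finally show ?thesis .
qed

text \<open>Wirtinger's inequality with \<open>c = pi / \<theta>\<close> on both halves of the cell
  bounds the deviation of \<open>F\<close> from its sample. The first inequality, for the lower
  constant, has to keep track of \<open>\<theta>\<close>; for the second, which serves the upper
  constant, splitting into equal parts is enough.\<close>

lemma voronoi_cell_bounds:
  fixes F F' :: "real \<Rightarrow> complex"
  assumes w: "a \<le> w" "w \<le> b" and \<theta>: "0 < \<theta>" "\<theta> < 1" "w - a < \<theta> / 2" "b - w < \<theta> / 2"
    and F: "\<And>x. (F has_vector_derivative F' x) (at x)" and F': "continuous_on UNIV F'"
  shows "integral {a..b} (\<lambda>x. (cmod (F x))\<^sup>2)
      \<le> ((b - a) * (cmod (F w))\<^sup>2) / (1 - \<theta>) + \<theta> / pi\<^sup>2 * integral {a..b} (\<lambda>x. (cmod (F' x))\<^sup>2)"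
    and "(b - a) * (cmod (F w))\<^sup>2
      \<le> 2 * integral {a..b} (\<lambda>x. (cmod (F x))\<^sup>2) + 2 / pi\<^sup>2 * integral {a..b} (\<lambda>x. (cmod (F' x))\<^sup>2)"
proof -
  let ?I = "\<lambda>f. integral {a..b} (\<lambda>x. (cmod (f x))\<^sup>2)"
  have cF: "continuous_on S F" for S
    using F by (meson continuous_at_imp_continuous_on has_vector_derivative_continuous)
  have ab: "a \<le> b" using w by simp
  have "(pi / \<theta>)\<^sup>2 * ?I (\<lambda>x. F x - F w) \<le> ?I F'"
  proof (rule wirtinger_cell[OF w _ _ _ F F'])
    show "pi / \<theta> * (w - a) < pi / 2" "pi / \<theta> * (b - w) < pi / 2"
      using mult_strict_left_mono[OF \<theta>(3), of "pi / \<theta>"] mult_strict_left_mono[OF \<theta>(4), of "pi / \<theta>"] \<theta>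
      by simp_all
  qed (use \<theta> in simp)
  then have W: "?I (\<lambda>x. F x - F w) \<le> \<theta>\<^sup>2 / pi\<^sup>2 * ?I F'"
    using \<theta> by (simp add: field_simps)
  have "?I F \<le> integral {a..b} (\<lambda>x. (cmod (F w))\<^sup>2 / (1 - \<theta>) + (cmod (F x - F w))\<^sup>2 / \<theta>)"
  proof (intro integral_le integrable_continuous_interval continuous_intros cF)
    fix x
    show "(cmod (F x))\<^sup>2 \<le> (cmod (F w))\<^sup>2 / (1 - \<theta>) + (cmod (F x - F w))\<^sup>2 / \<theta>"
      using norm_add_sq_le[OF \<theta>(1,2), of "F w" "F x - F w"] by simp
  qed (use \<theta> in simp_all)
  also have "\<dots> = ((b - a) * (cmod (F w))\<^sup>2) / (1 - \<theta>) + ?I (\<lambda>x. F x - F w) / \<theta>"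
  proof -
    have i: "(\<lambda>x::real. (cmod (F w))\<^sup>2 / (1 - \<theta>)) integrable_on {a..b}"
      "(\<lambda>x. (cmod (F x - F w))\<^sup>2 / \<theta>) integrable_on {a..b}"
      using \<theta> by (intro integrable_continuous_interval continuous_intros cF; simp)+
    show ?thesis unfolding integral_add[OF i] using ab by (simp add: integral_divide)
  qed
  also have "?I (\<lambda>x. F x - F w) / \<theta> \<le> (\<theta>\<^sup>2 / pi\<^sup>2 * ?I F') / \<theta>"
    using W \<theta> by (intro divide_right_mono) auto
  also have "\<dots> = \<theta> / pi\<^sup>2 * ?I F'" using \<theta> by (simp add: power2_eq_square)
  finally show "?I F \<le> ((b - a) * (cmod (F w))\<^sup>2) / (1 - \<theta>) + \<theta> / pi\<^sup>2 * ?I F'" by simp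
  have "(b - a) * (cmod (F w))\<^sup>2 = integral {a..b} (\<lambda>x. (cmod (F w))\<^sup>2)"
    using ab by simp
  also have "\<dots> \<le> integral {a..b} (\<lambda>x. 2 * (cmod (F x))\<^sup>2 + 2 * (cmod (F x - F w))\<^sup>2)"
  proof (intro integral_le integrable_continuous_interval continuous_intros cF)
    fix x
    show "(cmod (F w))\<^sup>2 \<le> 2 * (cmod (F x))\<^sup>2 + 2 * (cmod (F x - F w))\<^sup>2"
      using norm_add_sq_le[of "1/2" "F x" "F w - F x"] by (simp add: norm_minus_commute)
  qed
  also have "\<dots> = 2 * ?I F + 2 * ?I (\<lambda>x. F x - F w)"
  proof -
    have i: "(\<lambda>x. 2 * (cmod (F x))\<^sup>2) integrable_on {a..b}"
      "(\<lambda>x. 2 * (cmod (F x - F w))\<^sup>2) integrable_on {a..b}"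
      by (intro integrable_continuous_interval continuous_intros cF)+
    show ?thesis unfolding integral_add[OF i] by simp
  qed
  also have "?I (\<lambda>x. F x - F w) \<le> 1 / pi\<^sup>2 * ?I F'"
  proof -
    have "0 \<le> ?I F'"
      by (intro integral_nonneg integrable_continuous_interval continuous_intros continuous_on_subset[OF F']) auto
    then have "\<theta>\<^sup>2 * (?I F' / pi\<^sup>2) \<le> 1 * (?I F' / pi\<^sup>2)"
      using \<theta> by (intro mult_right_mono) (auto simp: abs_square_le_1)
    then show ?thesis using W by simp
  qed
  finally show "(b - a) * (cmod (F w))\<^sup>2 \<le> 2 * ?I F + 2 / pi\<^sup>2 * ?I F'" by simp
qed

section \<open>Comparison of samples and integrals\<close>

text \<open>Centering \<open>(0,1)\<close> at the origin does not change the modulus of the transform, but halves the bound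
  \<open>2\<pi>\<bar>f\<bar>\<close> on the function whose transform is the derivative; this is what allows every \<open>\<delta> < 1\<close>.\<close>

definition cfourier :: "(real \<Rightarrow> complex) \<Rightarrow> real \<Rightarrow> complex" where
  "cfourier f \<omega> = cis (pi * \<omega>) * fourier f \<omega>"

definition cfourier' :: "(real \<Rightarrow> complex) \<Rightarrow> real \<Rightarrow> complex" where
  "cfourier' f \<omega> = cis (pi * \<omega>) * fourier (\<lambda>x. (- 2 * pi * \<i> * (of_real x - 1 / 2)) * f x) \<omega>"

lemma norm_cfourier [simp]: "cmod (cfourier f \<omega>) = cmod (fourier f \<omega>)"
  by (simp add: cfourier_def norm_mult)

lemma cfourier_has_vector_derivative:
  assumes f: "f \<in> L2_01"
  shows "(cfourier f has_vector_derivative cfourier' f \<omega>) (at \<omega>)"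
proof -
  let ?g = "\<lambda>x. (- 2 * pi * \<i> * of_real x) * f x"
  have g: "?g \<in> L2_01"
    by (rule L2_01_bounded_mult[OF f, where B = "2 * pi"])
      (auto intro!: measurable_M01_borel simp: norm_mult)
  have c: "((\<lambda>\<omega>. cis (pi * \<omega>)) has_vector_derivative (pi * \<i> * cis (pi * \<omega>))) (at \<omega>)"
    unfolding cis_conv_exp
    by (auto intro!: derivative_eq_intros has_vector_derivative_real_field simp: field_simps)
  have "(cfourier f has_vector_derivative cis (pi * \<omega>) * fourier ?g \<omega> + pi * \<i> * cis (pi * \<omega>) * fourier f \<omega>) (at \<omega>)"
    unfolding cfourier_def
    by (rule has_vector_derivative_mult[OF c fourier_has_vector_derivative[OF f]])
  also have "cis (pi * \<omega>) * fourier ?g \<omega> + pi * \<i> * cis (pi * \<omega>) * fourier f \<omega>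
     = cis (pi * \<omega>) * (fourier ?g \<omega> + fourier (\<lambda>x. (pi * \<i>) * f x) \<omega>)"
    by (simp add: fourier_scale distrib_left)
  also have "fourier ?g \<omega> + fourier (\<lambda>x. (pi * \<i>) * f x) \<omega> = fourier (\<lambda>x. ?g x + (pi * \<i>) * f x) \<omega>"
    using fourier_add[OF g L2_01_scale[OF f]] by simp
  also have "(\<lambda>x. ?g x + (pi * \<i>) * f x) = (\<lambda>x. (- 2 * pi * \<i> * (of_real x - 1 / 2)) * f x)"
    by (simp add: fun_eq_iff algebra_simps)
  finally show ?thesis unfolding cfourier'_def .
qed

lemma l2norm_mono:
  assumes "f \<in> L2_01" "g \<in> L2_01" "\<And>x. x \<in> {0<..<1} \<Longrightarrow> cmod (f x) \<le> B * cmod (g x)"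
  shows "(l2norm f)\<^sup>2 \<le> B\<^sup>2 * (l2norm g)\<^sup>2"
proof -
  have "(l2norm f)\<^sup>2 \<le> (LINT x|M01. B\<^sup>2 * (cmod (g x))\<^sup>2)"
    unfolding l2norm_sq
  proof (intro integral_mono L2_01_square_integrable assms integrable_mult_right)
    fix x assume "x \<in> space M01"
    then have "cmod (f x) \<le> B * cmod (g x)" by (intro assms) simp
    then have "(cmod (f x))\<^sup>2 \<le> (B * cmod (g x))\<^sup>2" by (rule power_mono) simp
    then show "(cmod (f x))\<^sup>2 \<le> B\<^sup>2 * (cmod (g x))\<^sup>2" by (simp add: power_mult_distrib)
  qed
  then show ?thesis by (simp add: l2norm_sq)
qed

lemma cfourier'_bounds:
  assumes f: "f \<in> L2_01"
  shows "continuous_on UNIV (cfourier' f)"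
    and "integral {- real R..real R} (\<lambda>\<omega>. (cmod (cfourier' f \<omega>))\<^sup>2) \<le> pi\<^sup>2 * (l2norm f)\<^sup>2"
proof -
  let ?g = "\<lambda>x. (- 2 * pi * \<i> * (of_real x - 1 / 2)) * f x"
  have half: "cmod (of_real x - 1 / 2) = \<bar>x - 1 / 2\<bar>" for x :: real
  proof -
    have "complex_of_real x - 1 / 2 = of_real (x - 1 / 2)" by simp
    then show ?thesis by (simp only: norm_of_real)
  qed
  have b: "cmod (- 2 * pi * \<i> * (of_real x - 1 / 2)) \<le> pi" if "x \<in> {0<..<1}" for x :: real
  proof -
    have "\<bar>x - 1 / 2\<bar> \<le> 1 / 2" using that by (intro abs_leI) auto
    then have "2 * pi * \<bar>x - 1 / 2\<bar> \<le> 2 * pi * (1 / 2)" by (intro mult_left_mono) simp_all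
    then show ?thesis by (simp add: norm_mult half)
  qed
  have g: "?g \<in> L2_01"
    by (rule L2_01_bounded_mult[OF f _ b]) (auto intro!: measurable_M01_borel)
  show "continuous_on UNIV (cfourier' f)"
    unfolding cfourier'_def by (intro continuous_intros g)
  have "integral {- real R..real R} (\<lambda>\<omega>. (cmod (cfourier' f \<omega>))\<^sup>2) \<le> (l2norm ?g)\<^sup>2"
    using bessel_integral[OF g] by (simp add: cfourier'_def norm_mult)
  also have "\<dots> \<le> pi\<^sup>2 * (l2norm f)\<^sup>2"
  proof (rule l2norm_mono[OF g f])
    fix x :: real assume "x \<in> {0<..<1}"
    then show "cmod (?g x) \<le> pi * cmod (f x)"
      unfolding norm_mult[of _ "f x"] by (intro mult_right_mono b) simp_all
  qed
  finally show "integral {- real R..real R} (\<lambda>\<omega>. (cmod (cfourier' f \<omega>))\<^sup>2) \<le> pi\<^sup>2 * (l2norm f)\<^sup>2" .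
qed

text \<open>Consecutive values bound the Voronoi cell of a sampling point, and the length of that
  cell is exactly the weight of the point.\<close>

definition cell_end :: "(nat \<Rightarrow> nat \<Rightarrow> real) \<Rightarrow> (nat \<Rightarrow> real) \<Rightarrow> nat \<Rightarrow> nat \<Rightarrow> real" where
  "cell_end \<Omega> K N n = (extpt \<Omega> K N n + extpt \<Omega> K N (n + 1)) / 2"

lemma integral_cells:
  fixes F :: "real \<Rightarrow> real"
  assumes "\<And>n. n < N \<Longrightarrow> c n \<le> c (Suc n)" "continuous_on UNIV F"
  shows "(\<Sum>n=1..N. integral {c (n - 1)..c n} F) = integral {c 0..c N} F" "c 0 \<le> c N"
proof -
  have i: "F integrable_on {u..v}" for u v
    by (intro integrable_continuous_interval continuous_on_subset[OF assms(2)]) auto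
  have "(\<Sum>n=1..m. integral {c (n - 1)..c n} F) = integral {c 0..c m} F \<and> c 0 \<le> c m" if "m \<le> N" for m
    using that
  proof (induction m)
    case (Suc m)
    then have "c m \<le> c (Suc m)" "c 0 \<le> c m" using assms(1)[of m] by auto
    then show ?case
      using Suc Henstock_Kurzweil_Integration.integral_combine[OF \<open>c 0 \<le> c m\<close> \<open>c m \<le> c (Suc m)\<close> i]
      by simp
  qed simp
  then show "(\<Sum>n=1..N. integral {c (n - 1)..c n} F) = integral {c 0..c N} F" "c 0 \<le> c N" by auto
qed

text \<open>The outer points keep the order because all samples lie in \<open>{- K N..K N}\<close>.
  The order is only weak: the left outer point coincides with the first sample when the samples
  reach both \<open>- K N\<close> and \<open>K N\<close>.\<close>

lemma uniformly_denseD: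
  assumes "uniformly_dense \<delta> \<Omega> K" "N \<ge> 1"
  shows "0 \<le> K N" "n \<in> {1..N} \<Longrightarrow> \<bar>\<Omega> N n\<bar> \<le> K N"
    "n \<le> N \<Longrightarrow> extpt \<Omega> K N (Suc n) - extpt \<Omega> K N n \<le> \<delta>"
    "n \<le> N \<Longrightarrow> extpt \<Omega> K N n \<le> extpt \<Omega> K N (Suc n)"
proof -
  have b: "n \<in> {1..N} \<Longrightarrow> \<Omega> N n \<in> {- K N..K N}" for n
    using assms unfolding uniformly_dense_def by blast
  show "0 \<le> K N" using assms unfolding uniformly_dense_def by blast
  show "n \<in> {1..N} \<Longrightarrow> \<bar>\<Omega> N n\<bar> \<le> K N" using b[of n] by (simp add: abs_le_iff)
  show "n \<le> N \<Longrightarrow> extpt \<Omega> K N (Suc n) - extpt \<Omega> K N n \<le> \<delta>"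
    using assms unfolding uniformly_dense_def by simp
  have sm: "strict_mono_on {1..N} (\<Omega> N)" using assms unfolding uniformly_dense_def by blast
  assume n: "n \<le> N"
  consider "n = 0" | "n = N" "n \<noteq> 0" | "n \<in> {1..N}" "Suc n \<in> {1..N}" using n by force
  then show "extpt \<Omega> K N n \<le> extpt \<Omega> K N (Suc n)"
  proof cases
    case 1
    then show ?thesis using b[of 1] b[of N] assms(2) by (auto simp: extpt_def)
  next
    case 2
    then show ?thesis using b[of 1] b[of N] assms(2) by (auto simp: extpt_def)
  next
    case 3
    then have "\<Omega> N n < \<Omega> N (Suc n)" using sm by (intro strict_mono_onD[OF sm]) auto
    then show ?thesis using 3 by (simp add: extpt_def)
  qed
qed

text \<open>The sampled energy is a Riemann sum over the Voronoi cells, so the cell estimates add up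
  to integrals over the union of the cells. In the upper bound, 4 = 2 + 2: one half comes from
  Bessel's inequality for the transform, the other from the bound by \<open>pi^2\<close> for its
  derivative.\<close>

lemma sample_energy_bounds:
  assumes ud: "uniformly_dense \<delta> \<Omega> K" and \<theta>: "0 < \<theta>" "\<theta> < 1" "\<delta> < \<theta>" and N: "N \<ge> 1" and f: "f \<in> L2_01"
  shows "sample_energy \<Omega> K N f \<le> 4 * (l2norm f)\<^sup>2"
    and "real R \<le> K N - 1 \<Longrightarrow>
      (1 - \<theta>) * (integral {- real R..real R} (\<lambda>\<omega>. (cmod (fourier f \<omega>))\<^sup>2) - \<theta> * (l2norm f)\<^sup>2)
        \<le> sample_energy \<Omega> K N f"
proof -
  let ?c = "cell_end \<Omega> K N"
  let ?E = "sample_energy \<Omega> K N f"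
  let ?F = "\<lambda>\<omega>. (cmod (cfourier f \<omega>))\<^sup>2" and ?D = "\<lambda>\<omega>. (cmod (cfourier' f \<omega>))\<^sup>2"
  have cF: "continuous_on S ?F" for S
    unfolding norm_cfourier by (intro continuous_intros f)
  have cD: "continuous_on S ?D" for S
    by (intro continuous_intros continuous_on_subset[OF cfourier'_bounds(1)[OF f]] subset_UNIV)
  note gap = uniformly_denseD(3)[OF ud N] and mono = uniformly_denseD(4)[OF ud N]
  have cm: "?c n \<le> ?c (Suc n)" if "n < N" for n
    using mono[of n] mono[of "Suc n"] that by (simp add: cell_end_def)
  have cell: "?c (n - 1) \<le> \<Omega> N n" "\<Omega> N n \<le> ?c n" "\<Omega> N n - ?c (n - 1) < \<theta> / 2" "?c n - \<Omega> N n < \<theta> / 2"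
    and wt: "weight \<Omega> K N n = ?c n - ?c (n - 1)"
    if n: "n \<in> {1..N}" for n
  proof -
    obtain m where m: "n = Suc m" using n by (cases n) auto
    have "extpt \<Omega> K N n = \<Omega> N n" using n by (simp add: extpt_def)
    then show "?c (n - 1) \<le> \<Omega> N n" "\<Omega> N n \<le> ?c n" "\<Omega> N n - ?c (n - 1) < \<theta> / 2" "?c n - \<Omega> N n < \<theta> / 2"
      "weight \<Omega> K N n = ?c n - ?c (n - 1)"
      using gap[of m] gap[of n] mono[of m] mono[of n] n \<theta>(3)
      unfolding m by (auto simp: cell_end_def weight_def field_simps)
  qed
  have sumF: "(\<Sum>n=1..N. integral {?c (n - 1)..?c n} ?F) = integral {?c 0..?c N} ?F"
    and sumD: "(\<Sum>n=1..N. integral {?c (n - 1)..?c n} ?D) = integral {?c 0..?c N} ?D"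
    and c0N: "?c 0 \<le> ?c N"
    using integral_cells[where c = ?c and F = ?F, OF cm cF] integral_cells[where c = ?c and F = ?D, OF cm cD] by blast+
  have Eeq: "?E = (\<Sum>n=1..N. (?c n - ?c (n - 1)) * (cmod (cfourier f (\<Omega> N n)))\<^sup>2)"
    unfolding sample_energy_def by (intro sum.cong refl) (simp add: wt)
  obtain R0 :: nat where R0: "\<bar>?c 0\<bar> + \<bar>?c N\<bar> \<le> real R0" using real_arch_simple by blast
  have sub: "{?c 0..?c N} \<subseteq> {- real R0..real R0}" using R0 by (auto simp: abs_if split: if_splits)
  have D_le: "integral {?c 0..?c N} ?D \<le> pi\<^sup>2 * (l2norm f)\<^sup>2"
  proof -
    have "integral {?c 0..?c N} ?D \<le> integral {- real R0..real R0} ?D"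
      by (intro integral_subset_le sub integrable_continuous_interval cD) auto
    also have "\<dots> \<le> pi\<^sup>2 * (l2norm f)\<^sup>2" by (rule cfourier'_bounds(2)[OF f])
    finally show ?thesis .
  qed
  have F_le: "integral {?c 0..?c N} ?F \<le> (l2norm f)\<^sup>2"
  proof -
    have "integral {?c 0..?c N} ?F \<le> integral {- real R0..real R0} ?F"
      by (intro integral_subset_le sub integrable_continuous_interval cF) auto
    also have "\<dots> \<le> (l2norm f)\<^sup>2" using bessel_integral[OF f] by simp
    finally show ?thesis .
  qed
  note vb = voronoi_cell_bounds[OF cell(1,2) \<theta>(1,2) cell(3,4) cfourier_has_vector_derivative[OF f] cfourier'_bounds(1)[OF f]]
  have "?E \<le> (\<Sum>n=1..N. 2 * integral {?c (n - 1)..?c n} ?F + 2 / pi\<^sup>2 * integral {?c (n - 1)..?c n} ?D)"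
    unfolding Eeq by (intro sum_mono vb(2))
  also have "\<dots> = 2 * integral {?c 0..?c N} ?F + 2 / pi\<^sup>2 * integral {?c 0..?c N} ?D"
    unfolding sum.distrib sum_distrib_left[symmetric] sumF sumD ..
  also have "\<dots> \<le> 2 * (l2norm f)\<^sup>2 + 2 / pi\<^sup>2 * (pi\<^sup>2 * (l2norm f)\<^sup>2)"
    by (intro add_mono mult_left_mono F_le D_le) simp_all
  finally show "?E \<le> 4 * (l2norm f)\<^sup>2" by simp
  have "integral {?c 0..?c N} ?F \<le> (\<Sum>n=1..N. ((?c n - ?c (n - 1)) * (cmod (cfourier f (\<Omega> N n)))\<^sup>2) / (1 - \<theta>)
       + \<theta> / pi\<^sup>2 * integral {?c (n - 1)..?c n} ?D)"
    unfolding sumF[symmetric] by (intro sum_mono vb(1))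
  also have "\<dots> = ?E / (1 - \<theta>) + \<theta> / pi\<^sup>2 * integral {?c 0..?c N} ?D"
    unfolding sum.distrib sum_distrib_left[symmetric] sum_divide_distrib[symmetric] Eeq[symmetric] sumD ..
  also have "\<dots> \<le> ?E / (1 - \<theta>) + \<theta> / pi\<^sup>2 * (pi\<^sup>2 * (l2norm f)\<^sup>2)"
    using \<theta> by (intro add_left_mono mult_left_mono D_le) simp_all
  finally have "integral {?c 0..?c N} ?F \<le> ?E / (1 - \<theta>) + \<theta> * (l2norm f)\<^sup>2" by simp
  then have low: "(1 - \<theta>) * (integral {?c 0..?c N} ?F - \<theta> * (l2norm f)\<^sup>2) \<le> ?E"
    using \<theta> by (simp add: field_simps)
  assume R: "real R \<le> K N - 1"
  \<comment> \<open>The gaps at the two outer points place the first sample within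
    \<open>\<delta>\<close> of \<open>- K N\<close> and the last within \<open>\<delta>\<close> of
    \<open>K N\<close>; since \<open>\<delta> < 1\<close>, the cells cover everything up to distance
    1 from the ends of the band.\<close>
  have "\<bar>\<Omega> N 1\<bar> \<le> K N" "\<bar>\<Omega> N N\<bar> \<le> K N" using N by (auto intro!: uniformly_denseD(2)[OF ud N])
  then have "?c 0 \<le> - K N + 1" "K N - 1 \<le> ?c N"
    using gap[of 0] gap[of N] N \<theta> by (auto simp: cell_end_def extpt_def)
  then have "{- real R..real R} \<subseteq> {?c 0..?c N}" using R by auto
  then have "integral {- real R..real R} ?F \<le> integral {?c 0..?c N} ?F"
    by (intro integral_subset_le integrable_continuous_interval cF) auto
  then have "(1 - \<theta>) * (integral {- real R..real R} ?F - \<theta> * (l2norm f)\<^sup>2)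
      \<le> (1 - \<theta>) * (integral {?c 0..?c N} ?F - \<theta> * (l2norm f)\<^sup>2)"
    using \<theta> by (intro mult_left_mono) simp_all
  then show "(1 - \<theta>) * (integral {- real R..real R} (\<lambda>\<omega>. (cmod (fourier f \<omega>))\<^sup>2) - \<theta> * (l2norm f)\<^sup>2) \<le> ?E"
    using low by simp
qed

section \<open>Least squares and quasi-optimality\<close>

text \<open>Orthogonal projection for a possibly degenerate form that sees only the coordinates in
  \<open>I\<close>. In the induction, either coordinate \<open>j\<close> contributes nothing on
  \<open>V\<close>, or some \<open>a\<close> in \<open>V\<close> has \<open>a j\<close> nonzero;
  then the elements vanishing at \<open>j\<close> form a subspace \<open>U\<close> of codimension
  one, and \<open>a'\<close>, which is \<open>a\<close> minus its projection to \<open>U\<close>,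
  spans the orthogonal complement of \<open>U\<close> in \<open>V\<close>.\<close>

lemma weighted_projection_exists:
  fixes V :: "('i \<Rightarrow> real) set"
  assumes "finite I" "\<And>i. i \<in> I \<Longrightarrow> 0 \<le> w i"
    and "(\<lambda>_. 0) \<in> V" "\<And>u v a. u \<in> V \<Longrightarrow> v \<in> V \<Longrightarrow> (\<lambda>i. u i + a * v i) \<in> V"
  shows "\<exists>v\<in>V. \<forall>u\<in>V. (\<Sum>i\<in>I. w i * ((b i - v i) * u i)) = 0"
  using assms
proof (induction I arbitrary: V b rule: finite_induct)
  case empty
  then show ?case by auto
next
  case (insert j I)
  let ?B = "\<lambda>x y. \<Sum>i\<in>insert j I. w i * (x i * y i)"
  have B: "?B x y = w j * (x j * y j) + (\<Sum>i\<in>I. w i * (x i * y i))" for x y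
    using insert.hyps by simp
  have Badd: "?B (\<lambda>i. x i + a * z i) y = ?B x y + a * ?B z y" for x z y a
    by (simp only: distrib_left distrib_right sum.distrib sum_distrib_left mult_ac)
  have Bcom: "?B x y = ?B y x" for x y by (simp only: mult_ac)
  have wI: "\<And>i. i \<in> I \<Longrightarrow> 0 \<le> w i" and wj: "0 \<le> w j" using insert.prems(1) by auto
  note V0 = insert.prems(2) and Vlin = insert.prems(3)
  show ?case
  proof (cases "\<exists>a\<in>V. w j * a j \<noteq> 0")
    case False
    obtain v where v: "v \<in> V" "\<forall>u\<in>V. (\<Sum>i\<in>I. w i * ((b i - v i) * u i)) = 0"
      using insert.IH[OF wI V0 Vlin, of b] by auto
    show ?thesis
    proof (intro bexI[OF _ v(1)] ballI)
      fix u assume u: "u \<in> V"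
      have "w j * u j = 0" using False u by blast
      then have "w j * ((b j - v j) * u j) = 0" by auto
      then show "(\<Sum>i\<in>insert j I. w i * ((b i - v i) * u i)) = 0"
        unfolding B using v(2) u by simp
    qed
  next
    case True
    then obtain a where a: "a \<in> V" "w j \<noteq> 0" "a j \<noteq> 0" by auto
    define U where "U = {v \<in> V. v j = 0}"
    have U0: "(\<lambda>_. 0) \<in> U" using V0 by (simp add: U_def)
    have Ulin: "(\<lambda>i. u i + c * v i) \<in> U" if "u \<in> U" "v \<in> U" for u v c
      using Vlin[of u v c] that by (simp add: U_def)
    obtain p where p: "p \<in> U" "\<And>u. u \<in> U \<Longrightarrow> (\<Sum>i\<in>I. w i * ((a i - p i) * u i)) = 0"
      using insert.IH[OF wI U0 Ulin, of a] by auto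
    obtain q where q: "q \<in> U" "\<And>u. u \<in> U \<Longrightarrow> (\<Sum>i\<in>I. w i * ((b i - q i) * u i)) = 0"
      using insert.IH[OF wI U0 Ulin, of b] by auto
    define a' where "a' i = a i + (- 1) * p i" for i
    have a'V: "a' \<in> V" unfolding a'_def using Vlin[OF a(1), of p "- 1"] p(1) by (simp add: U_def)
    have a'j: "a' j = a j" using p(1) by (simp add: a'_def U_def)
    have orth_a: "?B a' u = 0" if "u \<in> U" for u
      unfolding B using p(2)[OF that] that by (simp add: a'_def U_def)
    have orth_q: "?B (\<lambda>i. b i - q i) u = 0" if "u \<in> U" for u
      unfolding B using q(2)[OF that] that by (simp add: U_def)
    have "0 < w j * (a j * a j)" using a wj by (auto intro!: mult_pos_pos simp: zero_less_mult_iff)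
    moreover have "0 \<le> (\<Sum>i\<in>I. w i * (a' i * a' i))" using wI by (intro sum_nonneg mult_nonneg_nonneg zero_le_square)
    ultimately have nn: "?B a' a' > 0" unfolding B a'j by linarith
    define t where "t = ?B (\<lambda>i. b i - q i) a' / ?B a' a'"
    define v where "v i = q i + t * a' i" for i
    have vV: "v \<in> V" unfolding v_def using Vlin[OF _ a'V, of q t] q(1) by (simp add: U_def)
    have bv: "?B (\<lambda>i. b i - v i) y = ?B (\<lambda>i. b i - q i) y - t * ?B a' y" for y
      using Badd[of "\<lambda>i. b i - q i" "- t" a' y] by (simp add: v_def diff_diff_eq)
    have "?B (\<lambda>i. b i - v i) u = 0" if u: "u \<in> V" for u
    proof -
      define s where "s = u j / a j"
      define u0 where "u0 i = u i + (- s) * a' i" for i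
      have u0: "u0 \<in> U" unfolding u0_def U_def using Vlin[OF u a'V, of "- s"] a by (simp add: a'j s_def)
      have "?B (\<lambda>i. b i - v i) u0 = 0" unfolding bv orth_q[OF u0] orth_a[OF u0] by simp
      moreover have "?B (\<lambda>i. b i - v i) a' = 0" unfolding bv t_def using nn by simp
      moreover have "?B u0 (\<lambda>i. b i - v i) = ?B u (\<lambda>i. b i - v i) + (- s) * ?B a' (\<lambda>i. b i - v i)"
        unfolding u0_def by (rule Badd)
      ultimately show ?thesis
        using Bcom[of u0 "\<lambda>i. b i - v i"] Bcom[of u "\<lambda>i. b i - v i"] Bcom[of a' "\<lambda>i. b i - v i"]
        by (simp only: mult_zero_right add_0_right)
    qed
    then show ?thesis using vV by blast
  qed
qed

section \<open>Null functions and the first variation\<close>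

lemma l2norm_cong_AE:
  assumes "AE x in M01. f x = g x" "f \<in> borel_measurable M01" "g \<in> borel_measurable M01"
  shows "l2norm f = l2norm g"
proof -
  have "(LINT x|M01. (cmod (f x))\<^sup>2) = (LINT x|M01. (cmod (g x))\<^sup>2)"
  proof (rule integral_cong_AE)
    show "AE x in M01. (cmod (f x))\<^sup>2 = (cmod (g x))\<^sup>2" using assms(1) by (rule AE_mp) simp
  qed (use assms in measurable)
  then show ?thesis by (simp add: l2norm_def)
qed

lemma l2norm_eq_0_iff_AE:
  assumes "u \<in> L2_01"
  shows "l2norm u = 0 \<longleftrightarrow> (AE x in M01. u x = 0)"
proof -
  have "l2norm u = 0 \<longleftrightarrow> (LINT x|M01. (cmod (u x))\<^sup>2) = 0" by (simp add: l2norm_def)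
  also have "\<dots> \<longleftrightarrow> (AE x in M01. (cmod (u x))\<^sup>2 = 0)"
    by (rule integral_nonneg_eq_0_iff_AE[OF L2_01_square_integrable[OF assms]]) simp
  finally show ?thesis by simp
qed

lemma quadratic_nonneg_linear_zero:
  fixes B e :: real
  assumes "\<And>t. 0 \<le> 2 * t * B + t\<^sup>2 * e" "0 \<le> e"
  shows "B = 0"
proof (rule ccontr)
  assume "B \<noteq> 0"
  \<comment> \<open>The minimiser of the quadratic is at \<open>- B / e\<close>; dividing by
    \<open>e + 1\<close> instead also covers \<open>e = 0\<close>.\<close>
  define r where "r = B / (e + 1)"
  have r: "B = r * (e + 1)" "r \<noteq> 0" using assms(2) \<open>B \<noteq> 0\<close> by (auto simp: r_def)
  have "0 \<le> 2 * (- r) * B + (- r)\<^sup>2 * e" by (rule assms(1))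
  also have "\<dots> = - (r\<^sup>2 * (e + 2))"
    unfolding r(1) by (simp add: algebra_simps power2_eq_square)
  also have "\<dots> < 0" using r(2) assms(2) by simp
  finally show False by simp
qed

context
  fixes \<Omega> :: "nat \<Rightarrow> nat \<Rightarrow> real" and K :: "nat \<Rightarrow> real" and N :: nat
    and T :: "(real \<Rightarrow> complex) set" and c0 C0 :: real
  assumes w: "\<And>n. n \<in> {1..N} \<Longrightarrow> 0 \<le> weight \<Omega> K N n"
    and TL: "T \<subseteq> L2_01" and T0: "(\<lambda>_. 0) \<in> T"
    and Tlin: "\<And>f g c. f \<in> T \<Longrightarrow> g \<in> T \<Longrightarrow> (\<lambda>x. f x + c * g x) \<in> T"
    and T1: "(\<lambda>_. 1) \<in> T"
    and c0: "0 < c0" "\<And>g. g \<in> T \<Longrightarrow> c0 * (l2norm g)\<^sup>2 \<le> sample_energy \<Omega> K N g"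
    and C0: "\<And>f. f \<in> L2_01 \<Longrightarrow> sample_energy \<Omega> K N f \<le> C0 * (l2norm f)\<^sup>2"
begin

private abbreviation "E \<equiv> sample_energy \<Omega> K N"
private abbreviation "C1 \<equiv> const_C1 \<Omega> K N T"
private abbreviation "C2 \<equiv> const_C2 \<Omega> K N"
private abbreviation "C \<equiv> const_C \<Omega> K N T"
private abbreviation "ls f \<equiv> is_ls_reconstruction \<Omega> K N T f"

text \<open>The real part of the sampled Hermitian form, since the inner product of the complex
  plane is the real one. Real parts suffice because minimality is tested along real lines and the
  Pythagorean identities concern squares only.\<close>

private definition "B u v = (\<Sum>n=1..N. weight \<Omega> K N n * (fourier u (\<Omega> N n) \<bullet> fourier v (\<Omega> N n)))"

private lemma E_nonneg: "0 \<le> E f"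
  unfolding sample_energy_def using w by (intro sum_nonneg mult_nonneg_nonneg) auto

private lemma E_add:
  assumes "u \<in> L2_01" "v \<in> L2_01"
  shows "E (\<lambda>x. u x + of_real t * v x) = E u + 2 * t * B u v + t\<^sup>2 * E v"
proof -
  have "(cmod (fourier (\<lambda>x. u x + of_real t * v x) \<omega>))\<^sup>2
     = (cmod (fourier u \<omega>))\<^sup>2 + 2 * t * (fourier u \<omega> \<bullet> fourier v \<omega>) + t\<^sup>2 * (cmod (fourier v \<omega>))\<^sup>2" for \<omega>
  proof -
    have "fourier (\<lambda>x. u x + of_real t * v x) \<omega> = fourier u \<omega> + t *\<^sub>R fourier v \<omega>"
      by (simp only: fourier_add[OF assms(1) L2_01_scale[OF assms(2)]] fourier_scale scaleR_conv_of_real)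
    then show ?thesis
      unfolding dot_square_norm[symmetric]
      by (simp add: inner_add_left inner_add_right power2_eq_square algebra_simps inner_commute[of "fourier v \<omega>" "fourier u \<omega>"])
  qed
  then show ?thesis
    unfolding sample_energy_def B_def sum_distrib_left sum.distrib[symmetric]
    by (intro sum.cong refl) (simp add: algebra_simps)
qed

private lemma ls_iff:
  assumes "f \<in> L2_01"
  shows "ls f h \<longleftrightarrow> h \<in> T \<and> (\<forall>g\<in>T. E (\<lambda>x. f x - h x) \<le> E (\<lambda>x. f x - g x))"
proof -
  have e: "(\<Sum>n=1..N. weight \<Omega> K N n * (cmod (fourier f (\<Omega> N n) - fourier g (\<Omega> N n)))\<^sup>2) = E (\<lambda>x. f x - g x)"
    if "g \<in> T" for g
  proof -
    have "g \<in> L2_01" using that TL by blast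
    then show ?thesis unfolding sample_energy_def by (simp only: fourier_diff[OF assms])
  qed
  show ?thesis
  proof -
    have "ls f h \<longleftrightarrow> h \<in> T \<and> (\<forall>g\<in>T.
        (\<Sum>n=1..N. weight \<Omega> K N n * (cmod (fourier f (\<Omega> N n) - fourier h (\<Omega> N n)))\<^sup>2)
        \<le> (\<Sum>n=1..N. weight \<Omega> K N n * (cmod (fourier f (\<Omega> N n) - fourier g (\<Omega> N n)))\<^sup>2))"
      unfolding is_ls_reconstruction_def is_arg_min_def not_less[symmetric] by blast
    also have "\<dots> \<longleftrightarrow> h \<in> T \<and> (\<forall>g\<in>T. E (\<lambda>x. f x - h x) \<le> E (\<lambda>x. f x - g x))"
      by (rule conj_cong[OF refl], rule ball_cong[OF refl]) (simp only: e)
    finally show ?thesis .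
  qed
qed

private lemma Tdiff: "f \<in> T \<Longrightarrow> g \<in> T \<Longrightarrow> (\<lambda>x. f x - g x) \<in> T"
  using Tlin[of f g "- 1"] by simp

private lemma Tscale: "g \<in> T \<Longrightarrow> (\<lambda>x. c * g x) \<in> T"
  using Tlin[OF T0, of g c] by simp

text \<open>The first variation at a minimiser: along the line through \<open>h\<close> in direction
  \<open>g\<close> the sampled energy of the residual is a quadratic in \<open>t\<close> that is
  least at \<open>t = 0\<close>.\<close>

private lemma ls_orthogonal:
  assumes f: "f \<in> L2_01" and h: "ls f h" and g: "g \<in> T"
  shows "B (\<lambda>x. f x - h x) g = 0"
proof (rule quadratic_nonneg_linear_zero)
  have hT: "h \<in> T" and min: "\<And>g. g \<in> T \<Longrightarrow> E (\<lambda>x. f x - h x) \<le> E (\<lambda>x. f x - g x)"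
    using h ls_iff[OF f] by auto
  have L: "(\<lambda>x. f x - h x) \<in> L2_01" "g \<in> L2_01" using f hT g TL by (auto intro: L2_01_diff)
  fix t :: real
  have "E (\<lambda>x. f x - h x) \<le> E (\<lambda>x. f x - (h x + of_real (- t) * g x))"
    by (rule min[OF Tlin[OF hT g]])
  also have "(\<lambda>x. f x - (h x + of_real (- t) * g x)) = (\<lambda>x. (f x - h x) + of_real t * g x)"
    by (simp add: fun_eq_iff)
  finally show "0 \<le> 2 * t * B (\<lambda>x. f x - h x) g + t\<^sup>2 * E g"
    unfolding E_add[OF L] by simp
qed (rule E_nonneg)

text \<open>The minimisation takes place among the samples, which form finitely many real
  coordinates: an index in \<open>I\<close> pairs a sampling point with the choice of real or
  imaginary part. A preimage in \<open>T\<close> of the projected sample vector is a minimiser, by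
  Pythagoras.\<close>

private lemma ls_exists:
  assumes f: "f \<in> L2_01"
  shows "\<exists>h. ls f h"
proof -
  define coord where "coord z s = (if s then Re z else Im z)" for z s
  define I where "I = {1..N} \<times> (UNIV :: bool set)"
  define S where "S g i = coord (fourier g (\<Omega> N (fst i))) (snd i)" for g and i :: "nat \<times> bool"
  define ww where "ww i = weight \<Omega> K N (fst i)" for i :: "nat \<times> bool"
  have "\<exists>v\<in>S ` T. \<forall>u\<in>S ` T. (\<Sum>i\<in>I. ww i * ((S f i - v i) * u i)) = 0"
  proof (rule weighted_projection_exists)
    show "finite I" by (simp add: I_def)
    show "0 \<le> ww i" if "i \<in> I" for i using that w by (auto simp: I_def ww_def)
    have "S (\<lambda>_. 0) = (\<lambda>_. 0)" by (simp add: S_def coord_def fun_eq_iff fourier_eq)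
    then show "(\<lambda>_. 0) \<in> S ` T" using T0 by (metis imageI)
    fix u v a assume "u \<in> S ` T" "v \<in> S ` T"
    then obtain g h where gh: "g \<in> T" "h \<in> T" "u = S g" "v = S h" by auto
    then have L: "g \<in> L2_01" "h \<in> L2_01" using TL by auto
    have "S (\<lambda>x. g x + of_real a * h x) = (\<lambda>i. u i + a * v i)"
      unfolding gh S_def fourier_add[OF L(1) L2_01_scale[OF L(2)]] fourier_scale
      by (simp add: coord_def fun_eq_iff)
    then show "(\<lambda>i. u i + a * v i) \<in> S ` T" using Tlin[OF gh(1,2), of "of_real a"] by (metis imageI)
  qed
  then obtain h where h: "h \<in> T" and orth: "\<And>g. g \<in> T \<Longrightarrow> (\<Sum>i\<in>I. ww i * ((S f i - S h i) * S g i)) = 0"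
    by blast
  have hL: "h \<in> L2_01" using h TL by auto
  have BI: "B (\<lambda>x. f x - h x) g = 0" if "g \<in> T" for g
  proof -
    have "(\<Sum>i\<in>I. ww i * ((S f i - S h i) * S g i)) = B (\<lambda>x. f x - h x) g"
      unfolding I_def B_def sum.cartesian_product'
        fourier_diff[OF f hL] UNIV_bool
      by (intro sum.cong refl) (simp add: ww_def S_def coord_def inner_complex_def distrib_left)
    then show ?thesis using orth[OF that] by simp
  qed
  have "E (\<lambda>x. f x - h x) \<le> E (\<lambda>x. f x - g x)" if g: "g \<in> T" for g
  proof -
    have hg: "(\<lambda>x. h x - g x) \<in> T" using h g by (rule Tdiff)
    then have L: "(\<lambda>x. f x - h x) \<in> L2_01" "(\<lambda>x. h x - g x) \<in> L2_01" using f hL TL by (auto intro: L2_01_diff)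
    have "E (\<lambda>x. (f x - h x) + of_real 1 * (h x - g x)) = E (\<lambda>x. f x - h x) + E (\<lambda>x. h x - g x)"
      unfolding E_add[OF L] BI[OF hg] by simp
    then show ?thesis using E_nonneg[of "\<lambda>x. h x - g x"] by simp
  qed
  then show ?thesis using h ls_iff[OF f] by blast
qed

section \<open>The optimal constants\<close>

private lemma one: "l2norm (\<lambda>_. 1) = 1"
  unfolding l2norm_def using measure_M01 finite_measure.finite_emeasure_space[OF finite_measure_M01] by simp

private lemma C1_props: "c0 \<le> C1" "g \<in> T \<Longrightarrow> C1 * (l2norm g)\<^sup>2 \<le> E g"
proof -
  let ?S = "{c. \<forall>f\<in>T. E f \<ge> c * (l2norm f)\<^sup>2}"
  have mem: "c0 \<in> ?S" using c0 by auto
  have "c \<le> E (\<lambda>_. 1)" if "c \<in> ?S" for c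
  proof -
    have "c * (l2norm (\<lambda>_. 1))\<^sup>2 \<le> E (\<lambda>_. 1)" using that T1 by blast
    then show ?thesis using one by simp
  qed
  then have bdd: "bdd_above ?S" by (rule bdd_aboveI)
  show "c0 \<le> C1" unfolding const_C1_def using mem bdd by (rule cSup_upper)
  assume g: "g \<in> T"
  show "C1 * (l2norm g)\<^sup>2 \<le> E g"
  proof (cases "l2norm g = 0")
    case True
    then show ?thesis using E_nonneg by simp
  next
    case False
    then have p: "0 < (l2norm g)\<^sup>2" by simp
    have "C1 \<le> E g / (l2norm g)\<^sup>2" unfolding const_C1_def
    proof (rule cSup_least)
      show "?S \<noteq> {}" using mem by blast
      fix c assume "c \<in> ?S"
      then show "c \<le> E g / (l2norm g)\<^sup>2" using g p by (simp add: pos_le_divide_eq)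
    qed
    then show ?thesis using p by (simp add: pos_le_divide_eq)
  qed
qed

private lemma C2_props: "C2 \<le> C0" "f \<in> L2_01 \<Longrightarrow> E f \<le> C2 * (l2norm f)\<^sup>2"
proof -
  let ?S = "{c. \<forall>f\<in>L2_01. E f \<le> c * (l2norm f)\<^sup>2}"
  have mem: "C0 \<in> ?S" using C0 by auto
  have "0 \<le> c" if "c \<in> ?S" for c
  proof -
    have "E (\<lambda>_. 1) \<le> c * (l2norm (\<lambda>_. 1))\<^sup>2" using that L2_01_const[of 1] by blast
    then show ?thesis using one E_nonneg[of "\<lambda>_. 1"] by simp
  qed
  then have bdd: "bdd_below ?S" by (rule bdd_belowI)
  show "C2 \<le> C0" unfolding const_C2_def using mem bdd by (rule cInf_lower)
  assume f: "f \<in> L2_01"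
  show "E f \<le> C2 * (l2norm f)\<^sup>2"
  proof (cases "l2norm f = 0")
    case True
    then show ?thesis using C0[OF f] by simp
  next
    case False
    then have p: "0 < (l2norm f)\<^sup>2" by simp
    have "E f / (l2norm f)\<^sup>2 \<le> C2" unfolding const_C2_def
    proof (rule cInf_greatest)
      show "?S \<noteq> {}" using mem by blast
      fix c assume "c \<in> ?S"
      then show "E f / (l2norm f)\<^sup>2 \<le> c" using f p by (simp add: pos_divide_le_eq)
    qed
    then show ?thesis using p by (simp add: pos_divide_le_eq)
  qed
qed

private lemma C_props: "0 < C1" "C1 \<le> C2" "0 < C" "C\<^sup>2 = C2 / C1" "C \<le> sqrt (C0 / c0)"
proof -
  show p: "0 < C1" using C1_props(1) c0(1) by linarith
  \<comment> \<open>The constant function 1 is an admissible test for both constants and has norm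
    1.\<close>
  show le: "C1 \<le> C2"
    using C1_props(2)[OF T1] C2_props(2)[OF L2_01_const[of 1]] one by simp
  then have C2: "0 < C2" using p by linarith
  show "0 < C" "C\<^sup>2 = C2 / C1" using p C2 by (auto simp: const_C_def)
  have "C2 / C1 \<le> C0 / c0"
    using C1_props(1) C2_props(1) C2 c0(1) by (intro frac_le) auto
  then show "C \<le> sqrt (C0 / c0)" by (simp add: const_C_def)
qed

private lemma le_C: "C1 * a\<^sup>2 \<le> C2 * b\<^sup>2 \<Longrightarrow> 0 \<le> b \<Longrightarrow> a \<le> C * b"
proof -
  assume le: "C1 * a\<^sup>2 \<le> C2 * b\<^sup>2" and "0 \<le> b"
  have "a\<^sup>2 \<le> C2 * b\<^sup>2 / C1"
    unfolding pos_le_divide_eq[OF C_props(1)] mult.commute[of _ C1] by (rule le)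
  also have "\<dots> = (C * b)\<^sup>2" unfolding power_mult_distrib C_props(4) by simp
  finally show "a \<le> C * b"
    by (rule power2_le_imp_le) (rule mult_nonneg_nonneg[OF less_imp_le[OF C_props(3)] \<open>0 \<le> b\<close>])
qed

text \<open>The oblique projection \<open>P\<close> onto \<open>T\<close> along its orthogonal complement for the sampled form
  satisfies \<open>\<parallel>I - P\<parallel> = \<parallel>P\<parallel>\<close>: \<open>s = \<parallel>v\<parallel> / \<parallel>u\<parallel>\<close> makes \<open>\<parallel>s u + v / s\<parallel> = \<parallel>u + v\<parallel>\<close>
  while the component of \<open>s u + v / s\<close> in \<open>T\<close> has norm \<open>\<parallel>v\<parallel>\<close>.\<close>

private lemma residual_bound:
  assumes v: "v \<in> L2_01" and orth: "\<And>g. g \<in> T \<Longrightarrow> B v g = 0" and u: "u \<in> T"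
  shows "C1 * (l2norm v)\<^sup>2 \<le> C2 * (l2norm (\<lambda>x. v x + u x))\<^sup>2"
proof -
  have uL: "u \<in> L2_01" using u TL by auto
  note L = L2_01_measurable[OF v] L2_01_measurable[OF uL] L2_01_measurable[OF L2_01_add[OF v uL]]
  \<comment> \<open>The first two cases are those in which the scaling by \<open>s\<close> and
    \<open>1 / s\<close> breaks down.\<close>
  consider "l2norm u = 0" | "l2norm v = 0" | "0 < l2norm u" "0 < l2norm v"
    using l2norm_nonneg[of u] l2norm_nonneg[of v] by linarith
  then show ?thesis
  proof cases
    case 1
    then have "AE x in M01. u x = 0" using l2norm_eq_0_iff_AE[OF uL] by simp
    then have "AE x in M01. v x + u x = v x" by (rule AE_mp) simp
    then have "l2norm (\<lambda>x. v x + u x) = l2norm v" using L by (intro l2norm_cong_AE)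
    then show ?thesis using C_props(2) by (simp add: mult_right_mono)
  next
    case 2
    then show ?thesis using C_props(1,2) by simp
  next
    case 3
    define s where "s = l2norm v / l2norm u"
    have s: "s > 0" using 3 by (simp add: s_def)
    define u' where "u' = (\<lambda>x. of_real s * u x)"
    define v' where "v' = (\<lambda>x. of_real (1 / s) * v x)"
    have u'T: "u' \<in> T" unfolding u'_def by (rule Tscale[OF u])
    have L': "u' \<in> L2_01" "v' \<in> L2_01" unfolding u'_def v'_def by (intro L2_01_scale uL v)+
    have nu: "l2norm u' = l2norm v"
      unfolding u'_def l2norm_scale norm_of_real using 3 by (simp add: s_def)
    have nv: "l2norm v' = l2norm u"
      unfolding v'_def l2norm_scale norm_of_real using 3 by (simp add: s_def)
    have ipe: "ip01 v' u' = ip01 v u"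
    proof -
      have "ip01 v' u' = of_real (1 / s) * cnj (of_real s * ip01 u v)"
        unfolding u'_def v'_def ip01_scale_left by (subst ip01_cnj) (simp only: ip01_scale_left)
      also have "\<dots> = cnj (ip01 u v)" using s by simp
      also have "\<dots> = ip01 v u" by (rule ip01_cnj[symmetric])
      finally show ?thesis .
    qed
    have n: "(l2norm (\<lambda>x. v' x + u' x))\<^sup>2 = (l2norm (\<lambda>x. v x + u x))\<^sup>2"
      unfolding l2norm_add_sq[OF L'(2,1)] l2norm_add_sq[OF v uL] nu nv ipe by simp
    have "B v' u' = (1 / s) * B v u'"
    proof -
      have "fourier v' \<omega> = (1 / s) *\<^sub>R fourier v \<omega>" for \<omega>
        unfolding v'_def fourier_scale scaleR_conv_of_real ..
      then show ?thesis
        unfolding B_def sum_distrib_left by (intro sum.cong refl) simp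
    qed
    then have "B v' u' = 0" using orth[OF u'T] by simp
    then have "E (\<lambda>x. v' x + of_real 1 * u' x) = E v' + E u'"
      unfolding E_add[OF L'(2,1)] by simp
    then have "E u' \<le> E (\<lambda>x. v' x + u' x)" using E_nonneg[of v'] by simp
    then have "C1 * (l2norm u')\<^sup>2 \<le> C2 * (l2norm (\<lambda>x. v' x + u' x))\<^sup>2"
      using C1_props(2)[OF u'T] C2_props(2)[OF L2_01_add[OF L'(2,1)]] by linarith
    then show ?thesis unfolding nu n .
  qed
qed

text \<open>For every competitor \<open>g\<close> the error \<open>f - g\<close> is the same
  residual \<open>f - h\<close> plus the element \<open>h - g\<close> of \<open>T\<close>, so a
  single estimate for the residual compares \<open>h\<close> with all competitors and gives the
  constant \<open>C\<close> itself. For the stability bound, orthogonality yields that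
  \<open>h\<close> has at most the sampled energy of \<open>f\<close>.\<close>

lemma quasi_optimality:
  shows "0 < C1" "C \<le> sqrt (C0 / c0)"
    and "f \<in> L2_01 \<Longrightarrow> \<exists>h. ls f h"
    and "f \<in> L2_01 \<Longrightarrow> ls f h \<Longrightarrow> l2norm (\<lambda>x. f x - h x) \<le> C * (INF g\<in>T. l2norm (\<lambda>x. f x - g x))"
    and "f \<in> L2_01 \<Longrightarrow> ls f h \<Longrightarrow> l2norm h \<le> C * l2norm f"
proof -
  show "0 < C1" "C \<le> sqrt (C0 / c0)" by (rule C_props)+
  assume f: "f \<in> L2_01"
  show "\<exists>h. ls f h" by (rule ls_exists[OF f])
  assume h: "ls f h"
  have hT: "h \<in> T" using h ls_iff[OF f] by blast
  then have hL: "h \<in> L2_01" using TL by auto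
  let ?v = "\<lambda>x. f x - h x"
  have v: "?v \<in> L2_01" by (rule L2_01_diff[OF f hL])
  have orth: "B ?v g = 0" if "g \<in> T" for g by (rule ls_orthogonal[OF f h that])
  have each: "l2norm ?v \<le> C * l2norm (\<lambda>x. f x - g x)" if g: "g \<in> T" for g
  proof -
    have "C1 * (l2norm ?v)\<^sup>2 \<le> C2 * (l2norm (\<lambda>x. ?v x + (h x - g x)))\<^sup>2"
      by (rule residual_bound[OF v orth Tdiff[OF hT g]])
    moreover have "(\<lambda>x. ?v x + (h x - g x)) = (\<lambda>x. f x - g x)" by (simp add: fun_eq_iff)
    ultimately show ?thesis by (intro le_C l2norm_nonneg) (simp only:)
  qed
  have "l2norm ?v / C \<le> (INF g\<in>T. l2norm (\<lambda>x. f x - g x))"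
  proof (rule cINF_greatest)
    show "T \<noteq> {}" using T0 by blast
    show "l2norm ?v / C \<le> l2norm (\<lambda>x. f x - g x)" if "g \<in> T" for g
      unfolding pos_divide_le_eq[OF C_props(3)] mult.commute[of _ C] by (rule each[OF that])
  qed
  then show "l2norm ?v \<le> C * (INF g\<in>T. l2norm (\<lambda>x. f x - g x))"
    unfolding pos_divide_le_eq[OF C_props(3)] mult.commute[of _ C] .
  have "f = (\<lambda>x. ?v x + of_real 1 * h x)" by (simp add: fun_eq_iff)
  then have "E f = E (\<lambda>x. ?v x + of_real 1 * h x)" by (rule arg_cong)
  also have "\<dots> = E ?v + E h" unfolding E_add[OF v hL] orth[OF hT] by simp
  finally have "E h \<le> E f" using E_nonneg[of ?v] by simp
  then have "C1 * (l2norm h)\<^sup>2 \<le> C2 * (l2norm f)\<^sup>2"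
    using C1_props(2)[OF hT] C2_props(2)[OF f] by linarith
  then show "l2norm h \<le> C * l2norm f" by (rule le_C[OF _ l2norm_nonneg])
qed

end

section \<open>Piecewise functions\<close>

lemma expo_continuous [continuous_intros]: "continuous_on S (expo \<omega>)"
  unfolding expo_def by (intro continuous_intros)

lemma poly_of_real_continuous [continuous_intros]:
  fixes p :: "complex poly"
  shows "continuous_on S (\<lambda>x. poly p (of_real x))"
  by (intro continuous_intros)

lemma integral_pderiv_expo:
  fixes P :: "complex poly"
  assumes "a \<le> b" "poly P (of_real a) = 0" "poly P (of_real b) = 0"
  shows "integral {a..b} (\<lambda>x. poly (pderiv P) (of_real x) * cnj (expo \<omega> x))
    = 2 * pi * \<i> * \<omega> * integral {a..b} (\<lambda>x. poly P (of_real x) * cnj (expo \<omega> x))"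
proof -
  have p: "((\<lambda>x. poly P (of_real x)) has_vector_derivative poly (pderiv P) (of_real x)) (at x within {a..b})" for x
    by (rule has_vector_derivative_real_field[OF poly_DERIV])
  have "((\<lambda>x. cnj (expo \<omega> x)) has_vector_derivative - (2 * pi * \<i> * \<omega>) * cnj (expo \<omega> x)) (at x within {a..b})" for x
  proof -
    let ?c = "- (2 * pi * \<i> * \<omega>)"
    have e: "cnj (expo \<omega> x) = exp (?c * of_real x)" for x
      unfolding expo_def cis_conv_exp by (simp add: exp_cnj mult_ac)
    have "((\<lambda>z. exp (?c * z)) has_field_derivative exp (?c * z) * (?c * 1)) (at z)" for z
      by (rule DERIV_fun_exp[OF DERIV_cmult[OF DERIV_ident]])
    from has_vector_derivative_real_field[OF this] show ?thesis
      unfolding e by (simp add: mult.commute)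
  qed
  note d = has_vector_derivative_mult[OF p this]
  have "((\<lambda>x. poly P (of_real x) * (- (2 * pi * \<i> * \<omega>) * cnj (expo \<omega> x)) + poly (pderiv P) (of_real x) * cnj (expo \<omega> x))
     has_integral (poly P (of_real b) * cnj (expo \<omega> b) - poly P (of_real a) * cnj (expo \<omega> a))) {a..b}"
    by (rule fundamental_theorem_of_calculus[OF assms(1) d])
  then have "0 = integral {a..b} (\<lambda>x. - (2 * pi * \<i> * \<omega>) * (poly P (of_real x) * cnj (expo \<omega> x)) + poly (pderiv P) (of_real x) * cnj (expo \<omega> x))"
    using assms(2,3) by (simp add: integral_unique mult.left_commute)
  also have "\<dots> = - (2 * pi * \<i> * \<omega>) * integral {a..b} (\<lambda>x. poly P (of_real x) * cnj (expo \<omega> x))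
     + integral {a..b} (\<lambda>x. poly (pderiv P) (of_real x) * cnj (expo \<omega> x))"
  proof -
    have i: "(\<lambda>x. - (2 * pi * \<i> * \<omega>) * (poly P (of_real x) * cnj (expo \<omega> x))) integrable_on {a..b}"
      "(\<lambda>x. poly (pderiv P) (of_real x) * cnj (expo \<omega> x)) integrable_on {a..b}"
      by (intro integrable_continuous_interval continuous_intros)+
    show ?thesis unfolding integral_add[OF i] by (simp only: integral_mult_right)
  qed
  finally show ?thesis by (simp add: algebra_simps)
qed

text \<open>Clamping the argument continues the polynomial by its endpoint values, hence by zero if
  it vanishes at the ends. A sum of such pieces is Lipschitz on the whole interval without any
  gluing at the nodes.\<close>

lemma lipschitz_poly_clamp:
  fixes P :: "complex poly"
  assumes "a \<le> b"
  shows "\<exists>L. L-lipschitz_on S (\<lambda>x. poly P (of_real (max a (min b x))))"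
proof -
  have "compact ((\<lambda>x. poly (pderiv P) (complex_of_real x)) ` {a..b})"
    by (intro compact_continuous_image continuous_intros) simp
  then obtain L where L: "\<And>x. x \<in> {a..b} \<Longrightarrow> cmod (poly (pderiv P) (of_real x)) \<le> L"
    using compact_imp_bounded bounded_iff by (metis imageI)
  have lip: "L-lipschitz_on {a..b} (\<lambda>x. poly P (of_real x))"
  proof (rule bounded_derivative_imp_lipschitz)
    fix x assume x: "x \<in> {a..b}"
    show "((\<lambda>x. poly P (of_real x)) has_derivative (\<lambda>h. h *\<^sub>R poly (pderiv P) (of_real x))) (at x within {a..b})"
      using has_vector_derivative_real_field[OF poly_DERIV[of P "of_real x"]]
      by (simp add: has_vector_derivative_def)
    show "onorm (\<lambda>h. h *\<^sub>R poly (pderiv P) (complex_of_real x)) \<le> L"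
      by (intro onorm_le) (use mult_right_mono[OF L[OF x] abs_ge_zero] in \<open>simp add: mult.commute\<close>)
  next
    show "0 \<le> L" using order_trans[OF norm_ge_zero L[of a]] assms by simp
  qed simp
  have l: "cmod (poly P (of_real u) - poly P (of_real v)) \<le> L * \<bar>u - v\<bar>" if "u \<in> {a..b}" "v \<in> {a..b}" for u v
    using lipschitz_onD[OF lip that] by (simp add: dist_norm)
  have L0: "0 \<le> L" using order_trans[OF norm_ge_zero L[of a]] assms by simp
  show ?thesis
  proof (intro exI[of _ L] lipschitz_onI L0)
    fix x y :: real
    have "cmod (poly P (of_real (max a (min b x))) - poly P (of_real (max a (min b y))))
       \<le> L * \<bar>max a (min b x) - max a (min b y)\<bar>"
      using assms by (intro l) auto
    also have "\<dots> \<le> L * \<bar>x - y\<bar>" by (intro mult_left_mono L0) (auto simp: max_def min_def)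
    finally show "dist (poly P (of_real (max a (min b x)))) (poly P (of_real (max a (min b y)))) \<le> L * dist x y"
      by (simp add: dist_norm dist_real_def)
  qed
qed

lemma lipschitz_sum:
  fixes f :: "'i \<Rightarrow> real \<Rightarrow> complex"
  assumes "finite I" "\<And>i. i \<in> I \<Longrightarrow> \<exists>L. L-lipschitz_on S (f i)"
  shows "\<exists>L. L-lipschitz_on S (\<lambda>x. \<Sum>i\<in>I. f i x)"
  using assms
proof (induction I)
  case empty
  show ?case by (intro exI[of _ 0] lipschitz_onI) simp_all
next
  case (insert i I)
  then obtain L L' where "L-lipschitz_on S (f i)" "L'-lipschitz_on S (\<lambda>x. \<Sum>i\<in>I. f i x)" by blast
  then have "(L + L')-lipschitz_on S (\<lambda>x. f i x + (\<Sum>i\<in>I. f i x))" by (rule lipschitz_on_add)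
  then show ?case using insert.hyps by auto
qed

text \<open>With half-open pieces exactly one term is active at each point of [0,1) when
  \<open>w\<close> is a sequence of nodes; the value at 1 is 0.\<close>

definition piecewise :: "nat \<Rightarrow> (nat \<Rightarrow> real) \<Rightarrow> (nat \<Rightarrow> real \<Rightarrow> 'a::real_vector) \<Rightarrow> real \<Rightarrow> 'a" where
  "piecewise k w \<phi> x = (\<Sum>j\<le>k. indicator {w j..<w (Suc j)} x *\<^sub>R \<phi> j x)"

context
  fixes k :: nat and w :: "nat \<Rightarrow> real"
  assumes nodes: "is_nodes k w"
begin

lemma nodes_less: "j \<le> k \<Longrightarrow> w j < w (Suc j)"
  using nodes by (simp add: is_nodes_def)

lemma nodes_ends: "w 0 = 0" "w (Suc k) = 1"
  using nodes by (simp_all add: is_nodes_def)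

lemma nodes_mono: "i \<le> j \<Longrightarrow> j \<le> Suc k \<Longrightarrow> w i \<le> w j"
proof (induction j)
  case (Suc j)
  show ?case
  proof (cases "i = Suc j")
    case False
    then have "w i \<le> w j" using Suc by simp
    also have "w j < w (Suc j)" using Suc by (intro nodes_less) simp
    finally show ?thesis by simp
  qed simp
qed simp

lemma nodes_range: "j \<le> Suc k \<Longrightarrow> 0 \<le> w j \<and> w j \<le> 1"
  using nodes_mono[of 0 j] nodes_mono[of j "Suc k"] nodes_ends by simp

lemma nodes_cover:
  assumes "0 \<le> x" "x < 1"
  obtains j where "j \<le> k" "x \<in> {w j..<w (Suc j)}"
proof -
  have "\<exists>j\<le>m. x \<in> {w j..<w (Suc j)}" if "x < w (Suc m)" for m
    using that
  proof (induction m)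
    case 0
    then show ?case using assms nodes_ends by auto
  next
    case (Suc m)
    show ?case
    proof (cases "x < w (Suc m)")
      case True
      then show ?thesis using Suc.IH by (meson le_SucI)
    next
      case False
      then show ?thesis using Suc.prems by (intro exI[of _ "Suc m"]) simp
    qed
  qed
  from this[of k] show ?thesis using that assms nodes_ends by auto
qed

lemma piecewise_eq:
  assumes j: "j \<le> k" "x \<in> {w j..<w (Suc j)}"
  shows "piecewise k w \<phi> x = \<phi> j x"
proof -
  have "indicator {w i..<w (Suc i)} x = (if i = j then 1 else (0::real))" if "i \<le> k" for i
  proof -
    have "x \<notin> {w i..<w (Suc i)}" if "i < j"
      using nodes_mono[of "Suc i" j] that j by auto
    moreover have "x \<notin> {w i..<w (Suc i)}" if "j < i"
      using nodes_mono[of "Suc j" i] that j \<open>i \<le> k\<close> by auto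
    ultimately show ?thesis using j by (cases i j rule: linorder_cases) auto
  qed
  then have "piecewise k w \<phi> x = (\<Sum>i\<le>k. (if i = j then \<phi> i x else 0))"
    unfolding piecewise_def by (intro sum.cong refl) simp
  then show ?thesis using j by simp
qed

text \<open>Since one piece is active at each point of (0,1), squared moduli and multiplication by
  exponentials may be moved inside the pieces.\<close>

lemma piecewise_compose:
  assumes "x \<in> {0<..<1}"
  shows "h x (piecewise k w \<phi> x) = piecewise k w (\<lambda>j x. h x (\<phi> j x)) x"
proof -
  obtain j where "j \<le> k" "x \<in> {w j..<w (Suc j)}"
    using nodes_cover[of x] assms by auto
  then show ?thesis by (simp only: piecewise_eq)
qed

lemma piecewise_integral:
  fixes \<phi> :: "nat \<Rightarrow> real \<Rightarrow> 'a::euclidean_space"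
  assumes c: "\<And>j. continuous_on UNIV (\<phi> j)"
  shows "integrable M01 (piecewise k w \<phi>)"
    "integral\<^sup>L M01 (piecewise k w \<phi>) = (\<Sum>j\<le>k. integral {w j..w (Suc j)} (\<phi> j))"
proof -
  let ?t = "\<lambda>j x. indicator {w j..<w (Suc j)} x *\<^sub>R \<phi> j x"
  have i: "integrable M01 (?t j)" for j
  proof (rule Bochner_Integration.integrable_bound)
    show "integrable M01 (\<phi> j)"
      by (rule integral_M01_continuous(1)[OF continuous_on_subset[OF c subset_UNIV]])
    then have "\<phi> j \<in> borel_measurable M01" by (rule borel_measurable_integrable)
    moreover have "(\<lambda>x. indicator {w j..<w (Suc j)} x :: real) \<in> borel_measurable M01"
      by (rule measurable_M01_borel) measurable
    ultimately show "?t j \<in> borel_measurable M01" by (intro borel_measurable_scaleR)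
    show "AE x in M01. norm (?t j x) \<le> norm (\<phi> j x)"
      by (intro AE_I2) (simp add: indicator_def)
  qed
  have e: "integral\<^sup>L M01 (?t j) = integral {w j..w (Suc j)} (\<phi> j)" if j: "j \<le> k" for j
  proof -
    have t: "?t j = (\<lambda>x. if x \<in> {w j..<w (Suc j)} then \<phi> j x else 0)"
      by (simp add: fun_eq_iff indicator_def)
    have "integral\<^sup>L M01 (?t j) = integral {0<..<1} (?t j)"
      by (rule lebesgue_integral_eq_integral[OF i]) simp
    also have "integral {0<..<1} (?t j) = integral ({w j..<w (Suc j)} \<inter> {0<..<1}) (\<phi> j)"
      unfolding t by (rule Henstock_Kurzweil_Integration.integral_restrict_Int)
    \<comment> \<open>The two domains differ at most in the points 0 and
      \<open>w (Suc j)\<close>.\<close>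
    also have "\<dots> = integral {w j..w (Suc j)} (\<phi> j)"
    proof (rule integral_spike_set)
      have r: "0 \<le> w j" "w (Suc j) \<le> 1" using nodes_range[of j] nodes_range[of "Suc j"] j by auto
      have "{x \<in> {w j..<w (Suc j)} \<inter> {0<..<1} - {w j..w (Suc j)}. \<phi> j x \<noteq> 0} \<subseteq> {}" by auto
      then show "negligible {x \<in> {w j..<w (Suc j)} \<inter> {0<..<1} - {w j..w (Suc j)}. \<phi> j x \<noteq> 0}"
        by (rule negligible_subset[rotated]) simp
      have "{x \<in> {w j..w (Suc j)} - {w j..<w (Suc j)} \<inter> {0<..<1}. \<phi> j x \<noteq> 0} \<subseteq> {0, w (Suc j)}"
        using r by auto
      then show "negligible {x \<in> {w j..w (Suc j)} - {w j..<w (Suc j)} \<inter> {0<..<1}. \<phi> j x \<noteq> 0}"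
        by (rule negligible_subset[rotated]) simp
    qed
    finally show ?thesis .
  qed
  have p: "piecewise k w \<phi> = (\<lambda>x. \<Sum>j\<le>k. ?t j x)" by (simp add: piecewise_def fun_eq_iff)
  show "integrable M01 (piecewise k w \<phi>)" unfolding p by (intro Bochner_Integration.integrable_sum i)
  show "integral\<^sup>L M01 (piecewise k w \<phi>) = (\<Sum>j\<le>k. integral {w j..w (Suc j)} (\<phi> j))"
    unfolding p by (subst Bochner_Integration.integral_sum[OF i]) (intro sum.cong refl e, simp)
qed

lemma l2norm_piecewise:
  assumes c: "\<And>j. continuous_on UNIV (\<phi> j)"
  shows "(l2norm (piecewise k w \<phi>))\<^sup>2 = (\<Sum>j\<le>k. integral {w j..w (Suc j)} (\<lambda>x. (cmod (\<phi> j x))\<^sup>2))"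
proof -
  have "(l2norm (piecewise k w \<phi>))\<^sup>2 = integral\<^sup>L M01 (piecewise k w (\<lambda>j x. (cmod (\<phi> j x))\<^sup>2))"
    unfolding l2norm_sq
    by (intro Bochner_Integration.integral_cong refl piecewise_compose[where h = "\<lambda>_ z. (cmod z)\<^sup>2"]) simp
  also have "\<dots> = (\<Sum>j\<le>k. integral {w j..w (Suc j)} (\<lambda>x. (cmod (\<phi> j x))\<^sup>2))"
    by (intro piecewise_integral(2) continuous_intros c)
  finally show ?thesis .
qed

lemma fourier_piecewise:
  assumes c: "\<And>j. continuous_on UNIV (\<phi> j)"
  shows "fourier (piecewise k w \<phi>) \<omega> = (\<Sum>j\<le>k. integral {w j..w (Suc j)} (\<lambda>x. \<phi> j x * cnj (expo \<omega> x)))"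
proof -
  have "fourier (piecewise k w \<phi>) \<omega> = integral\<^sup>L M01 (piecewise k w (\<lambda>j x. \<phi> j x * cnj (expo \<omega> x)))"
    unfolding fourier_eq
    by (intro Bochner_Integration.integral_cong refl piecewise_compose[where h = "\<lambda>x z. z * cnj (expo \<omega> x)"]) simp
  also have "\<dots> = (\<Sum>j\<le>k. integral {w j..w (Suc j)} (\<lambda>x. \<phi> j x * cnj (expo \<omega> x)))"
    by (intro piecewise_integral(2) continuous_intros c)
  finally show ?thesis .
qed

lemma L2_01_piecewise:
  assumes c: "\<And>j. continuous_on UNIV (\<phi> j)"
  shows "piecewise k w \<phi> \<in> L2_01"
proof -
  have "piecewise k w \<phi> \<in> borel_measurable M01"
    by (rule borel_measurable_integrable[OF piecewise_integral(1)[OF c]])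
  moreover have "integrable M01 (\<lambda>x. (cmod (piecewise k w \<phi> x))\<^sup>2)"
  proof -
    have "integrable M01 (piecewise k w (\<lambda>j x. (cmod (\<phi> j x))\<^sup>2))"
      by (intro piecewise_integral(1) continuous_intros c)
    moreover have "integrable M01 (\<lambda>x. (cmod (piecewise k w \<phi> x))\<^sup>2)
        \<longleftrightarrow> integrable M01 (piecewise k w (\<lambda>j x. (cmod (\<phi> j x))\<^sup>2))"
      by (intro Bochner_Integration.integrable_cong refl piecewise_compose[where h = "\<lambda>_ z. (cmod z)\<^sup>2"]) simp
    ultimately show ?thesis by simp
  qed
  ultimately show ?thesis by (simp add: L2_01_def)
qed

text \<open>The pieces carry different restricted measures, so their finitely many exceptional sets
  are united as null sets of the whole line and then restricted to (0,1).\<close>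

lemma piecewise_poly_eq_AE:
  assumes f: "f \<in> piecewise_poly k w M"
  shows "\<exists>p. (\<forall>j\<le>k. degree (p j) \<le> M j)
    \<and> (AE x in M01. f x = piecewise k w (\<lambda>j x. poly (p j) (of_real x)) x)"
proof -
  have "\<exists>p :: complex poly. degree p \<le> M j \<and> (AE x in lebesgue_on {w j..<w (Suc j)}. f x = poly p (of_real x))"
    if "j \<le> k" for j
    using f that unfolding piecewise_poly_def Suc_eq_plus1 by blast
  then obtain p :: "nat \<Rightarrow> complex poly" where d: "\<And>j. j \<le> k \<Longrightarrow> degree (p j) \<le> M j"
    and ae: "\<And>j. j \<le> k \<Longrightarrow> AE x in lebesgue_on {w j..<w (Suc j)}. f x = poly (p j) (of_real x)"
    by metis
  have "AE x in lebesgue. \<forall>j\<in>{..k}. x \<in> {w j..<w (Suc j)} \<longrightarrow> f x = poly (p j) (of_real x)"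
    using ae by (intro AE_finite_allI) (simp_all add: AE_restrict_space_iff)
  then have "AE x in lebesgue. x \<in> {0<..<1} \<longrightarrow> f x = piecewise k w (\<lambda>j x. poly (p j) (of_real x)) x"
  proof (rule AE_mp, intro AE_I2 impI)
    fix x assume h: "\<forall>j\<in>{..k}. x \<in> {w j..<w (Suc j)} \<longrightarrow> f x = poly (p j) (of_real x)" and "x \<in> {0<..<1::real}"
    then obtain j where j: "j \<le> k" "x \<in> {w j..<w (Suc j)}" using nodes_cover[of x] by auto
    then have "f x = poly (p j) (of_real x)" using h by blast
    then show "f x = piecewise k w (\<lambda>j x. poly (p j) (of_real x)) x" unfolding piecewise_eq[OF j] .
  qed
  then have "AE x in M01. f x = piecewise k w (\<lambda>j x. poly (p j) (of_real x)) x"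
    by (subst AE_restrict_space_iff) simp_all
  with d show ?thesis by blast
qed

end

context
  fixes k :: nat and w :: "nat \<Rightarrow> real"
  assumes nodes: "is_nodes k w"
begin

lemma min_gap_le: "j \<le> k \<Longrightarrow> min_gap k w \<le> w (Suc j) - w j"
  unfolding min_gap_def by (intro Min_le) auto

lemma min_gap_pos: "0 < min_gap k w"
  unfolding min_gap_def using nodes_less[OF nodes] by (subst Min_gr_iff) auto

text \<open>Multiplying the pieces by the cutoffs gives an approximation vanishing at all nodes, whose
  piecewise derivative is therefore a weak derivative.\<close>

lemma piecewise_poly_cutoff:
  assumes f: "f \<in> piecewise_poly k w M" and U: "U \<ge> 1"
  shows "\<exists>L G D. L-lipschitz_on {0..1} G \<and> G 0 = 0 \<and> G 1 = 0 \<and> G \<in> L2_01 \<and> D \<in> L2_01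
    \<and> (\<forall>\<omega>. fourier D \<omega> = 2 * pi * \<i> * \<omega> * fourier G \<omega>)
    \<and> (l2norm (\<lambda>x. f x - G x))\<^sup>2 \<le> (l2norm f)\<^sup>2 / real U
    \<and> (l2norm D)\<^sup>2 \<le> 144 * real U ^ 4 * ((real (max_deg k M) + 1)\<^sup>2 / min_gap k w)\<^sup>2 * (l2norm f)\<^sup>2"
proof -
  obtain p where degM: "\<forall>j\<le>k. degree (p j) \<le> M j"
    and ae: "AE x in M01. f x = piecewise k w (\<lambda>j x. poly (p j) (of_real x)) x"
    using piecewise_poly_eq_AE[OF nodes f] by blast
  define m where "m = max_deg k M"
  have deg: "degree (p j) \<le> m" if "j \<le> k" for j
  proof -
    have "M j \<le> m" unfolding m_def max_deg_def using that by (intro Max_ge) auto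
    then show ?thesis using degM that by (meson order_trans)
  qed
  define e where "e = 2 * U\<^sup>2 * (m + 1)\<^sup>2"
  have e1: "e \<ge> 1" using U by (simp add: e_def)
  define P where "P j = cutoff_poly (w j) (w (Suc j)) e * p j" for j
  have P0: "poly (P j) (of_real (w j)) = 0" "poly (P j) (of_real (w (Suc j))) = 0" if "j \<le> k" for j
    using cutoff_poly_ends[OF nodes_less[OF nodes that] deg[OF that] e1] by (simp_all add: P_def)
  let ?f = "piecewise k w (\<lambda>j x. poly (p j) (of_real x))"
  let ?g = "piecewise k w (\<lambda>j x. poly (P j) (of_real x))"
  define D where "D = piecewise k w (\<lambda>j x. poly (pderiv (P j)) (of_real x))"
  \<comment> \<open>On (0,1) this is \<open>?g\<close>, as each clamped piece vanishes outside its
    own interval. In this form the Lipschitz property and the values at 0 and 1 can be read off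
    piece by piece.\<close>
  define G where "G x = (\<Sum>j\<le>k. poly (P j) (of_real (max (w j) (min (w (Suc j)) x))))" for x
  have fL: "f \<in> L2_01" using f by (simp add: piecewise_poly_def)
  have L: "?f \<in> L2_01" "?g \<in> L2_01" "D \<in> L2_01"
    unfolding D_def by (intro L2_01_piecewise[OF nodes] poly_of_real_continuous)+
  have Gg: "G x = ?g x" if x: "x \<in> {0<..<1}" for x
  proof -
    obtain j where j: "j \<le> k" "x \<in> {w j..<w (Suc j)}"
      using nodes_cover[OF nodes, of x] x by auto
    have "poly (P i) (of_real (max (w i) (min (w (Suc i)) x))) = (if i = j then poly (P i) (of_real x) else 0)"
      if i: "i \<le> k" for i
    proof (cases i j rule: linorder_cases)
      case less
      then have "w (Suc i) \<le> x" using nodes_mono[OF nodes, of "Suc i" j] j by auto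
      then have "max (w i) (min (w (Suc i)) x) = w (Suc i)" using nodes_less[OF nodes i] by simp
      then show ?thesis using less P0[OF i] by simp
    next
      case equal
      then show ?thesis using j by simp
    next
      case greater
      then have "x \<le> w i" using nodes_mono[OF nodes, of "Suc j" i] j i by auto
      then have "max (w i) (min (w (Suc i)) x) = w i" using nodes_less[OF nodes i] by simp
      then show ?thesis using greater P0[OF i] by simp
    qed
    then have "G x = (\<Sum>i\<le>k. if i = j then poly (P i) (of_real x) else 0)"
      unfolding G_def by (intro sum.cong refl) simp
    also have "\<dots> = poly (P j) (of_real x)" using j by simp
    also have "\<dots> = ?g x" by (rule piecewise_eq[OF nodes j, symmetric])
    finally show ?thesis .
  qed
  have ends: "G 0 = 0" "G 1 = 0"
  proof -
    have r: "0 \<le> w j" "w j < w (Suc j)" "w (Suc j) \<le> 1" if "j \<le> k" for j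
      using nodes_range[OF nodes, of j] nodes_range[OF nodes, of "Suc j"] nodes_less[OF nodes that] that by auto
    have "poly (P j) (of_real (max (w j) (min (w (Suc j)) 0))) = 0" if "j \<le> k" for j
    proof -
      have "max (w j) (min (w (Suc j)) 0) = w j" using r[OF that] by simp
      then show ?thesis using P0[OF that] by simp
    qed
    then show "G 0 = 0" by (simp add: G_def)
    have "poly (P j) (of_real (max (w j) (min (w (Suc j)) 1))) = 0" if "j \<le> k" for j
    proof -
      have "max (w j) (min (w (Suc j)) 1) = w (Suc j)" using r[OF that] by simp
      then show ?thesis using P0[OF that] by simp
    qed
    then show "G 1 = 0" by (simp add: G_def)
  qed
  have "\<exists>L. L-lipschitz_on {0..1} G"
    unfolding G_def using nodes_less[OF nodes]
    by (intro lipschitz_sum lipschitz_poly_clamp) (simp_all add: less_imp_le)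
  then obtain L' where lip: "L'-lipschitz_on {0..1} G" by blast
  have GL: "G \<in> L2_01"
    using L(2) unfolding L2_01_def mem_Collect_eq
    by (subst measurable_cong[where g = ?g], simp add: Gg)
       (subst Bochner_Integration.integrable_cong[OF refl, where g = "\<lambda>x. (cmod (?g x))\<^sup>2"], simp_all add: Gg)
  have fourier_G: "fourier G \<omega> = fourier ?g \<omega>" for \<omega>
    unfolding fourier_eq by (intro Bochner_Integration.integral_cong refl) (simp add: Gg)
  have fD: "fourier D \<omega> = 2 * pi * \<i> * \<omega> * fourier G \<omega>" for \<omega>
    unfolding fourier_G D_def fourier_piecewise[OF nodes poly_of_real_continuous] sum_distrib_left
    using nodes_less[OF nodes]
    by (intro sum.cong refl integral_pderiv_expo P0) (simp_all add: less_imp_le)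
  have nf: "(l2norm f)\<^sup>2 = (\<Sum>j\<le>k. integral {w j..w (Suc j)} (\<lambda>x. (cmod (poly (p j) (of_real x)))\<^sup>2))"
    unfolding l2norm_piecewise[OF nodes poly_of_real_continuous, symmetric]
    using l2norm_cong_AE[OF ae L2_01_measurable[OF fL] L2_01_measurable[OF L(1)]] by simp
  have close: "(l2norm (\<lambda>x. f x - G x))\<^sup>2 \<le> (l2norm f)\<^sup>2 / real U"
  proof -
    let ?d = "piecewise k w (\<lambda>j x. poly (p j) (of_real x) - poly (P j) (of_real x))"
    have cd: "continuous_on UNIV (\<lambda>x. poly (p j) (of_real x) - poly (P j) (complex_of_real x))" for j
      by (intro continuous_on_diff poly_of_real_continuous)
    have dq: "?d x = ?f x - ?g x" for x
      unfolding piecewise_def by (simp only: scaleR_diff_right sum_subtractf)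
    have "AE x in M01. f x - G x = ?d x"
    proof (rule AE_mp[OF ae], rule AE_I2, rule impI)
      fix x assume "x \<in> space M01" and fx: "f x = ?f x"
      then have "G x = ?g x" by (intro Gg) simp
      then show "f x - G x = ?d x" unfolding dq fx by (rule arg_cong)
    qed
    then have ld: "l2norm (\<lambda>x. f x - G x) = l2norm ?d"
      by (rule l2norm_cong_AE[OF _ L2_01_measurable[OF L2_01_diff[OF fL GL]] L2_01_measurable[OF L2_01_piecewise[OF nodes cd]]])
    have "(l2norm (\<lambda>x. f x - G x))\<^sup>2
       = (\<Sum>j\<le>k. integral {w j..w (Suc j)} (\<lambda>x. (cmod (poly (p j) (of_real x) - poly (P j) (of_real x)))\<^sup>2))"
      unfolding ld by (rule l2norm_piecewise[OF nodes cd])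
    also have "\<dots> \<le> (\<Sum>j\<le>k. integral {w j..w (Suc j)} (\<lambda>x. (cmod (poly (p j) (of_real x)))\<^sup>2) / real U)"
      unfolding P_def
    proof (rule sum_mono)
      fix j assume "j \<in> {..k}"
      then have j: "j \<le> k" by simp
      show "integral {w j..w (Suc j)} (\<lambda>x. (cmod (poly (p j) (of_real x)
            - poly (cutoff_poly (w j) (w (Suc j)) e * p j) (of_real x)))\<^sup>2)
          \<le> integral {w j..w (Suc j)} (\<lambda>x. (cmod (poly (p j) (of_real x)))\<^sup>2) / real U"
        by (rule cutoff_poly_close[OF nodes_less[OF nodes j] deg[OF j] U e_def])
    qed
    also have "\<dots> = (l2norm f)\<^sup>2 / real U" unfolding nf sum_divide_distrib ..
    finally show ?thesis .
  qed
  have nD: "(l2norm D)\<^sup>2 \<le> 144 * real U ^ 4 * ((real (max_deg k M) + 1)\<^sup>2 / min_gap k w)\<^sup>2 * (l2norm f)\<^sup>2"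
  proof -
    have "(l2norm D)\<^sup>2 = (\<Sum>j\<le>k. integral {w j..w (Suc j)} (\<lambda>x. (cmod (poly (pderiv (P j)) (of_real x)))\<^sup>2))"
      unfolding D_def by (rule l2norm_piecewise[OF nodes poly_of_real_continuous])
    also have "\<dots> \<le> (\<Sum>j\<le>k. 144 * real U ^ 4 * ((real (max_deg k M) + 1)\<^sup>2 / min_gap k w)\<^sup>2
        * integral {w j..w (Suc j)} (\<lambda>x. (cmod (poly (p j) (of_real x)))\<^sup>2))"
    proof (rule sum_mono)
      fix j assume "j \<in> {..k}"
      then have j: "j \<le> k" by simp
      \<comment> \<open>Here the local ratios of degree to length are replaced by the one global
        ratio of the scaling condition.\<close>
      have "real ((m + 1)\<^sup>2) / (w (Suc j) - w j) \<le> (real (max_deg k M) + 1)\<^sup>2 / min_gap k w"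
        using min_gap_le[OF j] min_gap_pos nodes_less[OF nodes j] by (intro frac_le) (simp_all add: m_def add.commute)
      then have "(real ((m + 1)\<^sup>2) / (w (Suc j) - w j))\<^sup>2 \<le> ((real (max_deg k M) + 1)\<^sup>2 / min_gap k w)\<^sup>2"
        using nodes_less[OF nodes j] by (intro power_mono) simp_all
      then have "144 * real U ^ 4 * (real ((m + 1)\<^sup>2) / (w (Suc j) - w j))\<^sup>2
          * integral {w j..w (Suc j)} (\<lambda>x. (cmod (poly (p j) (of_real x)))\<^sup>2)
        \<le> 144 * real U ^ 4 * ((real (max_deg k M) + 1)\<^sup>2 / min_gap k w)\<^sup>2
          * integral {w j..w (Suc j)} (\<lambda>x. (cmod (poly (p j) (of_real x)))\<^sup>2)"
        by (intro mult_right_mono mult_left_mono integral_nonneg integrable_continuous_interval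
            continuous_intros poly_of_real_continuous) simp_all
      then show "integral {w j..w (Suc j)} (\<lambda>x. (cmod (poly (pderiv (P j)) (of_real x)))\<^sup>2)
        \<le> 144 * real U ^ 4 * ((real (max_deg k M) + 1)\<^sup>2 / min_gap k w)\<^sup>2
          * integral {w j..w (Suc j)} (\<lambda>x. (cmod (poly (p j) (of_real x)))\<^sup>2)"
        unfolding P_def
        using cutoff_poly_deriv[OF nodes_less[OF nodes j] deg[OF j] U e_def] by linarith
    qed
    also have "\<dots> = 144 * real U ^ 4 * ((real (max_deg k M) + 1)\<^sup>2 / min_gap k w)\<^sup>2 * (l2norm f)\<^sup>2"
      unfolding nf sum_distrib_left ..
    finally show ?thesis .
  qed
  show ?thesis using lip ends GL L(3) fD close nD by blast
qed

end

section \<open>The scaling condition\<close>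

lemma fourier_window_compare:
  assumes f: "f \<in> L2_01" and g: "g \<in> L2_01" and t: "0 < t" "t < 1"
  shows "integral {- real R..real R} (\<lambda>\<omega>. (cmod (fourier g \<omega>))\<^sup>2)
    \<le> integral {- real R..real R} (\<lambda>\<omega>. (cmod (fourier f \<omega>))\<^sup>2) / (1 - t) + (l2norm (\<lambda>x. f x - g x))\<^sup>2 / t"
proof -
  let ?d = "\<lambda>x. g x - f x"
  have d: "?d \<in> L2_01" by (rule L2_01_diff[OF g f])
  let ?I = "\<lambda>h. integral {- real R..real R} (\<lambda>\<omega>. (cmod (fourier h \<omega>))\<^sup>2)"
  have "?I g \<le> integral {- real R..real R} (\<lambda>\<omega>. (cmod (fourier f \<omega>))\<^sup>2 / (1 - t) + (cmod (fourier ?d \<omega>))\<^sup>2 / t)"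
  proof (intro integral_le integrable_continuous_interval continuous_intros f g d)
    fix \<omega>
    show "(cmod (fourier g \<omega>))\<^sup>2 \<le> (cmod (fourier f \<omega>))\<^sup>2 / (1 - t) + (cmod (fourier ?d \<omega>))\<^sup>2 / t"
      using norm_add_sq_le[OF t, of "fourier f \<omega>" "fourier ?d \<omega>"] by (simp add: fourier_diff f g)
  qed (use t in simp_all)
  also have "\<dots> = ?I f / (1 - t) + ?I ?d / t"
  proof -
    have i: "(\<lambda>\<omega>. (cmod (fourier f \<omega>))\<^sup>2 / (1 - t)) integrable_on {- real R..real R}"
      "(\<lambda>\<omega>. (cmod (fourier ?d \<omega>))\<^sup>2 / t) integrable_on {- real R..real R}"
      using t by (intro integrable_continuous_interval continuous_intros f d; simp)+
    show ?thesis unfolding integral_add[OF i] by (simp only: integral_divide)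
  qed
  also have "?I ?d / t \<le> (l2norm ?d)\<^sup>2 / t"
    using t by (intro divide_right_mono bessel_integral d) simp
  finally show ?thesis by (simp only: l2norm_diff_commute[of g f])
qed

lemma l2norm_compare:
  assumes f: "f \<in> L2_01" and g: "g \<in> L2_01" and t: "0 < t" "t < 1"
  shows "(l2norm f)\<^sup>2 \<le> (l2norm g)\<^sup>2 / (1 - t) + (l2norm (\<lambda>x. f x - g x))\<^sup>2 / t"
proof -
  let ?d = "\<lambda>x. f x - g x"
  have d: "?d \<in> L2_01" by (rule L2_01_diff[OF f g])
  have i: "integrable M01 (\<lambda>x. (cmod (g x))\<^sup>2 / (1 - t))" "integrable M01 (\<lambda>x. (cmod (?d x))\<^sup>2 / t)"
    by (intro integrable_divide L2_01_square_integrable g d)+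
  have "(l2norm f)\<^sup>2 \<le> (LINT x|M01. (cmod (g x))\<^sup>2 / (1 - t) + (cmod (?d x))\<^sup>2 / t)"
    unfolding l2norm_sq
  proof (intro integral_mono L2_01_square_integrable f Bochner_Integration.integrable_add i)
    fix x
    show "(cmod (f x))\<^sup>2 \<le> (cmod (g x))\<^sup>2 / (1 - t) + (cmod (?d x))\<^sup>2 / t"
      using norm_add_sq_le[OF t, of "g x" "?d x"] by simp
  qed
  also have "\<dots> = (l2norm g)\<^sup>2 / (1 - t) + (l2norm ?d)\<^sup>2 / t"
    unfolding Bochner_Integration.integral_add[OF i] l2norm_sq by simp
  finally show ?thesis .
qed

text \<open>The bound on \<open>U\<close> makes both the squared distance of \<open>f\<close> from
  its cutoff \<open>G\<close> and the tail energy of \<open>G\<close> at most \<open>t^2\<close>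
  times the squared norm of \<open>f\<close>. Passing from \<open>f\<close> to \<open>G\<close> in
  norm, and back from \<open>G\<close> to \<open>f\<close> in the window, costs factors
  \<open>1 - t\<close> and error terms of relative size \<open>t\<close>. Altogether the factor is
  (1 - t)(1 - 3t), which exceeds \<open>1 - 5 * t\<close>.\<close>

lemma window_concentration:
  assumes nodes: "is_nodes k w" and f: "f \<in> piecewise_poly k w M"
    and t: "0 < t" "t < 1" and U: "U \<ge> 1" "1 / t\<^sup>2 \<le> real U" and R: "R \<ge> 1"
    and scale: "144 * real U ^ 4 * ((real (max_deg k M) + 1)\<^sup>2 / min_gap k w)\<^sup>2 / (2 * pi * real R)\<^sup>2 \<le> 1 / real U"
  shows "(1 - 5 * t) * (l2norm f)\<^sup>2 \<le> integral {- real R..real R} (\<lambda>\<omega>. (cmod (fourier f \<omega>))\<^sup>2)"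
proof -
  obtain L G D where G: "L-lipschitz_on {0..1} G" "G 0 = 0" "G 1 = 0" "G \<in> L2_01" "D \<in> L2_01"
    "\<forall>\<omega>. fourier D \<omega> = 2 * pi * \<i> * \<omega> * fourier G \<omega>"
    and close: "(l2norm (\<lambda>x. f x - G x))\<^sup>2 \<le> (l2norm f)\<^sup>2 / real U"
    and D: "(l2norm D)\<^sup>2 \<le> 144 * real U ^ 4 * ((real (max_deg k M) + 1)\<^sup>2 / min_gap k w)\<^sup>2 * (l2norm f)\<^sup>2"
    using piecewise_poly_cutoff[OF nodes f U(1)] by blast
  have fL: "f \<in> L2_01" using f by (simp add: piecewise_poly_def)
  define X where "X = (l2norm f)\<^sup>2"
  define Y where "Y = (l2norm G)\<^sup>2"
  define Z where "Z = (l2norm (\<lambda>x. f x - G x))\<^sup>2"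
  let ?I = "\<lambda>h. integral {- real R..real R} (\<lambda>\<omega>. (cmod (fourier h \<omega>))\<^sup>2)"
  have X0: "0 \<le> X" by (simp add: X_def)
  have "1 / real U \<le> t\<^sup>2" using U t by (simp add: field_simps)
  have Z: "Z \<le> t\<^sup>2 * X"
  proof -
    have "Z \<le> 1 / real U * X" using close by (simp add: Z_def X_def)
    also have "\<dots> \<le> t\<^sup>2 * X" by (intro mult_right_mono X0 \<open>1 / real U \<le> t\<^sup>2\<close>)
    finally show ?thesis .
  qed
  have Zt: "Z / t \<le> t * X"
    using divide_right_mono[OF Z, of t] t by (simp add: power2_eq_square)
  have "X \<le> Y / (1 - t) + Z / t"
    unfolding X_def Y_def Z_def by (rule l2norm_compare[OF fL G(4) t])
  then have "(1 - t) * X \<le> Y / (1 - t)" using Zt by (simp add: algebra_simps)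
  then have Y: "(1 - t) * ((1 - t) * X) \<le> Y" using t by (simp add: pos_le_divide_eq mult.commute)
  have "(l2norm D)\<^sup>2 / (2 * pi * real R)\<^sup>2 \<le> t\<^sup>2 * X"
  proof -
    have "(l2norm D)\<^sup>2 / (2 * pi * real R)\<^sup>2
      \<le> (144 * real U ^ 4 * ((real (max_deg k M) + 1)\<^sup>2 / min_gap k w)\<^sup>2 * X) / (2 * pi * real R)\<^sup>2"
      using D by (intro divide_right_mono) (simp_all add: X_def)
    also have "\<dots> = 144 * real U ^ 4 * ((real (max_deg k M) + 1)\<^sup>2 / min_gap k w)\<^sup>2 / (2 * pi * real R)\<^sup>2 * X" by simp
    also have "\<dots> \<le> t\<^sup>2 * X"
      by (intro mult_right_mono X0 order_trans[OF scale] \<open>1 / real U \<le> t\<^sup>2\<close>)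
    finally show ?thesis .
  qed
  then have IG: "Y - t\<^sup>2 * X \<le> ?I G"
    using fourier_window_lower[OF G(1,2,3,5) G(6)[rule_format] R] by (simp add: Y_def)
  have "?I G \<le> ?I f / (1 - t) + Z / t"
    unfolding Z_def by (rule fourier_window_compare[OF fL G(4) t])
  then have "(1 - t) * ((1 - t) * X) - t\<^sup>2 * X - t * X \<le> ?I f / (1 - t)"
    using IG Y Zt by linarith
  then have "(1 - t) * ((1 - t) * ((1 - t) * X) - t\<^sup>2 * X - t * X) \<le> ?I f"
    using t by (simp add: pos_le_divide_eq mult.commute)
  moreover have "(1 - t) * ((1 - t) * ((1 - t) * X) - t\<^sup>2 * X - t * X) = (1 - 4 * t + 3 * t\<^sup>2) * X"
    by (simp add: algebra_simps power2_eq_square)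
  moreover have "(1 - 5 * t) * X \<le> (1 - 4 * t + 3 * t\<^sup>2) * X"
    using t by (intro mult_right_mono X0) simp
  ultimately show ?thesis unfolding X_def by linarith
qed

section \<open>Piecewise polynomials as a reconstruction space\<close>

lemma piecewise_poly_lin:
  assumes "f \<in> piecewise_poly k w M" "g \<in> piecewise_poly k w M"
  shows "(\<lambda>x. f x + c * g x) \<in> piecewise_poly k w M"
  unfolding piecewise_poly_def mem_Collect_eq
proof (intro conjI allI impI)
  show "(\<lambda>x. f x + c * g x) \<in> L2_01"
    using assms by (intro L2_01_add L2_01_scale) (simp_all add: piecewise_poly_def)
  fix j assume j: "j \<le> k"
  obtain p q where p: "degree p \<le> M j" "AE x in lebesgue_on {w j..<w (j + 1)}. f x = poly p (of_real x)"
    and q: "degree q \<le> M j" "AE x in lebesgue_on {w j..<w (j + 1)}. g x = poly q (of_real x)"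
    using assms j unfolding piecewise_poly_def by blast
  have "degree (p + smult c q) \<le> M j"
    using p(1) q(1) degree_smult_le[of c q] by (intro degree_add_le) auto
  moreover have "AE x in lebesgue_on {w j..<w (j + 1)}. f x + c * g x = poly (p + smult c q) (of_real x)"
    using p(2) q(2) by eventually_elim simp
  ultimately show "\<exists>p. degree p \<le> M j \<and> (AE x in lebesgue_on {w j..<w (j + 1)}. f x + c * g x = poly p (of_real x))"
    by blast
qed

lemma piecewise_poly_const: "(\<lambda>_. c) \<in> piecewise_poly k w M"
  unfolding piecewise_poly_def mem_Collect_eq
  by (intro conjI L2_01_const allI impI exI[of _ "[:c:]"]) simp_all

lemma weight_nonneg:
  assumes ud: "uniformly_dense \<delta> \<Omega> K" and N: "N \<ge> 1" and n: "n \<in> {1..N}"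
  shows "0 \<le> weight \<Omega> K N n"
proof -
  obtain m where m: "n = Suc m" using n by (cases n) auto
  then show ?thesis
    using uniformly_denseD(4)[OF ud N, of m] uniformly_denseD(4)[OF ud N, of n] n
    by (simp add: weight_def)
qed

text \<open>All three scalings of the theorem reduce to this one. The summand 1 keeps the hypothesis
  meaningful for piecewise constants, where the squared degree would vanish whatever the mesh
  is.\<close>

lemma stable_quasi_optimal_scaling:
  assumes \<delta>: "0 < \<delta>" "\<delta> < 1" and ud: "uniformly_dense \<delta> \<Omega> K"
  shows "\<exists>c>0. \<forall>k w M. (\<forall>N. is_nodes (k N) (w N)) \<longrightarrow>
     (\<forall>\<^sub>F N in sequentially. (real (max_deg (k N) (M N)) + 1)\<^sup>2 / min_gap (k N) (w N) \<le> c * K N) \<longrightarrow>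
     stable_quasi_optimal \<Omega> K (\<lambda>N. piecewise_poly (k N) (w N) (M N))"
proof -
  define \<theta> where "\<theta> = (1 + \<delta>) / 2"
  have \<theta>: "0 < \<theta>" "\<theta> < 1" "\<delta> < \<theta>" using \<delta> by (auto simp: \<theta>_def)
  \<comment> \<open>With this choice \<open>1 - 5 * t - \<theta>\<close> equals
    \<open>(1 - \<theta>) / 2\<close>: concentration beats the sampling error by a fixed margin. The
    constant \<open>c0\<close> below is this margin times the factor \<open>1 - \<theta>\<close> of
    the energy bound.\<close>
  define t where "t = (1 - \<theta>) / 10"
  have t: "0 < t" "t < 1" using \<theta> by (auto simp: t_def)
  define U where "U = max 1 (nat \<lceil>1 / t\<^sup>2\<rceil>)"
  have U: "U \<ge> 1" "1 / t\<^sup>2 \<le> real U"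
    unfolding U_def by (simp, rule order_trans[OF real_nat_ceiling_ge], simp)
  \<comment> \<open>Solves \<open>16 * U^4 * c^2 = 1 / U^2\<close>; the factor 16 is 144/9, as
    \<open>2 * pi * R\<close> will be at least \<open>3 * K N\<close>.\<close>
  define c where "c = 1 / (4 * real U ^ 3)"
  have c: "c > 0" using U by (simp add: c_def)
  define c0 where "c0 = (1 - \<theta>)\<^sup>2 / 2"
  have c0: "c0 > 0" using \<theta> by (simp add: c0_def)
  show ?thesis
  proof (intro exI[of _ c] conjI c allI impI)
    fix k :: "nat \<Rightarrow> nat" and w :: "nat \<Rightarrow> nat \<Rightarrow> real" and M :: "nat \<Rightarrow> nat \<Rightarrow> nat"
    assume nodes: "\<forall>N. is_nodes (k N) (w N)"
      and scale: "\<forall>\<^sub>F N in sequentially. (real (max_deg (k N) (M N)) + 1)\<^sup>2 / min_gap (k N) (w N) \<le> c * K N"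
    have "filterlim K at_top sequentially" using ud by (simp add: uniformly_dense_def)
    \<comment> \<open>From 4 on, an integer \<open>R\<close> between \<open>K N - 2\<close> and
      \<open>K N - 1\<close> is at least \<open>K N / 2\<close>.\<close>
    then have K4: "\<forall>\<^sub>F N in sequentially. 4 \<le> K N" by (simp add: filterlim_at_top)
    show "stable_quasi_optimal \<Omega> K (\<lambda>N. piecewise_poly (k N) (w N) (M N))"
      unfolding stable_quasi_optimal_def
    proof (rule exI[of _ "sqrt (4 / c0)"], use eventually_ge_at_top[of 1] K4 scale in eventually_elim)
      case (elim N)
      note N = elim(1) and KN = elim(2) and sc = elim(3)
      define T where "T = piecewise_poly (k N) (w N) (M N)"
      have nod: "is_nodes (k N) (w N)" using nodes by blast
      define R where "R = nat \<lfloor>K N - 1\<rfloor>"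
      have R: "real R \<le> K N - 1" "K N - 2 \<le> real R"
        using KN unfolding R_def by linarith+
      then have R1: "R \<ge> 1" and RK: "K N / 2 \<le> real R" using KN by linarith+
      let ?q = "(real (max_deg (k N) (M N)) + 1)\<^sup>2 / min_gap (k N) (w N)"
      have "144 * real U ^ 4 * ?q\<^sup>2 / (2 * pi * real R)\<^sup>2 \<le> 144 * real U ^ 4 * (c * K N)\<^sup>2 / (3 * K N)\<^sup>2"
      proof (intro frac_le mult_left_mono power_mono sc)
        show "0 \<le> ?q" using min_gap_pos[OF nod] by simp
        have "3 * K N = 2 * 3 * (K N / 2)" by simp
        also have "\<dots> \<le> 2 * pi * real R"
          using pi_gt3 RK KN by (intro mult_mono) simp_all
        finally show "3 * K N \<le> 2 * pi * real R" .
      qed (use KN in simp_all)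
      also have "\<dots> = 16 * real U ^ 4 * c\<^sup>2"
        using KN by (simp add: power_mult_distrib)
      also have "\<dots> = 1 / (real U)\<^sup>2"
      proof -
        have "real U \<noteq> 0" using U by simp
        then show ?thesis by (simp add: c_def power_divide power_mult_distrib field_simps flip: power_mult power_add)
      qed
      also have "\<dots> \<le> 1 / real U"
        using U by (intro divide_left_mono) (simp_all add: power2_eq_square)
      finally have small: "144 * real U ^ 4 * ?q\<^sup>2 / (2 * pi * real R)\<^sup>2 \<le> 1 / real U" .
      have low: "c0 * (l2norm g)\<^sup>2 \<le> sample_energy \<Omega> K N g" if g: "g \<in> T" for g
      proof -
        have gT: "g \<in> piecewise_poly (k N) (w N) (M N)" using g by (simp add: T_def)
        then have gL: "g \<in> L2_01" by (simp add: piecewise_poly_def)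
        have "c0 * (l2norm g)\<^sup>2 = (1 - \<theta>) * ((1 - 5 * t) * (l2norm g)\<^sup>2 - \<theta> * (l2norm g)\<^sup>2)"
          by (simp add: c0_def t_def power2_eq_square field_simps)
        also have "\<dots> \<le> (1 - \<theta>) * (integral {- real R..real R} (\<lambda>\<omega>. (cmod (fourier g \<omega>))\<^sup>2) - \<theta> * (l2norm g)\<^sup>2)"
          using window_concentration[OF nod gT t U R1 small] \<theta> by (intro mult_left_mono) simp_all
        also have "\<dots> \<le> sample_energy \<Omega> K N g"
          by (rule sample_energy_bounds(2)[OF ud \<theta> N gL R(1)])
        finally show ?thesis .
      qed
      have w0: "\<And>n. n \<in> {1..N} \<Longrightarrow> 0 \<le> weight \<Omega> K N n" by (rule weight_nonneg[OF ud N])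
      have TL: "T \<subseteq> L2_01" by (auto simp: T_def piecewise_poly_def)
      note qo = quasi_optimality[OF w0 TL piecewise_poly_const[of 0 "k N" "w N" "M N", folded T_def]
          piecewise_poly_lin[of _ "k N" "w N" "M N", folded T_def]
          piecewise_poly_const[of 1 "k N" "w N" "M N", folded T_def] c0 low
          sample_energy_bounds(1)[OF ud \<theta> N]]
      show ?case
        unfolding T_def[symmetric]
        by (intro conjI ballI allI impI qo)
    qed
  qed
qed

theorem mainTheorem4:
  fixes \<delta> :: real and \<Omega> :: "nat \<Rightarrow> nat \<Rightarrow> real" and K :: "nat \<Rightarrow> real"
  assumes "0 < \<delta>" and "\<delta> < 1" and "uniformly_dense \<delta> \<Omega> K"
  shows
    "(\<exists>c>0. \<forall>(k :: nat \<Rightarrow> nat) (w :: nat \<Rightarrow> nat \<Rightarrow> real) (M :: nat \<Rightarrow> nat \<Rightarrow> nat).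
        (\<forall>N. is_nodes (k N) (w N)) \<longrightarrow>
        (\<forall>N. 1 \<le> max_deg (k N) (M N)) \<longrightarrow>
        (\<forall>\<^sub>F N in sequentially.
           (real (max_deg (k N) (M N)))\<^sup>2 / min_gap (k N) (w N) \<le> c * K N) \<longrightarrow>
        stable_quasi_optimal \<Omega> K (\<lambda>N. piecewise_poly (k N) (w N) (M N)))
     \<and> (\<forall>\<eta>>0. \<exists>c>0. \<forall>(k :: nat \<Rightarrow> nat) (w :: nat \<Rightarrow> nat \<Rightarrow> real) (M :: nat \<Rightarrow> nat \<Rightarrow> nat).
        (\<forall>N. is_nodes (k N) (w N)) \<longrightarrow>
        (\<forall>N. min_gap (k N) (w N) = \<eta>) \<longrightarrow>
        (\<forall>\<^sub>F N in sequentially. real (max_deg (k N) (M N)) \<le> c * sqrt (K N)) \<longrightarrow>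
        stable_quasi_optimal \<Omega> K (\<lambda>N. piecewise_poly (k N) (w N) (M N)))
     \<and> (\<forall>m. \<exists>c>0. \<forall>(k :: nat \<Rightarrow> nat) (w :: nat \<Rightarrow> nat \<Rightarrow> real) (M :: nat \<Rightarrow> nat \<Rightarrow> nat).
        (\<forall>N. is_nodes (k N) (w N)) \<longrightarrow>
        (\<forall>N. max_deg (k N) (M N) = m) \<longrightarrow>
        (\<forall>\<^sub>F N in sequentially. 1 / min_gap (k N) (w N) \<le> c * K N) \<longrightarrow>
        stable_quasi_optimal \<Omega> K (\<lambda>N. piecewise_poly (k N) (w N) (M N)))"
proof -
  obtain c where c: "c > 0"
    and core: "\<And>k w M. \<forall>N. is_nodes (k N) (w N) \<Longrightarrow>
      \<forall>\<^sub>F N in sequentially. (real (max_deg (k N) (M N)) + 1)\<^sup>2 / min_gap (k N) (w N) \<le> c * K N \<Longrightarrow>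
      stable_quasi_optimal \<Omega> K (\<lambda>N. piecewise_poly (k N) (w N) (M N))"
    using stable_quasi_optimal_scaling[OF assms] by blast
  have K_top: "filterlim K at_top sequentially" using assms(3) by (simp add: uniformly_dense_def)
  show ?thesis
  proof (intro conjI allI impI)
    show "\<exists>c>0. \<forall>k w M. (\<forall>N. is_nodes (k N) (w N)) \<longrightarrow> (\<forall>N. 1 \<le> max_deg (k N) (M N)) \<longrightarrow>
        (\<forall>\<^sub>F N in sequentially. (real (max_deg (k N) (M N)))\<^sup>2 / min_gap (k N) (w N) \<le> c * K N) \<longrightarrow>
        stable_quasi_optimal \<Omega> K (\<lambda>N. piecewise_poly (k N) (w N) (M N))"
    \<comment> \<open>The factor 4 absorbs the summand 1: a degree of at least 1 satisfies (m + 1)^2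
      <= (2 m)^2.\<close>
    proof (intro exI[of _ "c / 4"] conjI allI impI)
      show "c / 4 > 0" using c by simp
      fix k :: "nat \<Rightarrow> nat" and w :: "nat \<Rightarrow> nat \<Rightarrow> real" and M :: "nat \<Rightarrow> nat \<Rightarrow> nat"
      assume nodes: "\<forall>N. is_nodes (k N) (w N)" and deg: "\<forall>N. 1 \<le> max_deg (k N) (M N)"
        and ev: "\<forall>\<^sub>F N in sequentially. (real (max_deg (k N) (M N)))\<^sup>2 / min_gap (k N) (w N) \<le> c / 4 * K N"
      show "stable_quasi_optimal \<Omega> K (\<lambda>N. piecewise_poly (k N) (w N) (M N))"
      proof (rule core[OF nodes], use ev in eventually_elim)
        case (elim N)
        have g: "0 < min_gap (k N) (w N)" using min_gap_pos nodes by blast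
        have "1 \<le> real (max_deg (k N) (M N))" using deg by simp
        then have "(real (max_deg (k N) (M N)) + 1)\<^sup>2 \<le> (2 * real (max_deg (k N) (M N)))\<^sup>2"
          by (intro power_mono) simp_all
        then have "(real (max_deg (k N) (M N)) + 1)\<^sup>2 / min_gap (k N) (w N)
            \<le> (4 * (real (max_deg (k N) (M N)))\<^sup>2) / min_gap (k N) (w N)"
          using g by (intro divide_right_mono) (simp_all add: power_mult_distrib)
        also have "\<dots> \<le> c * K N" using elim by (simp add: mult.commute)
        finally show ?case .
      qed
    qed
  next
    fix \<eta> :: real assume \<eta>: "\<eta> > 0"
    \<comment> \<open>By (m + 1)^2 <= 2 m^2 + 2 the bound \<open>c * \<eta> * K N\<close> is split
      in two halves: this choice of \<open>c'\<close> puts 2 m^2 below one half, and the growth of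
      \<open>K N\<close> puts 2 below the other, so that degree 0 is covered as well.\<close>
    define c' where "c' = sqrt (c * \<eta> / 4)"
    show "\<exists>c>0. \<forall>k w M. (\<forall>N. is_nodes (k N) (w N)) \<longrightarrow> (\<forall>N. min_gap (k N) (w N) = \<eta>) \<longrightarrow>
        (\<forall>\<^sub>F N in sequentially. real (max_deg (k N) (M N)) \<le> c * sqrt (K N)) \<longrightarrow>
        stable_quasi_optimal \<Omega> K (\<lambda>N. piecewise_poly (k N) (w N) (M N))"
    proof (intro exI[of _ c'] conjI allI impI)
      show "c' > 0" using c \<eta> by (simp add: c'_def)
      fix k :: "nat \<Rightarrow> nat" and w :: "nat \<Rightarrow> nat \<Rightarrow> real" and M :: "nat \<Rightarrow> nat \<Rightarrow> nat"
      assume nodes: "\<forall>N. is_nodes (k N) (w N)" and gap: "\<forall>N. min_gap (k N) (w N) = \<eta>"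
        and ev: "\<forall>\<^sub>F N in sequentially. real (max_deg (k N) (M N)) \<le> c' * sqrt (K N)"
      have ev2: "\<forall>\<^sub>F N in sequentially. 4 / (c * \<eta>) \<le> K N"
        using K_top by (simp add: filterlim_at_top)
      show "stable_quasi_optimal \<Omega> K (\<lambda>N. piecewise_poly (k N) (w N) (M N))"
      proof (rule core[OF nodes], use ev ev2 in eventually_elim)
        case (elim N)
        let ?m = "real (max_deg (k N) (M N))"
        have p: "0 < c * \<eta>" using c \<eta> by simp
        have "0 < 4 / (c * \<eta>)" using p by simp
        then have KN: "0 \<le> K N" using elim(2) by linarith
        have "?m\<^sup>2 \<le> (c' * sqrt (K N))\<^sup>2" using elim(1) by (intro power_mono) simp_all
        also have "\<dots> = c * \<eta> / 4 * K N"
          using p KN by (simp add: c'_def power_mult_distrib)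
        also have "\<dots> = (c * \<eta> * K N) / 4" by simp
        finally have 1: "?m\<^sup>2 \<le> (c * \<eta> * K N) / 4" .
        have 2: "4 \<le> c * \<eta> * K N"
          using elim(2) p by (simp add: pos_divide_le_eq mult.commute)
        have "(?m + 1)\<^sup>2 \<le> 2 * ?m\<^sup>2 + 2"
          using sum_squares_bound[of ?m 1] by (simp add: power2_sum)
        then have "(?m + 1)\<^sup>2 \<le> c * \<eta> * K N" using 1 2 by linarith
        then show ?case using gap \<eta> by (simp add: pos_divide_le_eq mult_ac)
      qed
    qed
  next
    fix m :: nat
    show "\<exists>c>0. \<forall>k w M. (\<forall>N. is_nodes (k N) (w N)) \<longrightarrow> (\<forall>N. max_deg (k N) (M N) = m) \<longrightarrow>
        (\<forall>\<^sub>F N in sequentially. 1 / min_gap (k N) (w N) \<le> c * K N) \<longrightarrow>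
        stable_quasi_optimal \<Omega> K (\<lambda>N. piecewise_poly (k N) (w N) (M N))"
    proof (intro exI[of _ "c / (real m + 1)\<^sup>2"] conjI allI impI)
      show "c / (real m + 1)\<^sup>2 > 0" using c by (simp add: add_nonneg_pos)
      fix k :: "nat \<Rightarrow> nat" and w :: "nat \<Rightarrow> nat \<Rightarrow> real" and M :: "nat \<Rightarrow> nat \<Rightarrow> nat"
      assume nodes: "\<forall>N. is_nodes (k N) (w N)" and deg: "\<forall>N. max_deg (k N) (M N) = m"
        and ev: "\<forall>\<^sub>F N in sequentially. 1 / min_gap (k N) (w N) \<le> c / (real m + 1)\<^sup>2 * K N"
      show "stable_quasi_optimal \<Omega> K (\<lambda>N. piecewise_poly (k N) (w N) (M N))"
      proof (rule core[OF nodes], use ev in eventually_elim)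
        case (elim N)
        have "0 < (real m + 1)\<^sup>2" by (simp add: add_nonneg_pos)
        then show ?case
          using mult_left_mono[OF elim, of "(real m + 1)\<^sup>2"] deg by simp
      qed
    qed
  qed
qed

end
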